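(* Let $b\colon\mathbb{T}\to\mathbb{R}$ be a smooth function with finitely many critical points. Suppose that $\{y\in\mathbb{T}: b^{(k)}(y)=0\ \ \forall k\in\mathbb{N}\}=\{y_1,\dots,y_m\}$ with $m\ge1$, and that for each $1\le i\le m$ there exist $h_i,p_i>0$ and $c_i\in\mathbb{R}$ such that $$b(y_i+h)-b(y_i)=c_i\exp\left(-\frac1{|h|^{p_i}}\right)\qquad\forall h\in[-h_i,h_i]\setminus\{0\}.$$ Then $u(x,y)=(b(y),0)$ is dissipation enhancing with rate function $$\lambda(\nu)=\nu|\log\nu|^{2/p},\qquad p=\max_{1\le i\le m}p_i.$$
   Context: $\mathbb{T}=\mathbb{R}/\mathbb{Z}$ and $\mathbb{N}=\{1,2,\dots\}$. For $b\colon\mathbb{T}\to\mathbb{R}$, the flow $u(x,y)=(b(y),0)$ on $\mathbb{T}^2$ is dissipation enhancing with rate function $\lambda\colon(0,1)\to(0,\infty)$ if $\lim_{\nu\to0}\nu/\lambda(\nu)=0$ and there exist constants $C,c>0$ (independent of $\nu$) such that for all $\nu\in(0,1)$ and all $f_0\in L^2(\mathbb{T}^2)$ with $\int_{\mathbb{T}}f_0(x,y)\,dx=0$ for all $y\in\mathbb{T}$, the solution of $\partial_tf+b(y)\partial_xf=\nu\Delta f$, $f|_{t=0}=f_0$ on $\mathbb{T}^2$ satisfies $\|f(t)\|_{L^2}\le Ce^{-c\lambda(\nu)t}\|f_0\|_{L^2}$ for all $t\ge0$. *)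

theory Defs
  imports "HOL-Analysis.Analysis"
begin

text \<open>
  Functions on the circle are 1-periodic functions on the reals. Functions that only matter up to
  null sets live on the fundamental domain [0,1), respectively its square, with Lebesgue measure.
\<close>

definition torus1 :: "real measure" where
  "torus1 = restrict_space lborel {0..<1}"

definition torus2 :: "(real \<times> real) measure" where
  "torus2 = restrict_space lborel ({0..<1} \<times> {0..<1})"

definition L2_torus :: "(real \<times> real \<Rightarrow> complex) set" where
  "L2_torus = {f \<in> borel_measurable torus2. integrable torus2 (\<lambda>z. (cmod (f z))\<^sup>2)}"

definition L2_norm :: "(real \<times> real \<Rightarrow> complex) \<Rightarrow> real" where
  "L2_norm f = sqrt (LINT z|torus2. (cmod (f z))\<^sup>2)"

definition partial_x :: "(real \<times> real \<Rightarrow> complex) \<Rightarrow> real \<times> real \<Rightarrow> complex" where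
  "partial_x \<phi> = (\<lambda>(x, y). vector_derivative (\<lambda>s. \<phi> (s, y)) (at x))"

definition partial_y :: "(real \<times> real \<Rightarrow> complex) \<Rightarrow> real \<times> real \<Rightarrow> complex" where
  "partial_y \<phi> = (\<lambda>(x, y). vector_derivative (\<lambda>s. \<phi> (x, s)) (at y))"

definition laplacian :: "(real \<times> real \<Rightarrow> complex) \<Rightarrow> real \<times> real \<Rightarrow> complex" where
  "laplacian \<phi> = (\<lambda>z. partial_x (partial_x \<phi>) z + partial_y (partial_y \<phi>) z)"

text \<open>
  Being the greatest fixed point, this says that iterated partial derivatives of every order exist
  and are (Frechet) differentiable, that is, the function is infinitely differentiable.
\<close>

coinductive smooth_plane :: "(real \<times> real \<Rightarrow> complex) \<Rightarrow> bool" where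
  "\<lbrakk>\<And>z. \<phi> differentiable (at z); smooth_plane (partial_x \<phi>); smooth_plane (partial_y \<phi>)\<rbrakk>
    \<Longrightarrow> smooth_plane \<phi>"

definition test_function :: "(real \<times> real \<Rightarrow> complex) \<Rightarrow> bool" where
  "test_function \<phi> \<longleftrightarrow> smooth_plane \<phi> \<and>
     (\<forall>x y. \<phi> (x + 1, y) = \<phi> (x, y) \<and> \<phi> (x, y + 1) = \<phi> (x, y))"

text \<open>
  Solutions for initial data in \<open>L\<^sup>2\<close> are weak solutions that are continuous in time with values
  in \<open>L\<^sup>2\<close>: for every smooth \<open>\<phi>\<close> on the torus, the equation is multiplied by \<open>\<phi>\<close>, integrated over
  the torus and over \<open>[0,t]\<close>, and the space derivatives are moved onto \<open>\<phi>\<close>. The transport term then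
  becomes \<open>f b \<partial>\<^sub>x\<phi>\<close> because \<open>b\<close> does not depend on \<open>x\<close>.
\<close>

definition advection_diffusion_solution ::
  "(real \<Rightarrow> real) \<Rightarrow> real \<Rightarrow> (real \<times> real \<Rightarrow> complex) \<Rightarrow> (real \<Rightarrow> real \<times> real \<Rightarrow> complex) \<Rightarrow> bool"
where
  "advection_diffusion_solution b \<nu> f0 f \<longleftrightarrow>
     (\<forall>t\<ge>0. f t \<in> L2_torus) \<and>
     (\<forall>t\<ge>0. ((\<lambda>s. L2_norm (\<lambda>z. f s z - f t z)) \<longlongrightarrow> 0) (at t within {0..})) \<and>
     (AE z in torus2. f 0 z = f0 z) \<and>
     (\<forall>\<phi>. test_function \<phi> \<longrightarrow> (\<forall>t\<ge>0.
        (LINT z|torus2. f t z * \<phi> z) =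
        (LINT z|torus2. f0 z * \<phi> z) +
        (LINT s:{0..t}|lborel. LINT z|torus2.
           f s z * (of_real (b (snd z)) * partial_x \<phi> z + of_real \<nu> * laplacian \<phi> z))))"

text \<open>
  Enhanced dissipation for the shear flow \<open>(x, y) \<mapsto> (b y, 0)\<close>. The mean-zero condition on each
  horizontal line is imposed for almost every \<open>y\<close>, as is meaningful for \<open>L\<^sup>2\<close> data.
\<close>

definition dissipation_enhancing :: "(real \<Rightarrow> real) \<Rightarrow> (real \<Rightarrow> real) \<Rightarrow> bool" where
  "dissipation_enhancing b rate \<longleftrightarrow>
     (\<forall>\<nu>\<in>{0<..<1}. rate \<nu> > 0) \<and>
     ((\<lambda>\<nu>. \<nu> / rate \<nu>) \<longlongrightarrow> 0) (at_right 0) \<and>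
     (\<exists>C>0. \<exists>c>0. \<forall>\<nu>\<in>{0<..<1}. \<forall>f0\<in>L2_torus. \<forall>f.
        (AE y in torus1. (LINT x|torus1. f0 (x, y)) = 0) \<longrightarrow>
        advection_diffusion_solution b \<nu> f0 f \<longrightarrow>
        (\<forall>t\<ge>0. L2_norm (f t) \<le> C * exp (- c * rate \<nu> * t) * L2_norm f0))"

end

theory Submission
  imports Defs
begin

text \<open>
  Fix a Fourier mode \<open>k \<noteq> 0\<close> in \<open>x\<close> and put \<open>\<kappa> = 2 \<pi> k\<close>. If the mode did not lose a fixed fraction of its
  energy during time \<open>T = 1 / (\<nu> \<Lambda>\<^sup>2)\<close> with \<open>\<Lambda> = \<bar>log \<nu>\<bar>\<^bsup>1/p\<^esup>\<close>, then the dissipation would be small, so at two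
  times at distance \<open>\<tau> = \<nu>\<^bsup>-1/4\<^esup>\<close> the mode would vary in \<open>y\<close> only on length scales much larger than \<open>1 / \<Lambda>\<close>.
  Over time \<open>\<tau>\<close> diffusion is negligible, hence the mode at the later time is almost \<open>exp (- i \<kappa> \<tau> b)\<close>
  times the mode at the earlier time. At distance at least \<open>K / \<Lambda>\<close> from the critical points,
  \<open>\<bar>b'\<bar>\<close> exceeds a small power of \<open>\<nu>\<close> (this is where the profile \<open>exp (- 1 / \<bar>h\<bar>\<^sup>p)\<close> enters), and
  nonstationary phase shows that two slowly varying functions related in this way carry almost no
  mass there. Neither can the mass sit within \<open>K / \<Lambda>\<close> of the critical points, because the mode varies on
  larger scales. This contradiction gives the decay of each mode, and Parseval's identity sums the modes.

  Weak solutions are made smooth by convolution with the Fejer kernel in \<open>y\<close>. The transport term leaves a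
  commutator, which is uniformly small because the kernel times \<open>sin\<^sup>2 (\<pi> s)\<close> is at most \<open>1 / N\<close>.
\<close>

section \<open>Energy balance of a mollified Fourier mode\<close>

text \<open>The exponents balance two errors. Over time \<tau> the squared distance to pure
  transport is of order \<open>\<tau>^3 / T\<close>, hence \<open>\<nu>^(1/4)\<close> up to
  logarithms; where \<open>\<bar>b'\<bar>\<close> is at least of order
  \<open>m = \<nu>^(1/16)\<close>, the phase integral is of order
  \<open>\<Lambda>^2 / (\<tau> * m^2)\<close>, hence \<open>\<nu>^(1/8)\<close> up to logarithms.
  The mass near the critical points gains no power of \<nu>: a mode with gradient of order
  \<open>c * \<Lambda>^2\<close> satisfies \<open>|G|^2 \<le> 2 + 10 * sqrt c * \<Lambda>\<close>,
  and on intervals of length of order \<open>1 / \<Lambda>\<close> this leaves a multiple of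
  \<open>sqrt c\<close>. This term forces \<open>c\<close> to be small, though independent of \<nu>,
  and it is why the rate involves exactly \<open>\<Lambda>^2\<close>. The constants are uniform in
  \<open>k\<close>, because \<kappa> enters only through \<open>\<bar>\<kappa>\<bar> \<ge> 1\<close>
  in the phase and through \<open>\<nu> * \<kappa>^2 * T \<le> 4 * c\<close>, which every stuck mode
  satisfies. Weak solutions come without an energy identity, so all estimates are made for functions
  that solve the mode equation up to a residual \<rho>; for each fixed \<open>k\<close> the residual
  tends to zero with the order of the kernel.\<close>

lemma has_vector_derivative_norm_square:
  fixes f :: "real \<Rightarrow> complex"
  assumes "(f has_vector_derivative f') (at t within S)"
  shows "((\<lambda>t. (cmod (f t))\<^sup>2) has_vector_derivative 2 * (f t \<bullet> f')) (at t within S)"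
  using bounded_bilinear.has_vector_derivative[OF bounded_bilinear_inner assms assms]
  by (simp add: power2_norm_eq_inner inner_commute)

lemma continuous_on_slice:
  fixes H :: "real \<Rightarrow> real \<Rightarrow> 'a :: topological_space"
  assumes "continuous_on (S \<times> B) (\<lambda>(t, y). H t y)" "t \<in> S"
  shows "continuous_on B (H t)"
proof -
  have "continuous_on B (\<lambda>y. (\<lambda>(t, y). H t y) (t, y))"
    using assms(2) by (intro continuous_on_compose2[OF assms(1)] continuous_intros) auto
  then show ?thesis by simp
qed

lemma integral_norm_square_derivative:
  fixes H H' :: "real \<Rightarrow> real \<Rightarrow> complex"
  assumes der: "\<And>t y. t \<in> {a..b} \<Longrightarrow> y \<in> {0..1} \<Longrightarrow>
      ((\<lambda>t. H t y) has_vector_derivative H' t y) (at t within {a..b})"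
    and H: "continuous_on ({a..b} \<times> {0..1}) (\<lambda>(t, y). H t y)"
    and H': "continuous_on ({a..b} \<times> {0..1}) (\<lambda>(t, y). H' t y)"
    and t: "t \<in> {a..b}"
  shows "((\<lambda>t. integral {0..1} (\<lambda>y. (cmod (H t y))\<^sup>2)) has_vector_derivative
      integral {0..1} (\<lambda>y. 2 * (H t y \<bullet> H' t y))) (at t within {a..b})"
  unfolding box_real(2)[symmetric]
proof (rule leibniz_rule_vector_derivative)
  fix x s :: real
  assume "x \<in> cbox a b" "s \<in> cbox 0 1"
  then show "((\<lambda>x. (cmod (H x s))\<^sup>2) has_vector_derivative 2 * (H x s \<bullet> H' x s)) (at x within cbox a b)"
    using der by (auto intro!: has_vector_derivative_norm_square)
next
  fix x :: real
  assume "x \<in> cbox a b"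
  then have "continuous_on {0..1} (H x)"
    by (intro continuous_on_slice[OF H]) auto
  then show "(\<lambda>y. (cmod (H x y))\<^sup>2) integrable_on cbox 0 1"
    by (auto intro!: integrable_continuous_interval continuous_intros)
next
  show "continuous_on (cbox a b \<times> cbox 0 1) (\<lambda>(x, s). 2 * (H x s \<bullet> H' x s))"
    using H H' by (auto simp: case_prod_beta intro!: continuous_intros)
qed (use t in auto)

lemma integral_inner_by_parts:
  fixes f g f' g' :: "real \<Rightarrow> complex"
  assumes f: "\<And>y. y \<in> {0..1} \<Longrightarrow> (f has_vector_derivative f' y) (at y within {0..1})"
    and g: "\<And>y. y \<in> {0..1} \<Longrightarrow> (g has_vector_derivative g' y) (at y within {0..1})"
    and cont: "continuous_on {0..1} f'" "continuous_on {0..1} g'"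
    and boundary: "f 1 \<bullet> g 1 = f 0 \<bullet> g 0"
  shows "integral {0..1} (\<lambda>y. f y \<bullet> g' y) = - integral {0..1} (\<lambda>y. f' y \<bullet> g y)"
proof -
  have cf: "continuous_on {0..1} f" "continuous_on {0..1} g"
    by (rule continuous_on_vector_derivative, erule f) (rule continuous_on_vector_derivative, erule g)
  have "((\<lambda>y. f y \<bullet> g' y + f' y \<bullet> g y) has_integral f 1 \<bullet> g 1 - f 0 \<bullet> g 0) {0..1}"
    by (intro fundamental_theorem_of_calculus bounded_bilinear.has_vector_derivative[OF bounded_bilinear_inner] f g) auto
  then have "integral {0..1} (\<lambda>y. f y \<bullet> g' y + f' y \<bullet> g y) = 0"
    using boundary by (simp add: integral_unique)
  moreover have "integral {0..1} (\<lambda>y. f y \<bullet> g' y + f' y \<bullet> g y) =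
      integral {0..1} (\<lambda>y. f y \<bullet> g' y) + integral {0..1} (\<lambda>y. f' y \<bullet> g y)"
    by (intro Henstock_Kurzweil_Integration.integral_add integrable_continuous_interval continuous_intros cf cont)
  ultimately show ?thesis by simp
qed

text \<open>Young's inequality with a free weight. When \<open>z\<close> is a residual, a small
  \<sigma> makes the energy term harmless, and a still smaller \<rho> pays for the division by
  \<sigma>.\<close>

lemma two_inner_le:
  fixes x z :: complex
  assumes "\<sigma> > 0" "cmod z \<le> \<rho>"
  shows "\<bar>2 * (x \<bullet> z)\<bar> \<le> \<sigma> * (cmod x)\<^sup>2 + \<rho>\<^sup>2 / \<sigma>"
proof -
  have "\<bar>x \<bullet> z\<bar> \<le> cmod x * \<rho>"
    using Cauchy_Schwarz_ineq2[of x z] mult_left_mono[OF assms(2), of "cmod x"] by simp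
  moreover have "0 \<le> (\<sigma> * cmod x - \<rho>)\<^sup>2 / \<sigma>" using assms by simp
  then have "2 * (cmod x * \<rho>) \<le> \<sigma> * (cmod x)\<^sup>2 + \<rho>\<^sup>2 / \<sigma>"
    using assms(1) by (simp add: power2_diff power2_eq_square field_simps)
  ultimately show ?thesis by (simp add: abs_mult)
qed

text \<open>This is \<open>\<partial>_t G + i \<kappa> b G = \<nu> (\<partial>_y^2 - \<kappa>^2)
  G\<close>, the equation of a Fourier mode in \<open>x\<close>, up to an error \<rho> in the
  supremum norm. The derivatives are parameters, so that their joint continuity can be assumed
  directly. Periodicity is the equality of the endpoint values of \<open>G\<close> and
  \<open>Gy\<close>, which is what integration by parts uses.\<close>

locale approximate_mode =
  fixes b b' :: "real \<Rightarrow> real" and \<kappa> \<nu> T \<rho> :: real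
    and G Gt Gy Gyy :: "real \<Rightarrow> real \<Rightarrow> complex"
  assumes b': "\<And>y. (b has_real_derivative b' y) (at y)"
    and b'_cont: "continuous_on UNIV b'"
    and b_periodic: "b 1 = b 0"
    and pos: "0 < \<nu>" "0 < T"
    and G_cont: "continuous_on ({0..T} \<times> {0..1}) (\<lambda>(t, y). G t y)"
    and Gt_cont: "continuous_on ({0..T} \<times> {0..1}) (\<lambda>(t, y). Gt t y)"
    and Gy_cont: "continuous_on ({0..T} \<times> {0..1}) (\<lambda>(t, y). Gy t y)"
    and Gyy_cont: "continuous_on ({0..T} \<times> {0..1}) (\<lambda>(t, y). Gyy t y)"
    and Gt: "\<And>t y. t \<in> {0..T} \<Longrightarrow> y \<in> {0..1} \<Longrightarrow>
      ((\<lambda>t. G t y) has_vector_derivative Gt t y) (at t within {0..T})"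
    and Gy: "\<And>t y. t \<in> {0..T} \<Longrightarrow> y \<in> {0..1} \<Longrightarrow>
      (G t has_vector_derivative Gy t y) (at y within {0..1})"
    and Gyy: "\<And>t y. t \<in> {0..T} \<Longrightarrow> y \<in> {0..1} \<Longrightarrow>
      (Gy t has_vector_derivative Gyy t y) (at y within {0..1})"
    and G_periodic: "\<And>t. t \<in> {0..T} \<Longrightarrow> G t 1 = G t 0"
    and Gy_periodic: "\<And>t. t \<in> {0..T} \<Longrightarrow> Gy t 1 = Gy t 0"
    and residual: "\<And>t y. t \<in> {0..T} \<Longrightarrow> y \<in> {0..1} \<Longrightarrow>
      cmod (Gt t y + \<i> * of_real (\<kappa> * b y) * G t y - of_real \<nu> * (Gyy t y - of_real (\<kappa>\<^sup>2) * G t y)) \<le> \<rho>"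
begin

definition R :: "real \<Rightarrow> real \<Rightarrow> complex" where
  "R t y = Gt t y + \<i> * of_real (\<kappa> * b y) * G t y - of_real \<nu> * (Gyy t y - of_real (\<kappa>\<^sup>2) * G t y)"

definition energy :: "real \<Rightarrow> real" where
  "energy t = integral {0..1} (\<lambda>y. (cmod (G t y))\<^sup>2)"

definition gradient :: "real \<Rightarrow> real" where
  "gradient t = integral {0..1} (\<lambda>y. (cmod (Gy t y))\<^sup>2)"

lemma b_cont: "continuous_on S b"
  using b' by (meson DERIV_continuous continuous_at_imp_continuous_on)

lemma R_cont: "continuous_on ({0..T} \<times> {0..1}) (\<lambda>(t, y). R t y)"
proof -
  have "continuous_on ({0..T} \<times> {0..1}) (\<lambda>z. b (snd z))"
    by (intro continuous_on_compose2[OF b_cont[of UNIV]] continuous_intros) auto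
  then show ?thesis
    using G_cont Gt_cont Gyy_cont unfolding R_def case_prod_beta
    by (intro continuous_intros) auto
qed

lemmas slices = G_cont[THEN continuous_on_slice] Gt_cont[THEN continuous_on_slice]
  Gy_cont[THEN continuous_on_slice] Gyy_cont[THEN continuous_on_slice] R_cont[THEN continuous_on_slice]

lemma Gt_eq: "Gt t y = R t y - \<i> * of_real (\<kappa> * b y) * G t y + of_real \<nu> * (Gyy t y - of_real (\<kappa>\<^sup>2) * G t y)"
  by (simp add: R_def)

lemma R_le: "t \<in> {0..T} \<Longrightarrow> y \<in> {0..1} \<Longrightarrow> cmod (R t y) \<le> \<rho>"
  using residual by (simp add: R_def)

lemma rho_nonneg: "0 \<le> \<rho>"
  using order_trans[OF norm_ge_zero R_le[of 0 0]] pos by simp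

lemma energy_nonneg: "t \<in> {0..T} \<Longrightarrow> 0 \<le> energy t" and gradient_nonneg: "t \<in> {0..T} \<Longrightarrow> 0 \<le> gradient t"
  unfolding energy_def gradient_def
  by (auto intro!: Henstock_Kurzweil_Integration.integral_nonneg integrable_continuous_interval continuous_intros slices)

lemma gradient_cont: "continuous_on {0..T} gradient"
  unfolding gradient_def box_real(2)[symmetric]
  by (rule integral_continuous_on_param)
    (use Gy_cont in \<open>auto simp: case_prod_beta intro!: continuous_intros\<close>)

text \<open>Transport conserves energy: for real \<open>s\<close>, \<open>\<i> * s * G\<close> is
  orthogonal to \<open>G\<close> in the real inner product of the complex plane. Diffusion is
  integrated by parts, so only the residual is left without a sign.\<close>

lemma energy_derivative:
  assumes t: "t \<in> {0..T}"
  shows "(energy has_vector_derivative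
    integral {0..1} (\<lambda>y. 2 * (G t y \<bullet> R t y)) - 2 * \<nu> * (gradient t + \<kappa>\<^sup>2 * energy t)) (at t within {0..T})"
proof -
  have eq: "G t y \<bullet> Gt t y = G t y \<bullet> R t y + \<nu> * (G t y \<bullet> Gyy t y) - \<nu> * \<kappa>\<^sup>2 * (cmod (G t y))\<^sup>2" for y
  proof -
    have "x \<bullet> (\<i> * of_real s * x) = 0" for x :: complex and s by (simp add: inner_complex_def)
    moreover have "x \<bullet> (of_real s * z) = s * (x \<bullet> z)" for x z :: complex and s by (simp add: inner_complex_def algebra_simps)
    ultimately show ?thesis
      by (simp only: Gt_eq power2_norm_eq_inner inner_diff_right inner_add_right) (simp add: algebra_simps)
  qed
  have ibp: "integral {0..1} (\<lambda>y. G t y \<bullet> Gyy t y) = - integral {0..1} (\<lambda>y. Gy t y \<bullet> Gy t y)"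
    using t by (intro integral_inner_by_parts Gy Gyy slices) (auto simp: G_periodic Gy_periodic)
  have "((\<lambda>y. 2 * (G t y \<bullet> R t y) + 2 * \<nu> * (G t y \<bullet> Gyy t y) - 2 * \<nu> * \<kappa>\<^sup>2 * (cmod (G t y))\<^sup>2) has_integral
      integral {0..1} (\<lambda>y. 2 * (G t y \<bullet> R t y)) + 2 * \<nu> * integral {0..1} (\<lambda>y. G t y \<bullet> Gyy t y)
        - 2 * \<nu> * \<kappa>\<^sup>2 * energy t) {0..1}"
    unfolding energy_def
    by (intro has_integral_add has_integral_diff has_integral_mult_right integrable_integral
        integrable_continuous_interval continuous_intros slices t)
  moreover have "2 * (G t y \<bullet> R t y) + 2 * \<nu> * (G t y \<bullet> Gyy t y) - 2 * \<nu> * \<kappa>\<^sup>2 * (cmod (G t y))\<^sup>2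
      = 2 * (G t y \<bullet> Gt t y)" for y
    by (simp add: eq algebra_simps)
  ultimately have "integral {0..1} (\<lambda>y. 2 * (G t y \<bullet> Gt t y)) = integral {0..1} (\<lambda>y. 2 * (G t y \<bullet> R t y)) +
      2 * \<nu> * integral {0..1} (\<lambda>y. G t y \<bullet> Gyy t y) - 2 * \<nu> * \<kappa>\<^sup>2 * energy t"
    by (simp only: integral_unique)
  also have "\<dots> = integral {0..1} (\<lambda>y. 2 * (G t y \<bullet> R t y)) - 2 * \<nu> * (gradient t + \<kappa>\<^sup>2 * energy t)"
    unfolding ibp gradient_def power2_norm_eq_inner by (simp add: algebra_simps)
  finally show ?thesis
    using integral_norm_square_derivative[OF Gt G_cont Gt_cont t] by (simp add: energy_def[abs_def])
qed

lemma energy_cont: "continuous_on {0..T} energy"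
  by (rule continuous_on_vector_derivative) (rule energy_derivative)

lemma residual_power_le:
  assumes t: "t \<in> {0..T}" and \<sigma>: "\<sigma> > 0"
  shows "\<bar>integral {0..1} (\<lambda>y. 2 * (G t y \<bullet> R t y))\<bar> \<le> \<sigma> * energy t + \<rho>\<^sup>2 / \<sigma>"
proof -
  have "norm (integral {0..1} (\<lambda>y. 2 * (G t y \<bullet> R t y))) \<le> integral {0..1} (\<lambda>y. \<sigma> * (cmod (G t y))\<^sup>2 + \<rho>\<^sup>2 / \<sigma>)"
    using two_inner_le[OF \<sigma> R_le[OF t]] t
    by (intro integral_norm_bound_integral)
       (auto intro!: integrable_continuous_interval continuous_intros slices)
  also have "\<dots> = \<sigma> * energy t + \<rho>\<^sup>2 / \<sigma>"
    unfolding energy_def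
    by (subst Henstock_Kurzweil_Integration.integral_add)
       (use t in \<open>auto intro!: integrable_continuous_interval continuous_intros slices\<close>)
  finally show ?thesis by simp
qed

text \<open>\<open>X\<close> is an a priori bound, called for because Young's inequality returns a
  multiple of the energy. The weight \<sigma> stays free: a stuck mode takes \<open>c / T\<close>,
  while the proof that mode energies decrease lets it tend to zero.\<close>

lemma energy_balance:
  assumes X: "\<And>x. x \<in> {0..T} \<Longrightarrow> energy x \<le> X" and \<sigma>: "\<sigma> > 0" and st: "0 \<le> s" "s \<le> t" "t \<le> T"
  shows "\<bar>energy t - energy s + 2 * \<nu> * integral {s..t} (\<lambda>x. gradient x + \<kappa>\<^sup>2 * energy x)\<bar>
    \<le> (t - s) * (\<sigma> * X + \<rho>\<^sup>2 / \<sigma>)"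
proof -
  define e' where "e' x = integral {0..1} (\<lambda>y. 2 * (G x y \<bullet> R x y)) - 2 * \<nu> * (gradient x + \<kappa>\<^sup>2 * energy x)" for x
  define D where "D x = gradient x + \<kappa>\<^sup>2 * energy x" for x
  have sub: "{s..t} \<subseteq> {0..T}" using st by auto
  have i1: "(e' has_integral (energy t - energy s)) {s..t}"
    using sub st unfolding e'_def
    by (intro fundamental_theorem_of_calculus has_vector_derivative_within_subset[OF energy_derivative]) auto
  have i2: "D integrable_on {s..t}"
    unfolding D_def using sub
    by (intro integrable_continuous_interval continuous_intros continuous_on_subset[OF gradient_cont] continuous_on_subset[OF energy_cont])
  have i3: "((\<lambda>x. e' x + 2 * \<nu> * D x) has_integral (energy t - energy s + 2 * \<nu> * integral {s..t} D)) {s..t}"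
    using i1 has_integral_mult_right[OF integrable_integral[OF i2], of "2 * \<nu>"] by (rule has_integral_add)
  have "norm (energy t - energy s + 2 * \<nu> * integral {s..t} D) \<le> (\<sigma> * X + \<rho>\<^sup>2 / \<sigma>) * measure lborel (cbox s t)"
  proof (rule has_integral_bound)
    show "((\<lambda>x. e' x + 2 * \<nu> * D x) has_integral (energy t - energy s + 2 * \<nu> * integral {s..t} D)) (cbox s t)"
      using i3 by simp
    have "0 \<le> X" using X[of 0] energy_nonneg[of 0] pos by simp
    then show "0 \<le> \<sigma> * X + \<rho>\<^sup>2 / \<sigma>" using \<sigma> by simp
    fix x assume "x \<in> cbox s t"
    then have x: "x \<in> {0..T}" using sub by auto
    then show "norm (e' x + 2 * \<nu> * D x) \<le> \<sigma> * X + \<rho>\<^sup>2 / \<sigma>"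
      using residual_power_le[OF x \<sigma>] mult_left_mono[OF X[OF x], of \<sigma>] \<sigma> unfolding e'_def D_def real_norm_def by linarith
  qed
  then show ?thesis using st unfolding D_def by (simp add: mult.commute)
qed

lemma dissipation_nonneg:
  assumes "0 \<le> s" "s \<le> t" "t \<le> T"
  shows "0 \<le> integral {s..t} (\<lambda>x. gradient x + \<kappa>\<^sup>2 * energy x)"
proof (rule Henstock_Kurzweil_Integration.integral_nonneg)
  show "(\<lambda>x. gradient x + \<kappa>\<^sup>2 * energy x) integrable_on {s..t}"
    using assms
    by (intro integrable_continuous_interval continuous_intros continuous_on_subset[OF gradient_cont] continuous_on_subset[OF energy_cont]) auto
qed (use assms in \<open>auto intro!: add_nonneg_nonneg mult_nonneg_nonneg gradient_nonneg energy_nonneg\<close>)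

end

text \<open>The situation that the proof by contradiction has to refute: unit initial energy, almost none of it lost.\<close>

locale stuck_mode = approximate_mode +
  fixes c :: real
  assumes c: "0 < c" "c \<le> 1 / 8"
    and start: "energy 0 = 1"
    and small: "\<rho> * T \<le> c"
    and stuck: "energy T > 1 - c"
begin

lemma balance_bound:
  assumes "\<And>x. x \<in> {0..T} \<Longrightarrow> energy x \<le> X" "0 \<le> s" "s \<le> t" "t \<le> T"
  shows "\<bar>energy t - energy s + 2 * \<nu> * integral {s..t} (\<lambda>x. gradient x + \<kappa>\<^sup>2 * energy x)\<bar> \<le> c * X + c"
proof -
  \<comment> \<open>Used as the weight, \<open>c / T\<close> turns the energy term over the whole
    time into \<open>c * X\<close>, and by \<open>\<rho> * T \<le> c\<close> the residual term into
    at most \<open>c\<close>.\<close>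
  have \<sigma>: "c / T > 0" using c pos by simp
  have "X \<ge> 0" using assms(1)[of 0] energy_nonneg[of 0] pos by simp
  have "(t - s) * (c / T * X + \<rho>\<^sup>2 / (c / T)) \<le> c * X + c"
  proof -
    have "(\<rho> * T)\<^sup>2 \<le> c\<^sup>2" using small rho_nonneg pos by (intro power_mono) auto
    then have "\<rho>\<^sup>2 * T\<^sup>2 / c \<le> c" using c by (simp add: field_simps power2_eq_square)
    have "(t - s) * (c / T * X + \<rho>\<^sup>2 / (c / T)) \<le> T * (c / T * X + \<rho>\<^sup>2 / (c / T))"
      using assms(2-4) \<open>X \<ge> 0\<close> c pos by (intro mult_right_mono add_nonneg_nonneg) auto
    also have "\<dots> = c * X + \<rho>\<^sup>2 * T\<^sup>2 / c" using pos by (simp add: algebra_simps power2_eq_square)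
    finally show ?thesis using \<open>\<rho>\<^sup>2 * T\<^sup>2 / c \<le> c\<close> by simp
  qed
  then show ?thesis using energy_balance[OF assms(1) \<sigma> assms(2-4)] by linarith
qed

text \<open>A bootstrap: the maximum of the energy serves as its own a priori bound
  \<open>X\<close>, which gives \<open>X \<le> 1 + c * X + c\<close>, and
  \<open>c \<le> 1 / 8\<close> absorbs the term on the right.\<close>

lemma energy_le_2: assumes "x \<in> {0..T}" shows "energy x \<le> 2"
proof -
  obtain z where z: "z \<in> {0..T}" "\<And>x. x \<in> {0..T} \<Longrightarrow> energy x \<le> energy z"
    using continuous_attains_sup[of "{0..T}" energy] energy_cont pos by auto
  have X0: "0 \<le> energy z" using energy_nonneg z by simp
  have "\<bar>energy z - 1 + 2 * \<nu> * integral {0..z} (\<lambda>x. gradient x + \<kappa>\<^sup>2 * energy x)\<bar> \<le> c * energy z + c"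
    using balance_bound[OF z(2), of 0 z] z start by simp
  moreover have "0 \<le> 2 * \<nu> * integral {0..z} (\<lambda>x. gradient x + \<kappa>\<^sup>2 * energy x)"
    using dissipation_nonneg[of 0 z] z pos by simp
  moreover have "c * energy z \<le> energy z / 8" using mult_right_mono[OF c(2) X0] by simp
  ultimately have "energy z \<le> 2" using c by linarith
  then show ?thesis using z(2)[OF assms] by linarith
qed

lemma balance: "0 \<le> s \<Longrightarrow> s \<le> t \<Longrightarrow> t \<le> T \<Longrightarrow>
    \<bar>energy t - energy s + 2 * \<nu> * integral {s..t} (\<lambda>x. gradient x + \<kappa>\<^sup>2 * energy x)\<bar> \<le> 3 * c"
  using balance_bound[OF energy_le_2] by simp

text \<open>Energy can hardly grow: from \<open>x\<close> to \<open>T\<close> it gains at most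
  \<open>3 * c\<close>, so it already exceeds \<open>1 - 4 * c\<close> at \<open>x\<close>.\<close>

lemma energy_ge_half: assumes "x \<in> {0..T}" shows "energy x \<ge> 1 / 2"
proof -
  have "0 \<le> 2 * \<nu> * integral {x..T} (\<lambda>x. gradient x + \<kappa>\<^sup>2 * energy x)"
    using dissipation_nonneg[of x T] assms pos by simp
  then show ?thesis using balance[of x T] assms stuck c unfolding atLeastAtMost_iff by linarith
qed

lemma dissipation_le: "2 * \<nu> * integral {0..T} (\<lambda>x. gradient x + \<kappa>\<^sup>2 * energy x) \<le> 4 * c"
  using balance[of 0 T] pos start stuck by linarith

text \<open>As the energy never falls below one half, the damping
  \<open>\<nu> * \<kappa>\<^sup>2\<close> alone dissipates at least
  \<open>\<nu> * \<kappa>\<^sup>2 * T\<close>. So a stuck mode has a bounded wavenumber, and later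
  estimates become uniform in \<kappa>.\<close>

lemma wavenumber_le: "\<nu> * \<kappa>\<^sup>2 * T \<le> 4 * c"
proof -
  have "integral {0..T} (\<lambda>x. \<kappa>\<^sup>2 * (1/2)) \<le> integral {0..T} (\<lambda>x. gradient x + \<kappa>\<^sup>2 * energy x)"
    by (rule integral_le)
      (auto intro!: integrable_continuous_interval continuous_intros gradient_cont energy_cont
         add_increasing gradient_nonneg mult_left_mono energy_ge_half simp del: times_divide_eq_right)
  then have "\<nu> * (T * \<kappa>\<^sup>2) \<le> \<nu> * (2 * integral {0..T} (\<lambda>x. gradient x + \<kappa>\<^sup>2 * energy x))"
    using pos by (intro mult_left_mono) auto
  with dissipation_le show ?thesis by (simp add: algebra_simps)
qed

lemma gradient_integral_le: "\<nu> * integral {0..T} gradient \<le> 2 * c"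
proof -
  have "integral {0..T} gradient \<le> integral {0..T} (\<lambda>x. gradient x + \<kappa>\<^sup>2 * energy x)"
    by (rule integral_le)
      (auto intro!: integrable_continuous_interval continuous_intros gradient_cont energy_cont mult_nonneg_nonneg energy_nonneg)
  then have "\<nu> * integral {0..T} gradient \<le> \<nu> * integral {0..T} (\<lambda>x. gradient x + \<kappa>\<^sup>2 * energy x)"
    using pos by (intro mult_left_mono) auto
  with dissipation_le show ?thesis by simp
qed

text \<open>Averaging over \<open>s\<close>: the integral of
  \<open>gradient s + gradient (s + \<tau>)\<close> is at most \<open>4 * c / \<nu>\<close>, over an
  interval longer than \<open>T / 2\<close>. Averaging the sum makes both gradients small for the
  same \<open>s\<close>.\<close>

lemma small_gradient_times:
  assumes \<tau>: "0 < \<tau>" "\<tau> < T / 2"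
  obtains s where "0 \<le> s" "s + \<tau> \<le> T" "gradient s + gradient (s + \<tau>) \<le> 8 * c / (\<nu> * T)"
proof (rule ccontr)
  assume "\<not> thesis"
  with that have gt: "8 * c / (\<nu> * T) \<le> gradient s + gradient (s + \<tau>)" if "s \<in> {0..T - \<tau>}" for s
    using \<tau> that by force
  have int: "gradient integrable_on {u..v}" if "0 \<le> u" "v \<le> T" for u v
    using that by (intro integrable_continuous_interval continuous_on_subset[OF gradient_cont]) auto
  have shift: "((\<lambda>s. gradient (s + \<tau>)) has_integral integral {\<tau>..T} gradient) {0..T - \<tau>}"
    using has_integral_affinity[of gradient "integral {\<tau>..T} gradient" \<tau> T 1 \<tau>] integrable_integral[OF int[of \<tau> T]] \<tau>
    by simp
  have sum: "((\<lambda>s. gradient s + gradient (s + \<tau>)) has_integral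
      integral {0..T - \<tau>} gradient + integral {\<tau>..T} gradient) {0..T - \<tau>}"
    using integrable_integral[OF int[of 0 "T - \<tau>"]] shift \<tau> by (intro has_integral_add) auto
  have "8 * c / (\<nu> * T) * (T - \<tau>) \<le> integral {0..T - \<tau>} gradient + integral {\<tau>..T} gradient"
    using has_integral_le[OF has_integral_const_real[of "8 * c / (\<nu> * T)" 0 "T - \<tau>"] sum] gt \<tau> by (simp add: mult.commute)
  moreover have "integral {0..T - \<tau>} gradient \<le> integral {0..T} gradient" "integral {\<tau>..T} gradient \<le> integral {0..T} gradient"
    using \<tau> int by (auto intro!: integral_subset_le gradient_nonneg)
  ultimately have "8 * c / (\<nu> * T) * (T - \<tau>) \<le> 2 * integral {0..T} gradient" by simp
  then have "\<nu> * (8 * c / (\<nu> * T) * (T - \<tau>)) \<le> \<nu> * (2 * integral {0..T} gradient)"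
    using pos by (intro mult_left_mono) auto
  also have "\<dots> \<le> 4 * c" using gradient_integral_le by simp
  finally have "8 * c * (T - \<tau>) \<le> 4 * c * T" using pos by (simp add: field_simps)
  then have "2 * (T - \<tau>) \<le> T" using c by simp
  then show False using \<tau> by simp
qed

end

section \<open>Phase mixing against a nonconstant shear\<close>

lemma has_vector_derivative_cis:
  assumes "(g has_real_derivative g') (at t within S)"
  shows "((\<lambda>t. cis (g t)) has_vector_derivative \<i> * of_real g' * cis (g t)) (at t within S)"
proof -
  have "((\<lambda>t. Complex (cos (g t)) (sin (g t))) has_vector_derivative Complex (- sin (g t) * g') (cos (g t) * g')) (at t within S)"
    unfolding has_vector_derivative_complex_iff
    using assms by (auto intro!: derivative_eq_intros)
  moreover have "Complex (- sin (g t) * g') (cos (g t) * g') = \<i> * of_real g' * cis (g t)"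
    by (simp add: complex_eq_iff)
  ultimately show ?thesis by (simp add: cis.code)
qed

text \<open>A one-dimensional Sobolev inequality: the minimum of \<open>|u|^2\<close> is at most its
  mean, and its variation is at most the integral of \<open>2 |u| |u'|\<close>. The weight \<omega>
  is left free because a stuck mode has bounded energy but a gradient that may be as large as a
  multiple of \<open>\<Lambda>^2\<close>.\<close>

lemma norm_square_sup_bound:
  fixes u u' :: "real \<Rightarrow> complex"
  assumes u: "\<And>y. y \<in> {0..1} \<Longrightarrow> (u has_vector_derivative u' y) (at y within {0..1})"
    and cont: "continuous_on {0..1} u'" and \<omega>: "\<omega> > 0" and y: "y \<in> {0..1}"
  shows "(cmod (u y))\<^sup>2 \<le> (1 + \<omega>) * integral {0..1} (\<lambda>y. (cmod (u y))\<^sup>2)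
    + integral {0..1} (\<lambda>y. (cmod (u' y))\<^sup>2) / \<omega>"
proof -
  have cu: "continuous_on {0..1} u" by (rule continuous_on_vector_derivative, erule u)
  obtain z where z: "z \<in> {0..1}" "\<And>x. x \<in> {0..1} \<Longrightarrow> (cmod (u z))\<^sup>2 \<le> (cmod (u x))\<^sup>2"
  proof -
    have "continuous_on {0..1} (\<lambda>x. (cmod (u x))\<^sup>2)" by (intro continuous_intros cu)
    then show thesis using continuous_attains_inf[of "{0..1}" "\<lambda>x. (cmod (u x))\<^sup>2"] that by fastforce
  qed
  define g where "g x = \<omega> * (cmod (u x))\<^sup>2 + (cmod (u' x))\<^sup>2 / \<omega>" for x
  have gi: "g integrable_on {0..1}"
    unfolding g_def by (intro integrable_continuous_interval continuous_intros cu cont) (use \<omega> in auto)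
  have gI: "integral {0..1} g = \<omega> * integral {0..1} (\<lambda>y. (cmod (u y))\<^sup>2) + integral {0..1} (\<lambda>y. (cmod (u' y))\<^sup>2) / \<omega>"
    unfolding g_def
    by (subst Henstock_Kurzweil_Integration.integral_add)
       (use \<omega> in \<open>auto intro!: integrable_continuous_interval continuous_intros cu cont simp: divide_inverse\<close>)
  have variation: "\<bar>(cmod (u q))\<^sup>2 - (cmod (u p))\<^sup>2\<bar> \<le> integral {0..1} g" if "0 \<le> p" "p \<le> q" "q \<le> 1" for p q
  proof -
    have "((\<lambda>x. 2 * (u x \<bullet> u' x)) has_integral (cmod (u q))\<^sup>2 - (cmod (u p))\<^sup>2) {p..q}"
      using that by (intro fundamental_theorem_of_calculus has_vector_derivative_norm_square
          has_vector_derivative_within_subset[OF u]) auto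
    moreover have "norm (integral {p..q} (\<lambda>x. 2 * (u x \<bullet> u' x))) \<le> integral {p..q} g"
      using that two_inner_le[OF \<omega> order_refl] unfolding g_def
      by (intro integral_norm_bound_integral integrable_continuous_interval continuous_intros
         continuous_on_subset[OF cu] continuous_on_subset[OF cont]) (use \<omega> in auto)
    moreover have "integral {p..q} g \<le> integral {0..1} g"
      using that \<omega> gi by (intro integral_subset_le integrable_subinterval_real[OF gi]) (auto simp: g_def)
    ultimately show ?thesis by (metis integral_unique order_trans real_norm_def)
  qed
  have "\<bar>(cmod (u y))\<^sup>2 - (cmod (u z))\<^sup>2\<bar> \<le> integral {0..1} g"
  proof (cases "y \<le> z")
    case True
    then show ?thesis using variation[of y z] y z(1) by (simp add: abs_minus_commute)
  qed (use variation[of z y] y z(1) in simp)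
  moreover have "integral {0..1} (\<lambda>x::real. (cmod (u z))\<^sup>2) \<le> integral {0..1} (\<lambda>x. (cmod (u x))\<^sup>2)"
    using z(2) by (intro integral_le integrable_continuous_interval continuous_intros cu) auto
  ultimately show ?thesis by (simp add: gI algebra_simps)
qed

text \<open>Since \<open>b' * cis (q * b)\<close> has the primitive
  \<open>cis (q * b) / (\<i> * q)\<close>, one integration by parts moves a derivative onto the
  amplitude \<open>w / b'\<close>, at the cost of \<open>b'' / b'^2\<close>. The bounds
  \<open>m \<le> 1\<close> and \<open>B \<le> A + 1\<close> bring all terms over the common
  denominator \<open>\<mu> * m\<^sup>2\<close>.\<close>

lemma nonstationary_phase:
  fixes w w' :: "real \<Rightarrow> complex" and b b' b'' :: "real \<Rightarrow> real"
  assumes AB: "A \<le> B" "B \<le> A + 1"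
    and w: "\<And>y. y \<in> {A..B} \<Longrightarrow> (w has_vector_derivative w' y) (at y within {A..B})"
    and w': "continuous_on {A..B} w'"
    and b: "\<And>y. (b has_real_derivative b' y) (at y)" "\<And>y. (b' has_real_derivative b'' y) (at y)"
    and b'': "continuous_on {A..B} b''"
    and W: "\<And>y. y \<in> {A..B} \<Longrightarrow> cmod (w y) \<le> W"
    and m: "0 < m" "m \<le> 1" "\<And>y. y \<in> {A..B} \<Longrightarrow> m \<le> \<bar>b' y\<bar>"
    and K: "\<And>y. y \<in> {A..B} \<Longrightarrow> \<bar>b'' y\<bar> \<le> K"
    and V: "integral {A..B} (\<lambda>y. cmod (w' y)) \<le> V"
    and \<mu>: "0 < \<mu>" "\<mu> \<le> \<bar>q\<bar>"
  shows "cmod (integral {A..B} (\<lambda>y. w y * cis (q * b y))) \<le> (2 * W + V + W * K) / (\<mu> * m\<^sup>2)"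
proof -
  define r r' where "r y = (1 / b' y)" and "r' y = (- b'' y / (b' y)\<^sup>2)" for y
  have ne: "b' y \<noteq> 0" if "y \<in> {A..B}" for y using m(3)[OF that] m(1) by auto
  have r: "(r has_real_derivative r' y) (at y within {A..B})" if "y \<in> {A..B}" for y
    unfolding r_def r'_def
    by (auto intro!: derivative_eq_intros DERIV_subset[OF b(2)] simp: ne[OF that] power2_eq_square divide_simps)
  have cb: "continuous_on {A..B} b" "continuous_on {A..B} b'"
    using b by (meson DERIV_continuous continuous_at_imp_continuous_on)+
  have cw: "continuous_on {A..B} w" by (rule continuous_on_vector_derivative, erule w)
  have cr: "continuous_on {A..B} r" "continuous_on {A..B} r'"
    unfolding r_def r'_def using ne by (auto intro!: continuous_intros cb b'')
  define e where "e y = cis (q * b y)" for y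
  have q: "q \<noteq> 0" using \<mu> by auto
  have ce: "continuous_on {A..B} e" unfolding e_def by (intro continuous_intros cb)
  define F where "F y = w y * of_real (r y) * e y" for y
  define H where "H y = (w' y * of_real (r y) + w y * of_real (r' y)) * e y" for y
  have F: "(F has_vector_derivative (H y + \<i> * of_real q * (w y * e y))) (at y within {A..B})"
    if y: "y \<in> {A..B}" for y
  proof -
    have "((\<lambda>y. complex_of_real (r y)) has_vector_derivative complex_of_real (r' y)) (at y within {A..B})"
      using r[OF y] by (rule has_vector_derivative_of_real)
    moreover have "(e has_vector_derivative (\<i> * of_real (q * b' y) * e y)) (at y within {A..B})"
      unfolding e_def by (intro has_vector_derivative_cis DERIV_cmult DERIV_subset[OF b(1)]) auto
    ultimately have dF: "(F has_vector_derivative (w y * of_real (r y) * (\<i> * of_real (q * b' y) * e y) +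
        (w y * of_real (r' y) + w' y * of_real (r y)) * e y)) (at y within {A..B})"
      unfolding F_def by (intro has_vector_derivative_mult w y)
    have one: "of_real (r y) * of_real (b' y) = (1 :: complex)"
      using ne[OF y] by (simp add: r_def)
    have eq: "w y * of_real (r y) * (\<i> * of_real (q * b' y) * e y)
        = \<i> * of_real q * (w y * e y) * (of_real (r y) * of_real (b' y))"
      by (simp add: algebra_simps)
    show ?thesis
      by (rule has_vector_derivative_eq_rhs[OF dF]) (simp only: eq one H_def mult_1_right add.commute)
  qed
  have "((\<lambda>y. H y + \<i> * of_real q * (w y * e y)) has_integral F B - F A) {A..B}"
    by (intro fundamental_theorem_of_calculus F AB)
  moreover have Hi: "(H has_integral integral {A..B} H) {A..B}"
    unfolding H_def by (intro integrable_integral integrable_continuous_interval continuous_intros cw w' cr ce)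
  ultimately have "((\<lambda>y. H y + \<i> * of_real q * (w y * e y) - H y) has_integral F B - F A - integral {A..B} H) {A..B}"
    by (rule has_integral_diff)
  then have "((\<lambda>y. (\<i> * of_real q) * (w y * e y)) has_integral F B - F A - integral {A..B} H) {A..B}"
    by simp
  from integral_unique[OF this] have "\<i> * of_real q * integral {A..B} (\<lambda>y. w y * e y) = F B - F A - integral {A..B} H"
    by (simp only: integral_mult_right)
  then have "cmod (\<i> * of_real q * integral {A..B} (\<lambda>y. w y * e y)) \<le> cmod (F B) + cmod (F A) + cmod (integral {A..B} H)"
    by (metis add_mono_thms_linordered_semiring(3) norm_triangle_ineq4 order_trans)
  then have main: "\<bar>q\<bar> * cmod (integral {A..B} (\<lambda>y. w y * e y)) \<le> cmod (F B) + cmod (F A) + cmod (integral {A..B} H)"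
    by (simp add: norm_mult)
  have W0: "0 \<le> W" using order_trans[OF norm_ge_zero W[of A]] AB by simp
  have K0: "0 \<le> K" using order_trans[OF abs_ge_zero K[of A]] AB by simp
  have rb: "\<bar>r y\<bar> \<le> 1 / m\<^sup>2" "\<bar>r' y\<bar> \<le> K / m\<^sup>2" if y: "y \<in> {A..B}" for y
  proof -
    have "m\<^sup>2 \<le> m" using m by (simp add: power2_eq_square mult_le_cancel_left1)
    then have "\<bar>r y\<bar> \<le> 1 / m" "1 / m \<le> 1 / m\<^sup>2"
      using m(1) m(3)[OF y] by (auto simp: r_def frac_le)
    then show "\<bar>r y\<bar> \<le> 1 / m\<^sup>2" by linarith
    have "m\<^sup>2 \<le> (b' y)\<^sup>2" using m(1) m(3)[OF y] by (metis abs_le_square_iff abs_of_pos)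
    then show "\<bar>r' y\<bar> \<le> K / m\<^sup>2" using K[OF y] m(1) K0 by (auto simp: r'_def abs_divide intro!: frac_le)
  qed
  have Fb: "cmod (F y) \<le> W / m\<^sup>2" if "y \<in> {A..B}" for y
    using mult_mono[OF W[OF that] rb(1)[OF that]] W0 by (simp add: F_def e_def norm_mult)
  have "cmod (integral {A..B} H) \<le> integral {A..B} (\<lambda>y. cmod (w' y) / m\<^sup>2 + W * K / m\<^sup>2)"
  proof (rule integral_norm_bound_integral)
    show "H integrable_on {A..B}" using Hi by blast
    show "(\<lambda>y. cmod (w' y) / m\<^sup>2 + W * K / m\<^sup>2) integrable_on {A..B}"
      using m by (intro integrable_continuous_interval continuous_intros w') auto
    fix y assume y: "y \<in> {A..B}"
    have "cmod (H y) \<le> cmod (w' y) * \<bar>r y\<bar> + cmod (w y) * \<bar>r' y\<bar>"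
      using norm_triangle_ineq[of "w' y * of_real (r y)" "w y * of_real (r' y)"] by (simp add: H_def e_def norm_mult)
    also have "\<dots> \<le> cmod (w' y) * (1 / m\<^sup>2) + W * (K / m\<^sup>2)"
      using rb[OF y] W[OF y] W0 by (intro add_mono mult_mono) auto
    finally show "cmod (H y) \<le> cmod (w' y) / m\<^sup>2 + W * K / m\<^sup>2" by simp
  qed
  also have "\<dots> = integral {A..B} (\<lambda>y. cmod (w' y)) / m\<^sup>2 + W * K / m\<^sup>2 * (B - A)"
    using AB m by (subst Henstock_Kurzweil_Integration.integral_add)
      (auto intro!: integrable_continuous_interval continuous_intros w')
  also have "\<dots> \<le> V / m\<^sup>2 + W * K / m\<^sup>2 * 1"
    using V m AB W0 K0 by (intro add_mono mult_left_mono divide_right_mono) auto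
  finally have "\<bar>q\<bar> * cmod (integral {A..B} (\<lambda>y. w y * e y)) \<le> (2 * W + V + W * K) / m\<^sup>2"
    using main Fb[of A] Fb[of B] AB by (simp add: add_divide_distrib)
  moreover have "\<mu> * cmod (integral {A..B} (\<lambda>y. w y * e y)) \<le> \<bar>q\<bar> * cmod (integral {A..B} (\<lambda>y. w y * e y))"
    using \<mu> by (intro mult_right_mono) auto
  ultimately have "\<mu> * cmod (integral {A..B} (\<lambda>y. w y * e y)) \<le> (2 * W + V + W * K) / m\<^sup>2" by linarith
  then show ?thesis using \<mu> m by (simp add: e_def field_simps)
qed

text \<open>Removing intervals of length \<open>2 * r\<close> around the points of \<open>Z\<close>
  leaves at most \<open>card Z + 1\<close> pieces, on which \<open>good\<close> applies. On the
  removed intervals \<open>f \<le> W\<close> and \<open>g \<ge> 0\<close> suffice.\<close>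

lemma integral_le_off_finite_set:
  fixes f g :: "real \<Rightarrow> real"
  assumes Z: "finite Z" and cont: "continuous_on {0..1} f" "continuous_on {0..1} g"
    and f: "\<And>x. x \<in> {0..1} \<Longrightarrow> f x \<le> W" and g: "\<And>x. x \<in> {0..1} \<Longrightarrow> 0 \<le> g x"
    and nonneg: "0 \<le> W" "0 \<le> \<beta>" "0 < r"
    and good: "\<And>A B. \<lbrakk>0 \<le> A; A \<le> B; B \<le> 1; \<And>y z. y \<in> {A..B} \<Longrightarrow> z \<in> Z \<Longrightarrow> r \<le> \<bar>y - z\<bar>\<rbrakk> \<Longrightarrow>
      integral {A..B} f \<le> integral {A..B} g + \<beta>"
  shows "integral {0..1} f \<le> integral {0..1} g + real (card Z) * (2 * r * W) + (real (card Z) + 1) * \<beta>"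
proof -
  have fi: "f integrable_on {A..B}" and gi: "g integrable_on {A..B}" if "0 \<le> A" "B \<le> 1" for A B
    using that cont by (auto intro!: integrable_continuous_interval elim!: continuous_on_subset)
  \<comment> \<open>Induction from the left: the segment \<open>{0..B}\<close> sees only those
    points of \<open>Z\<close> that lie in \<open>Z'\<close>, and the largest point is added last.
    Stating this through distances covers points of \<open>Z\<close> just outside the segment as
    well.\<close>
  have "\<forall>B\<in>{0..1}. (\<forall>y\<in>{0..B}. (\<forall>z\<in>Z'. r \<le> \<bar>y - z\<bar>) \<longrightarrow> (\<forall>z\<in>Z. r \<le> \<bar>y - z\<bar>)) \<longrightarrow>
      integral {0..B} f \<le> integral {0..B} g + real (card Z') * (2 * r * W) + (real (card Z') + 1) * \<beta>"
    if "finite Z'" for Z'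
    using that
  proof (induction Z' rule: finite_linorder_max_induct)
    case empty
    then show ?case using good by (auto simp: nonneg)
  next
    case (insert z Z')
    show ?case
    proof (intro ballI impI)
      fix B :: real assume B: "B \<in> {0..1}"
        and far: "\<forall>y\<in>{0..B}. (\<forall>z\<in>insert z Z'. r \<le> \<bar>y - z\<bar>) \<longrightarrow> (\<forall>z\<in>Z. r \<le> \<bar>y - z\<bar>)"
      \<comment> \<open>Clamping lets the removed interval around \<open>z\<close> stick out of
        \<open>{0..B}\<close> on either side; a piece that shrinks to a point contributes
        nothing.\<close>
      define B1 B2 where "B1 = max 0 (min B (z - r))" and "B2 = max 0 (min B (z + r))"
      have le: "0 \<le> B1" "B1 \<le> B2" "B2 \<le> B" "B \<le> 1" "B2 - B1 \<le> 2 * r"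
        using B nonneg by (auto simp: B1_def B2_def)
      have card: "card (insert z Z') = Suc (card Z')" using insert by (auto simp: card_insert_if)
      have left: "integral {0..B1} f \<le> integral {0..B1} g + real (card Z') * (2 * r * W) + (real (card Z') + 1) * \<beta>"
      proof (cases "z - r \<ge> 0")
        case True
        then have "B1 \<le> z - r" using B by (simp add: B1_def)
        have "\<forall>z\<in>Z. r \<le> \<bar>y - z\<bar>" if y: "y \<in> {0..B1}" "\<forall>z\<in>Z'. r \<le> \<bar>y - z\<bar>" for y
        proof -
          have "r \<le> \<bar>y - z\<bar>" using y(1) \<open>B1 \<le> z - r\<close> unfolding atLeastAtMost_iff by linarith
          then have "\<forall>z\<in>insert z Z'. r \<le> \<bar>y - z\<bar>" using y(2) by blast
          moreover have "y \<in> {0..B}" using y(1) le by simp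
          ultimately show ?thesis using far by blast
        qed
        moreover have "B1 \<in> {0..1}" using le by simp
        ultimately show ?thesis using insert.IH by blast
      next
        case False
        then have "B1 = 0" by (simp add: B1_def)
        then show ?thesis using nonneg by simp
      qed
      have mid: "integral {B1..B2} f \<le> 2 * r * W"
      proof -
        have "integral {B1..B2} f \<le> integral {B1..B2} (\<lambda>x. W)"
          using le by (intro integral_le fi) (auto intro!: f)
        also have "\<dots> = (B2 - B1) * W" using le by simp
        also have "\<dots> \<le> 2 * r * W" using le nonneg by (intro mult_right_mono) auto
        finally show ?thesis .
      qed
      have right: "integral {B2..B} f \<le> integral {B2..B} g + \<beta>"
      proof (cases "B2 < B")
        case True
        then have "z + r \<le> B2" by (auto simp: B2_def min_def max_def split: if_splits)
        have "r \<le> \<bar>y - x\<bar>" if y: "y \<in> {B2..B}" and x: "x \<in> Z" for y x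
        proof -
          have "r \<le> \<bar>y - x\<bar>" if "x \<in> insert z Z'" for x
          proof -
            have "x \<le> z" using that insert.hyps(2) by fastforce
            then show ?thesis using y \<open>z + r \<le> B2\<close> unfolding atLeastAtMost_iff by linarith
          qed
          moreover have "y \<in> {0..B}" using y le by simp
          ultimately show ?thesis using far x by blast
        qed
        then show ?thesis using le by (intro good) auto
      next
        case False
        then show ?thesis using le nonneg by simp
      qed
      have "0 \<le> integral {B1..B2} g" using le by (intro Henstock_Kurzweil_Integration.integral_nonneg gi) (auto intro!: g)
      moreover have "integral {0..B} f = integral {0..B1} f + integral {B1..B2} f + integral {B2..B} f"
        using le by (simp add: Henstock_Kurzweil_Integration.integral_combine fi)
      moreover have "integral {0..B} g = integral {0..B1} g + integral {B1..B2} g + integral {B2..B} g"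
        using le by (simp add: Henstock_Kurzweil_Integration.integral_combine gi)
      ultimately show "integral {0..B} f \<le> integral {0..B} g + real (card (insert z Z')) * (2 * r * W) + (real (card (insert z Z')) + 1) * \<beta>"
        using left mid right unfolding card by (simp add: algebra_simps)
    qed
  qed
  from this[OF Z] show ?thesis by simp
qed

lemma norm_diff_square_le: "(cmod (z - w))\<^sup>2 \<le> 2 * (cmod z)\<^sup>2 + 2 * (cmod w)\<^sup>2"
proof -
  have "(cmod (z - w))\<^sup>2 \<le> (cmod z + cmod w)\<^sup>2"
    by (intro power_mono norm_triangle_ineq4) auto
  also have "\<dots> \<le> 2 * (cmod z)\<^sup>2 + 2 * (cmod w)\<^sup>2"
    using zero_le_power2[of "cmod z - cmod w"] by (simp add: power2_eq_square algebra_simps)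
  finally show ?thesis .
qed

section \<open>Comparison with pure transport over the mixing time\<close>

context stuck_mode
begin

text \<open>The solution at time \<open>s + x\<close> of the mode equation with \<nu> = 0, started
  from \<open>G s\<close>. It keeps the modulus of \<open>G s\<close>; only its gradient
  grows.\<close>

definition U :: "real \<Rightarrow> real \<Rightarrow> real \<Rightarrow> complex" where
  "U s x y = cis (- (\<kappa> * x * b y)) * G s y"

definition Uy :: "real \<Rightarrow> real \<Rightarrow> real \<Rightarrow> complex" where
  "Uy s x y = cis (- (\<kappa> * x * b y)) * (Gy s y - \<i> * of_real (\<kappa> * x * b' y) * G s y)"

definition drift :: "real \<Rightarrow> real \<Rightarrow> real" where
  "drift s x = integral {0..1} (\<lambda>y. (cmod (G (s + x) y - U s x y))\<^sup>2)"

lemma norm_U: "cmod (U s x y) = cmod (G s y)"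
  by (simp add: U_def norm_mult)

context
  fixes s \<tau> L :: real
  assumes s: "0 \<le> s" and \<tau>: "0 < \<tau>" "s + \<tau> \<le> T"
    and L: "\<And>y. y \<in> {0..1} \<Longrightarrow> \<bar>b' y\<bar> \<le> L"
    and grad: "gradient s \<le> 8 * c / (\<nu> * T)"
begin

lemma shift_mem: "x \<in> {0..\<tau>} \<Longrightarrow> s + x \<in> {0..T}" "s \<in> {0..T}"
  using s \<tau> by auto

lemma U_cont: "continuous_on {0..1} (U s x)"
  unfolding U_def by (intro continuous_intros b_cont slices shift_mem)

lemma Uy_cont: "continuous_on {0..1} (Uy s x)"
  unfolding Uy_def by (intro continuous_intros b_cont slices shift_mem continuous_on_subset[OF b'_cont]) auto

lemma Uy: "y \<in> {0..1} \<Longrightarrow> (U s x has_vector_derivative Uy s x y) (at y within {0..1})"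
  unfolding U_def Uy_def
  by (rule has_vector_derivative_eq_rhs,
      rule has_vector_derivative_mult[OF has_vector_derivative_cis Gy[OF shift_mem(2)]])
     (auto intro!: derivative_eq_intros DERIV_subset[OF b'] simp: algebra_simps)

lemma U_periodic: "U s x 1 = U s x 0"
  using G_periodic[OF shift_mem(2)] b_periodic by (simp add: U_def)

text \<open>A crude bound, good enough for the residual term in the derivative of the drift, where
  it is multiplied by \<open>c / T\<close>.\<close>

lemma drift_le_8: assumes x: "x \<in> {0..\<tau>}" shows "drift s x \<le> 8"
proof -
  have "drift s x \<le> integral {0..1} (\<lambda>y. 2 * (cmod (G (s + x) y))\<^sup>2 + 2 * (cmod (G s y))\<^sup>2)"
    unfolding drift_def
    using norm_diff_square_le[of "G (s + x) _" "U s x _"] unfolding norm_U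
    by (intro integral_le integrable_continuous_interval continuous_intros U_cont slices shift_mem x) auto
  also have "\<dots> = 2 * energy (s + x) + 2 * energy s"
    unfolding energy_def
    by (subst Henstock_Kurzweil_Integration.integral_add)
       (auto intro!: integrable_continuous_interval continuous_intros slices shift_mem x)
  also have "\<dots> \<le> 8" using energy_le_2[OF shift_mem(1)[OF x]] energy_le_2[OF shift_mem(2)] by simp
  finally show ?thesis .
qed

text \<open>The phase adds \<open>\<kappa> * x * b'\<close> to the gradient, linear in the elapsed
  time \<open>x \<le> \<tau>\<close>; the rest is the gradient at time \<open>s\<close>, small by
  the choice of \<open>s\<close>.\<close>

lemma integral_norm_square_Uy_le:
  assumes x: "x \<in> {0..\<tau>}"
  shows "integral {0..1} (\<lambda>y. (cmod (Uy s x y))\<^sup>2) \<le> 16 * c / (\<nu> * T) + 4 * \<kappa>\<^sup>2 * \<tau>\<^sup>2 * L\<^sup>2"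
proof -
  have pt: "(cmod (Uy s x y))\<^sup>2 \<le> 2 * (cmod (Gy s y))\<^sup>2 + 2 * (\<kappa>\<^sup>2 * \<tau>\<^sup>2 * L\<^sup>2) * (cmod (G s y))\<^sup>2" if y: "y \<in> {0..1}" for y
  proof -
    have "(\<kappa> * x * b' y)\<^sup>2 \<le> \<kappa>\<^sup>2 * \<tau>\<^sup>2 * L\<^sup>2"
      unfolding power_mult_distrib
    proof (intro mult_mono)
      show "x\<^sup>2 \<le> \<tau>\<^sup>2" using x by (intro power_mono) auto
      show "(b' y)\<^sup>2 \<le> L\<^sup>2" using power_mono[OF L[OF y], of 2] by simp
    qed auto
    from mult_right_mono[OF this, of "2 * (cmod (G s y))\<^sup>2"]
    moreover have "cmod (Uy s x y) = cmod (Gy s y - \<i> * of_real (\<kappa> * x * b' y) * G s y)"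
      by (simp add: Uy_def norm_mult)
    ultimately show ?thesis
      using norm_diff_square_le[of "Gy s y" "\<i> * of_real (\<kappa> * x * b' y) * G s y"]
      by (simp add: norm_mult power_mult_distrib abs_mult algebra_simps)
  qed
  have "integral {0..1} (\<lambda>y. (cmod (Uy s x y))\<^sup>2) \<le>
      integral {0..1} (\<lambda>y. 2 * (cmod (Gy s y))\<^sup>2 + 2 * (\<kappa>\<^sup>2 * \<tau>\<^sup>2 * L\<^sup>2) * (cmod (G s y))\<^sup>2)"
    by (intro integral_le integrable_continuous_interval continuous_intros Uy_cont slices shift_mem pt)
  also have "\<dots> = 2 * gradient s + 2 * (\<kappa>\<^sup>2 * \<tau>\<^sup>2 * L\<^sup>2) * energy s"
    unfolding energy_def gradient_def
    by (subst Henstock_Kurzweil_Integration.integral_add)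
       (auto intro!: integrable_continuous_interval continuous_intros slices shift_mem)
  also have "\<dots> \<le> 2 * (8 * c / (\<nu> * T)) + 2 * (\<kappa>\<^sup>2 * \<tau>\<^sup>2 * L\<^sup>2) * 2"
    using grad energy_le_2[OF shift_mem(2)] by (intro add_mono mult_left_mono) auto
  finally show ?thesis by simp
qed

text \<open>With \<open>D = G (s + x) - U\<close>, the transport part of \<open>D'\<close> is
  orthogonal to \<open>D\<close>. Nothing is known about the gradient of \<open>G\<close> at
  intermediate times, but after integration by parts the diffusion enters as
  \<open>- |Gy|^2 + Uy \<bullet> Gy \<le> |Uy|^2 / 4\<close>, and \<open>Uy\<close> is explicit. The
  constant collects 9 from the residual, 8 from \<open>gradient s\<close>, and
  \<open>4 + 8 * \<tau>\<^sup>2 * L\<^sup>2\<close> from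
  \<open>\<nu> * \<kappa>\<^sup>2 \<le> 4 * c / T\<close>.\<close>

lemma drift_derivative_le:
  assumes x: "x \<in> {0..\<tau>}"
  obtains d where "(drift s has_vector_derivative d) (at x within {0..\<tau>})" "d \<le> c / T * (21 + 8 * \<tau>\<^sup>2 * L\<^sup>2)"
proof -
  define D where "D x y = G (s + x) y - U s x y" for x y
  define D' where "D' x y = Gt (s + x) y + \<i> * of_real (\<kappa> * b y) * U s x y" for x y
  have der: "((\<lambda>x. D x y) has_vector_derivative D' x y) (at x within {0..\<tau>})" if "x \<in> {0..\<tau>}" "y \<in> {0..1}" for x y
  proof -
    have "((\<lambda>x. G (s + x) y) has_vector_derivative Gt (s + x) y) (at x within {0..\<tau>})"
    proof -
      have "(((\<lambda>t. G t y) \<circ> (\<lambda>x. s + x)) has_vector_derivative 1 *\<^sub>R Gt (s + x) y) (at x within {0..\<tau>})"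
        by (rule vector_diff_chain_within)
          (use s \<tau> in \<open>auto intro!: derivative_eq_intros has_vector_derivative_within_subset[OF Gt] that shift_mem(1) simp: image_subset_iff\<close>)
      then show ?thesis by (simp add: o_def)
    qed
    moreover have "((\<lambda>x. U s x y) has_vector_derivative - (\<i> * of_real (\<kappa> * b y) * U s x y)) (at x within {0..\<tau>})"
      unfolding U_def
      by (rule has_vector_derivative_eq_rhs,
          rule has_vector_derivative_mult_left[OF has_vector_derivative_cis])
         (auto intro!: derivative_eq_intros simp: algebra_simps)
    ultimately have "((\<lambda>x. D x y) has_vector_derivative Gt (s + x) y - (- (\<i> * of_real (\<kappa> * b y) * U s x y))) (at x within {0..\<tau>})"
      unfolding D_def by (rule has_vector_derivative_diff)
    then show ?thesis by (simp add: D'_def)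
  qed
  have bsnd: "continuous_on ({0..\<tau>} \<times> {0..1}) (\<lambda>z. b (snd z))"
    by (intro continuous_on_compose2[OF b_cont[of UNIV]] continuous_intros) auto
  have Gs: "continuous_on ({0..\<tau>} \<times> {0..1}) (\<lambda>z. G s (snd z))"
    by (intro continuous_on_compose2[OF slices(1)[OF shift_mem(2)]] continuous_intros) auto
  have Ucont: "continuous_on ({0..\<tau>} \<times> {0..1}) (\<lambda>z. U s (fst z) (snd z))"
    unfolding U_def by (intro continuous_intros bsnd Gs)
  have shiftcont: "continuous_on ({0..\<tau>} \<times> {0..1}) (\<lambda>z. H (s + fst z) (snd z))"
    if H: "continuous_on ({0..T} \<times> {0..1}) (\<lambda>(t, y). H t y)" for H :: "real \<Rightarrow> real \<Rightarrow> complex"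
  proof -
    have "continuous_on ({0..\<tau>} \<times> {0..1}) (\<lambda>z. (\<lambda>(t, y). H t y) (s + fst z, snd z))"
      using shift_mem by (intro continuous_on_compose2[OF H] continuous_intros) auto
    then show ?thesis by simp
  qed
  have Dcont: "continuous_on ({0..\<tau>} \<times> {0..1}) (\<lambda>(x, y). D x y)"
    unfolding D_def case_prod_beta by (intro continuous_intros Ucont shiftcont[OF G_cont])
  have D'cont: "continuous_on ({0..\<tau>} \<times> {0..1}) (\<lambda>(x, y). D' x y)"
    unfolding D'_def case_prod_beta by (intro continuous_intros Ucont shiftcont[OF Gt_cont] bsnd)
  define t where "t = s + x"
  have t: "t \<in> {0..T}" using shift_mem(1)[OF x] by (simp add: t_def)
  have eq: "2 * (D x y \<bullet> D' x y) = 2 * (D x y \<bullet> R t y) + 2 * \<nu> * (D x y \<bullet> Gyy t y) - 2 * \<nu> * \<kappa>\<^sup>2 * (D x y \<bullet> G t y)" for y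
  proof -
    have e: "D' x y = R t y - \<i> * of_real (\<kappa> * b y) * D x y + of_real \<nu> * (Gyy t y - of_real (\<kappa>\<^sup>2) * G t y)"
      by (simp add: D'_def D_def Gt_eq t_def algebra_simps)
    have "x \<bullet> (\<i> * of_real s * x) = 0" for x :: complex and s by (simp add: inner_complex_def)
    moreover have "x \<bullet> (of_real s * z) = s * (x \<bullet> z)" for x z :: complex and s by (simp add: inner_complex_def algebra_simps)
    ultimately show ?thesis
      by (simp only: e inner_diff_right inner_add_right) (simp add: algebra_simps)
  qed
  have Dc: "continuous_on {0..1} (D x)" by (rule continuous_on_slice[OF Dcont x])
  note ci = Dc slices[OF t] Uy_cont U_cont
  have "integral {0..1} (\<lambda>y. D x y \<bullet> Gyy t y) = - integral {0..1} (\<lambda>y. (Gy t y - Uy s x y) \<bullet> Gy t y)"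
    unfolding D_def t_def[symmetric]
    by (intro integral_inner_by_parts has_vector_derivative_diff Gy Uy Gyy t continuous_intros ci)
       (simp_all add: G_periodic[OF t] Gy_periodic[OF t] U_periodic)
  also have "\<dots> \<le> integral {0..1} (\<lambda>y. (cmod (Uy s x y))\<^sup>2 / 4)"
    unfolding integral_neg[symmetric]
  proof (intro integral_le integrable_continuous_interval continuous_intros ci)
    fix y :: real
    have "0 \<le> (2 *\<^sub>R Gy t y - Uy s x y) \<bullet> (2 *\<^sub>R Gy t y - Uy s x y)" by simp
    then show "- ((Gy t y - Uy s x y) \<bullet> Gy t y) \<le> (cmod (Uy s x y))\<^sup>2 / 4"
      unfolding power2_norm_eq_inner by (simp add: inner_diff_left inner_diff_right inner_commute)
  qed simp
  finally have I2: "integral {0..1} (\<lambda>y. D x y \<bullet> Gyy t y) \<le> (16 * c / (\<nu> * T) + 4 * \<kappa>\<^sup>2 * \<tau>\<^sup>2 * L\<^sup>2) / 4"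
    using integral_norm_square_Uy_le[OF x] by simp
  have "- integral {0..1} (\<lambda>y. D x y \<bullet> G t y) \<le> integral {0..1} (\<lambda>y. (cmod (G s y))\<^sup>2 / 4)"
    unfolding integral_neg[symmetric]
  proof (intro integral_le integrable_continuous_interval continuous_intros ci slices shift_mem)
    fix y :: real
    have "0 \<le> (2 *\<^sub>R G t y - U s x y) \<bullet> (2 *\<^sub>R G t y - U s x y)" by simp
    then show "- (D x y \<bullet> G t y) \<le> (cmod (G s y))\<^sup>2 / 4"
      unfolding norm_U[of s x, symmetric] power2_norm_eq_inner D_def t_def[symmetric] by (simp add: inner_diff_left inner_diff_right inner_commute)
  qed simp
  then have I3: "- integral {0..1} (\<lambda>y. D x y \<bullet> G t y) \<le> 1 / 2"
    using energy_le_2[OF shift_mem(2)] by (simp add: energy_def)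
  have \<sigma>: "c / T > 0" using c pos by simp
  have "integral {0..1} (\<lambda>y. 2 * (D x y \<bullet> R t y)) \<le> integral {0..1} (\<lambda>y. c / T * (cmod (D x y))\<^sup>2 + \<rho>\<^sup>2 / (c / T))"
  proof (intro integral_le integrable_continuous_interval continuous_intros ci)
    fix y :: real assume "y \<in> {0..1}"
    then show "2 * (D x y \<bullet> R t y) \<le> c / T * (cmod (D x y))\<^sup>2 + \<rho>\<^sup>2 / (c / T)"
      using two_inner_le[OF \<sigma> R_le[OF t]] by (meson abs_le_iff)
  qed
  also have "\<dots> = c / T * drift s x + \<rho>\<^sup>2 / (c / T)"
    unfolding drift_def D_def[symmetric]
    by (subst Henstock_Kurzweil_Integration.integral_add)
       (use pos in \<open>auto intro!: integrable_continuous_interval continuous_intros ci\<close>)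
  also have "\<dots> \<le> c / T * 8 + c / T"
  proof (intro add_mono mult_left_mono drift_le_8 x)
    have "\<rho> \<le> c / T" using small pos by (simp add: field_simps)
    then have "\<rho>\<^sup>2 \<le> (c / T)\<^sup>2" using rho_nonneg by (intro power_mono) auto
    then show "\<rho>\<^sup>2 / (c / T) \<le> c / T" using \<sigma> by (simp only: pos_divide_le_eq power2_eq_square)
  qed (use \<sigma> in simp)
  finally have I1: "integral {0..1} (\<lambda>y. 2 * (D x y \<bullet> R t y)) \<le> 9 * (c / T)" by simp
  have I: "integral {0..1} (\<lambda>y. 2 * (D x y \<bullet> D' x y)) = integral {0..1} (\<lambda>y. 2 * (D x y \<bullet> R t y))
      + 2 * \<nu> * integral {0..1} (\<lambda>y. D x y \<bullet> Gyy t y) - 2 * \<nu> * \<kappa>\<^sup>2 * integral {0..1} (\<lambda>y. D x y \<bullet> G t y)"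
    unfolding eq
    by (intro integral_unique has_integral_add has_integral_diff has_integral_mult_right integrable_integral
        integrable_continuous_interval continuous_intros ci)
  have \<nu>\<kappa>: "\<nu> * \<kappa>\<^sup>2 \<le> 4 * (c / T)" using wavenumber_le pos by (simp add: field_simps)
  have "integral {0..1} (\<lambda>y. 2 * (D x y \<bullet> D' x y)) \<le> 9 * (c / T)
      + 2 * \<nu> * ((16 * c / (\<nu> * T) + 4 * \<kappa>\<^sup>2 * \<tau>\<^sup>2 * L\<^sup>2) / 4) + 2 * \<nu> * \<kappa>\<^sup>2 * (1 / 2)"
  proof -
    have "0 \<le> 2 * \<nu>" "0 \<le> 2 * \<nu> * \<kappa>\<^sup>2" using pos by simp_all
    then show ?thesis
      using I I1 mult_left_mono[OF I2, of "2 * \<nu>"] mult_left_mono[OF I3, of "2 * \<nu> * \<kappa>\<^sup>2"]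
      unfolding mult_minus_right by linarith
  qed
  also have "\<dots> = 17 * (c / T) + (\<nu> * \<kappa>\<^sup>2) * (2 * \<tau>\<^sup>2 * L\<^sup>2 + 1)"
    using pos by (simp add: field_simps)
  also have "\<dots> \<le> 17 * (c / T) + 4 * (c / T) * (2 * \<tau>\<^sup>2 * L\<^sup>2 + 1)"
    using \<nu>\<kappa> by (intro add_left_mono mult_right_mono) auto
  also have "\<dots> = c / T * (21 + 8 * \<tau>\<^sup>2 * L\<^sup>2)" by (simp add: algebra_simps)
  finally have "integral {0..1} (\<lambda>y. 2 * (D x y \<bullet> D' x y)) \<le> c / T * (21 + 8 * \<tau>\<^sup>2 * L\<^sup>2)" .
  moreover have "(drift s has_vector_derivative integral {0..1} (\<lambda>y. 2 * (D x y \<bullet> D' x y))) (at x within {0..\<tau>})"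
    using integral_norm_square_derivative[OF der Dcont D'cont x] by (simp add: drift_def[abs_def] D_def)
  ultimately show thesis using that by blast
qed

lemma drift_le: "drift s \<tau> \<le> \<tau> * (c / T * (21 + 8 * \<tau>\<^sup>2 * L\<^sup>2))"
proof -
  have "\<exists>d. \<forall>x\<in>{0..\<tau>}. (drift s has_vector_derivative d x) (at x within {0..\<tau>}) \<and> d x \<le> c / T * (21 + 8 * \<tau>\<^sup>2 * L\<^sup>2)"
    using drift_derivative_le by (intro bchoice) blast
  then obtain d where d: "\<And>x. x \<in> {0..\<tau>} \<Longrightarrow> (drift s has_vector_derivative d x) (at x within {0..\<tau>})"
    "\<And>x. x \<in> {0..\<tau>} \<Longrightarrow> d x \<le> c / T * (21 + 8 * \<tau>\<^sup>2 * L\<^sup>2)" by blast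
  have "(d has_integral drift s \<tau> - drift s 0) {0..\<tau>}"
    using \<tau> by (intro fundamental_theorem_of_calculus d) auto
  then have "drift s \<tau> - drift s 0 \<le> \<tau> * (c / T * (21 + 8 * \<tau>\<^sup>2 * L\<^sup>2))"
    using has_integral_le[OF _ has_integral_const_real[of "c / T * (21 + 8 * \<tau>\<^sup>2 * L\<^sup>2)" 0 \<tau>] d(2)] \<tau> by auto
  moreover have "drift s 0 = 0" by (simp add: drift_def U_def)
  ultimately show ?thesis by simp
qed

end
end

text \<open>The three summands bound the distance to pure transport, the mass within
  \<open>r\<close> of \<open>Z\<close> (where \<open>W\<close> bounds \<open>|G|^2\<close> at the
  two chosen times), and the phase integrals \<beta> on the intervals between. The left side is
  three quarters of the least possible energy one half.\<close>

lemma (in stuck_mode) stuck_inequality: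
  fixes Z :: "real set" and b'' :: "real \<Rightarrow> real" and \<tau> L K r m \<omega> P W \<beta> :: real
  assumes b'': "\<And>y. (b' has_real_derivative b'' y) (at y)" "continuous_on UNIV b''"
    and \<tau>: "0 < \<tau>" "\<tau> < T / 2"
    and L: "\<And>y. y \<in> {0..1} \<Longrightarrow> \<bar>b' y\<bar> \<le> L"
    and K: "\<And>y. y \<in> {0..1} \<Longrightarrow> \<bar>b'' y\<bar> \<le> K"
    and Z: "finite Z" and r: "0 < r" and m: "0 < m" "m \<le> 1"
    and off: "\<And>y. y \<in> {0..1} \<Longrightarrow> (\<And>z. z \<in> Z \<Longrightarrow> r \<le> \<bar>y - z\<bar>) \<Longrightarrow> m \<le> \<bar>b' y\<bar>"
    and \<kappa>: "1 \<le> \<bar>\<kappa>\<bar>" and \<omega>: "0 < \<omega>"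
  defines "P \<equiv> 8 * c / (\<nu> * T)"
  defines "W \<equiv> 2 * (1 + \<omega>) + P / \<omega>"
  defines "\<beta> \<equiv> (2 * W + (P / 2 + 2) + W * K) / (\<tau> * m\<^sup>2)"
  shows "3 / 8 \<le> \<tau> * (c / T * (21 + 8 * \<tau>\<^sup>2 * L\<^sup>2)) + real (card Z) * (2 * r * W) + (real (card Z) + 1) * \<beta>"
proof -
  obtain s where s: "0 \<le> s" "s + \<tau> \<le> T" and grad: "gradient s + gradient (s + \<tau>) \<le> P"
    using small_gradient_times[OF \<tau>] unfolding P_def by blast
  have mem: "s \<in> {0..T}" "s + \<tau> \<in> {0..T}" using s \<tau> by auto
  note gn = gradient_nonneg[OF mem(1)] gradient_nonneg[OF mem(2)]
  have gs: "gradient s \<le> P" "gradient (s + \<tau>) \<le> P" using grad gn by auto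
  note hyps = s(1) \<tau>(1) s(2) L gs(1)[unfolded P_def]
  note drift = drift_le[OF hyps]
  define V where "V y = U s \<tau> y" for y
  have V_cont: "continuous_on {0..1} V"
    unfolding V_def[abs_def] by (rule U_cont[OF hyps])
  have normV: "cmod (V y) = cmod (G s y)" for y by (simp add: V_def norm_U)
  have sup: "(cmod (G t y))\<^sup>2 \<le> W" if t: "t \<in> {0..T}" "gradient t \<le> P" and y: "y \<in> {0..1}" for t y
  proof -
    have "(cmod (G t y))\<^sup>2 \<le> (1 + \<omega>) * energy t + gradient t / \<omega>"
      unfolding energy_def gradient_def by (rule norm_square_sup_bound[OF Gy[OF t(1)] slices(3)[OF t(1)] \<omega> y])
    also have "\<dots> \<le> (1 + \<omega>) * 2 + P / \<omega>"
      using \<omega> t energy_le_2[OF t(1)] by (intro add_mono mult_left_mono divide_right_mono) auto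
    finally show ?thesis by (simp add: W_def)
  qed
  have P0: "0 \<le> P" using c pos by (simp add: P_def)
  have W0: "0 \<le> W" using \<omega> P0 by (simp add: W_def)
  have K0: "0 \<le> K" using order_trans[OF abs_ge_zero K[of 0]] by simp
  have \<beta>0: "0 \<le> \<beta>" using W0 P0 K0 \<tau> m by (simp add: \<beta>_def)
  define f where "f y = (cmod (G s y))\<^sup>2" for y
  define g where "g y = (cmod (G (s + \<tau>) y - V y))\<^sup>2 + (cmod (G s y))\<^sup>2 / 4" for y
  \<comment> \<open>\<open>V\<close> itself oscillates rapidly, so its phase is split off:
    \<open>G (s + \<tau>) * cnj V\<close> equals \<open>w * cis (\<kappa> * \<tau> * b)\<close>, and
    both factors of \<open>w\<close> have their gradients bounded by \<open>P\<close>.\<close>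
  define w where "w y = G (s + \<tau>) y * cnj (G s y)" for y
  define w' where "w' y = G (s + \<tau>) y * cnj (Gy s y) + Gy (s + \<tau>) y * cnj (G s y)" for y
  note ci = slices[OF mem(1)] slices[OF mem(2)] V_cont
  have fc: "continuous_on {0..1} f" and gc: "continuous_on {0..1} g" and w'c: "continuous_on {0..1} w'"
    and wc: "continuous_on {0..1} w"
    unfolding f_def g_def w_def w'_def by (intro continuous_intros ci; simp)+
  have w: "(w has_vector_derivative w' y) (at y within {0..1})" if "y \<in> {0..1}" for y
    unfolding w_def w'_def
    by (intro has_vector_derivative_mult Gy mem that bounded_linear.has_vector_derivative[OF bounded_linear_cnj])
  have amgm: "cmod z * cmod z' \<le> ((cmod z)\<^sup>2 + (cmod z')\<^sup>2) / 2" for z z'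
    using zero_le_power2[of "cmod z - cmod z'"] by (simp add: power2_diff)
  have wW: "cmod (w y) \<le> W" if "y \<in> {0..1}" for y
    using amgm[of "G (s + \<tau>) y" "G s y"] sup[OF mem(1) gs(1) that] sup[OF mem(2) gs(2) that]
    by (simp add: w_def norm_mult)
  \<comment> \<open>A majorant of \<open>|w'|\<close>. Its integral is half the sum of two energies
    and two gradients, at most \<open>(4 + P) / 2\<close>.\<close>
  define h where "h y = ((cmod (G (s + \<tau>) y))\<^sup>2 + (cmod (Gy s y))\<^sup>2) / 2 + ((cmod (Gy (s + \<tau>) y))\<^sup>2 + (cmod (G s y))\<^sup>2) / 2" for y
  have hc: "continuous_on {0..1} h" unfolding h_def by (intro continuous_intros ci; simp)
  have hI: "integral {0..1} h \<le> P / 2 + 2"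
  proof -
    have "integral {0..1} h = (energy (s + \<tau>) + gradient s) / 2 + (gradient (s + \<tau>) + energy s) / 2"
      unfolding h_def energy_def gradient_def
      by (intro integral_unique has_integral_add has_integral_divide integrable_integral
          integrable_continuous_interval continuous_intros ci)
    moreover have "(energy (s + \<tau>) + gradient s) / 2 + (gradient (s + \<tau>) + energy s) / 2
        = (energy s + energy (s + \<tau>) + (gradient s + gradient (s + \<tau>))) / 2"
      by (simp add: add_divide_distrib)
    moreover have "energy s + energy (s + \<tau>) + (gradient s + gradient (s + \<tau>)) \<le> P + 4"
      using energy_le_2[OF mem(1)] energy_le_2[OF mem(2)] grad by linarith
    ultimately show ?thesis by simp
  qed
  have w'h: "cmod (w' y) \<le> h y" for y
    using norm_triangle_ineq[of "G (s + \<tau>) y * cnj (Gy s y)" "Gy (s + \<tau>) y * cnj (G s y)"]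
      add_mono[OF amgm[of "G (s + \<tau>) y" "Gy s y"] amgm[of "Gy (s + \<tau>) y" "G s y"]]
    unfolding w'_def h_def norm_mult complex_mod_cnj by (rule order_trans)
  have good: "integral {A..B} f \<le> integral {A..B} g + \<beta>"
    if AB: "0 \<le> A" "A \<le> B" "B \<le> 1" and far: "\<And>y z. y \<in> {A..B} \<Longrightarrow> z \<in> Z \<Longrightarrow> r \<le> \<bar>y - z\<bar>" for A B
  proof -
    have sub: "{A..B} \<subseteq> {0..1}" using AB by auto
    have V: "integral {A..B} (\<lambda>y. cmod (w' y)) \<le> P / 2 + 2"
    proof -
      have "integral {A..B} (\<lambda>y. cmod (w' y)) \<le> integral {A..B} h"
        using sub w'h by (intro integral_le integrable_continuous_interval continuous_intros
            continuous_on_subset[OF w'c] continuous_on_subset[OF hc]) auto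
      also have "\<dots> \<le> integral {0..1} h"
        using sub by (intro integral_subset_le integrable_continuous_interval hc continuous_on_subset[OF hc])
          (auto simp: h_def)
      finally show ?thesis using hI by simp
    qed
    have osc: "cmod (integral {A..B} (\<lambda>y. w y * cis (\<kappa> * \<tau> * b y))) \<le> \<beta>"
      unfolding \<beta>_def
    proof (rule nonstationary_phase[OF AB(2) _ _ continuous_on_subset[OF w'c sub] b' b''(1)])
      show "(w has_vector_derivative w' y) (at y within {A..B})" if "y \<in> {A..B}" for y
        using that sub by (intro has_vector_derivative_within_subset[OF w]) auto
      show "m \<le> \<bar>b' y\<bar>" if "y \<in> {A..B}" for y using off far that sub by blast
      show "\<tau> \<le> \<bar>\<kappa> * \<tau>\<bar>" using \<kappa> \<tau> mult_right_mono[of 1 "\<bar>\<kappa>\<bar>" \<tau>] by (simp add: abs_mult)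
    qed (use AB sub wW K m \<tau> V continuous_on_subset[OF b''(2)] in auto)
    have wi: "((\<lambda>y. w y * cis (\<kappa> * \<tau> * b y)) has_integral integral {A..B} (\<lambda>y. w y * cis (\<kappa> * \<tau> * b y))) {A..B}"
      by (intro integrable_integral integrable_continuous_interval continuous_intros b_cont continuous_on_subset[OF wc sub])
    have gI: "((\<lambda>y. g y + Re (w y * cis (\<kappa> * \<tau> * b y))) has_integral
        integral {A..B} g + Re (integral {A..B} (\<lambda>y. w y * cis (\<kappa> * \<tau> * b y)))) {A..B}"
      by (intro has_integral_add has_integral_Re wi integrable_integral integrable_continuous_interval continuous_on_subset[OF gc sub])
    have fI: "(f has_integral integral {A..B} f) {A..B}"
      by (intro integrable_integral integrable_continuous_interval continuous_on_subset[OF fc sub])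
    \<comment> \<open>Right side minus left side is \<open>|(V - G (s + \<tau>)) - V / 2|^2\<close>.
      So wherever \<open>V\<close> is close to \<open>G (s + \<tau>)\<close>, its mass is controlled
      by the oscillating integrand.\<close>
    have pt: "f y \<le> g y + Re (w y * cis (\<kappa> * \<tau> * b y))" for y
    proof -
      have "w y * cis (\<kappa> * \<tau> * b y) = G (s + \<tau>) y * cnj (V y)"
        by (simp add: w_def V_def U_def cis_cnj)
      then have eq: "Re (w y * cis (\<kappa> * \<tau> * b y)) = G (s + \<tau>) y \<bullet> V y"
        by (simp add: inner_complex_def)
      have "0 \<le> (2 *\<^sub>R (V y - G (s + \<tau>) y) - V y) \<bullet> (2 *\<^sub>R (V y - G (s + \<tau>) y) - V y)" by simp
      then show ?thesis
        unfolding eq f_def g_def normV[of y, symmetric] power2_norm_eq_inner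
        by (simp add: inner_diff_left inner_diff_right inner_commute)
    qed
    have "integral {A..B} f \<le> integral {A..B} g + Re (integral {A..B} (\<lambda>y. w y * cis (\<kappa> * \<tau> * b y)))"
      by (rule has_integral_le[OF fI gI pt])
    also have "\<dots> \<le> integral {A..B} g + \<beta>"
      by (intro add_left_mono order_trans[OF complex_Re_le_cmod osc])
    finally show ?thesis .
  qed
  have "integral {0..1} f \<le> integral {0..1} g + real (card Z) * (2 * r * W) + (real (card Z) + 1) * \<beta>"
    by (rule integral_le_off_finite_set[OF Z fc gc _ _ W0 \<beta>0 r good]) (auto simp: f_def g_def intro!: sup mem gs)
  moreover have "integral {0..1} f = energy s" by (simp add: f_def[abs_def] energy_def)
  moreover have "integral {0..1} g = drift s \<tau> + energy s / 4"
    unfolding g_def drift_def energy_def V_def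
    by (intro integral_unique has_integral_add has_integral_divide integrable_integral
          integrable_continuous_interval continuous_intros ci[unfolded V_def[abs_def]])
  ultimately have "3 / 4 * energy s \<le> drift s \<tau> + real (card Z) * (2 * r * W) + (real (card Z) + 1) * \<beta>" by simp
  moreover have "3 / 4 * energy s \<ge> 3 / 8" using energy_ge_half[OF mem(1)] by simp
  ultimately show ?thesis using drift by linarith
qed

section \<open>Lower bounds for the derivative of the profile\<close>

lemma deriv_shift: "deriv (\<lambda>s. f (s + a)) s = deriv f (s + a)" for f :: "real \<Rightarrow> real"
  by (simp add: deriv_def DERIV_shift)

lemma periodic_deriv_funpow:
  fixes b :: "real \<Rightarrow> real"
  assumes "\<And>s. b (s + 1) = b s"
  shows "(deriv ^^ k) b (s + 1) = (deriv ^^ k) b s"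
proof (induction k arbitrary: s)
  case (Suc k)
  then have "(\<lambda>s. (deriv ^^ k) b (s + 1)) = (deriv ^^ k) b" by auto
  then show ?case using deriv_shift[of "(deriv ^^ k) b" 1 s] by simp
qed (use assms in simp)

text \<open>From \<open>exp x \<ge> (x / N)^N\<close> with \<open>x = r^(-P)\<close>. Through this
  comparison, critical points of finite order obey the same lower bound as the flat ones.\<close>

lemma power_ge_exp_neg_powr:
  fixes P :: real
  assumes P: "P > 0"
  obtains C where "C > 0" "\<And>r. 0 < r \<Longrightarrow> r \<le> 1 \<Longrightarrow> C * exp (- (1 / r powr P)) \<le> r ^ n"
proof -
  \<comment> \<open>\<open>N \<ge> n / P\<close> makes \<open>1 / r ^ n \<le> x ^ N\<close> for
    \<open>r \<le> 1\<close>; the added one keeps \<open>N\<close> positive.\<close>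
  define N where "N = nat \<lceil>real n / P\<rceil> + 1"
  have N: "real n / P \<le> real N" "N \<ge> 1" by (auto simp: N_def intro: order_trans[OF le_of_int_ceiling])
  have "(1 / real N) ^ N * exp (- (1 / r powr P)) \<le> r ^ n" if r: "0 < r" "r \<le> 1" for r
  proof -
    define x where "x = 1 / r powr P"
    have x: "x = r powr (- P)" by (simp add: x_def powr_minus_divide)
    have x0: "x > 0" using r by (simp add: x)
    have "exp (x / real N) ^ N = exp x" using N by (simp flip: exp_of_nat_mult)
    moreover have "x / real N \<le> exp (x / real N)" using exp_ge_add_one_self[of "x / real N"] by linarith
    then have "(x / real N) ^ N \<le> exp (x / real N) ^ N" using x0 by (intro power_mono) auto
    ultimately have le: "(x / real N) ^ N \<le> exp x" by simp
    have "1 / r ^ n = r powr - real n" using r by (simp add: powr_minus_divide powr_realpow)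
    also have "\<dots> \<le> r powr (- P * real N)"
      using N P r by (intro powr_mono') (auto simp: field_simps)
    also have "\<dots> = x ^ N" using x0 r by (simp add: x powr_powr flip: powr_realpow)
    finally have "1 / r ^ n \<le> x ^ N" .
    then have "(1 / real N) ^ N * (1 / r ^ n) \<le> (1 / real N) ^ N * x ^ N" by (intro mult_left_mono) auto
    also have "\<dots> \<le> exp x" using le by (simp add: power_divide)
    finally have "(1 / real N) ^ N * (1 / r ^ n) * (r ^ n * exp (- x)) \<le> exp x * (r ^ n * exp (- x))"
      using r by (intro mult_right_mono) auto
    moreover have "(1 / real N) ^ N * (1 / r ^ n) * (r ^ n * exp (- x)) = (1 / real N) ^ N * exp (- x)"
      using r by simp
    moreover have "exp x * (r ^ n * exp (- x)) = r ^ n" by (simp add: exp_minus)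
    ultimately show ?thesis by (simp only: x_def)
  qed
  moreover have "(1 / real N) ^ N > 0" using N by simp
  ultimately show thesis using that by blast
qed

lemma exp_neg_powr_mono:
  fixes r s p P :: real
  assumes "0 < r" "r \<le> 1" "r \<le> s" "0 < p" "p \<le> P"
  shows "exp (- (1 / r powr P)) \<le> exp (- (1 / s powr p))"
proof -
  have "r powr P \<le> s powr p"
    using assms powr_mono'[of p P r] powr_mono2[of p r s] by linarith
  then show ?thesis using assms by (simp add: frac_le)
qed

text \<open>Taylor's formula for \<open>deriv b\<close> at \<open>x\<close>: if
  \<open>l = n + 1\<close> is the order of the first nonvanishing derivative of \<open>b\<close>,
  only the remainder of order \<open>n\<close> survives, and by continuity the derivative in it
  keeps half its size nearby.\<close>

lemma finite_order_lower_bound: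
  fixes b :: "real \<Rightarrow> real"
  assumes smooth: "\<And>k s. (deriv ^^ k) b differentiable (at s)"
    and k: "k \<ge> 1" "(deriv ^^ k) b x \<noteq> 0" and crit: "deriv b x = 0"
  obtains \<epsilon> C n where "\<epsilon> > 0" "C > 0" "\<And>s. \<bar>s - x\<bar> < \<epsilon> \<Longrightarrow> C * \<bar>s - x\<bar> ^ n \<le> \<bar>deriv b s\<bar>"
proof -
  have der: "((deriv ^^ j) b has_real_derivative (deriv ^^ Suc j) b s) (at s)" for j s
    using smooth[of j s] by (simp add: DERIV_deriv_iff_real_differentiable)
  define l where "l = (LEAST k. k \<ge> 1 \<and> (deriv ^^ k) b x \<noteq> 0)"
  have l: "l \<ge> 1" "(deriv ^^ l) b x \<noteq> 0"
    using LeastI[of "\<lambda>k. k \<ge> 1 \<and> (deriv ^^ k) b x \<noteq> 0" k] k by (auto simp: l_def)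
  have least: "(deriv ^^ j) b x = 0" if "1 \<le> j" "j < l" for j
    using not_less_Least[of j "\<lambda>k. k \<ge> 1 \<and> (deriv ^^ k) b x \<noteq> 0"] that by (auto simp: l_def)
  \<comment> \<open>At a critical point the order is at least two, so the expansion of
    \<open>deriv b\<close> has the positive order \<open>n\<close>.\<close>
  have "l \<noteq> 1" using crit l by auto
  then obtain n where n: "l = Suc n" "n > 0" using l by (cases l) auto
  define D where "D = \<bar>(deriv ^^ l) b x\<bar> / 2"
  have D: "D > 0" using l by (simp add: D_def)
  have "isCont ((deriv ^^ l) b) x" using der DERIV_isCont by blast
  then have "\<forall>\<^sub>F s in at x. \<bar>(deriv ^^ l) b s\<bar> > D"
    using D by (intro order_tendstoD(1)[of _ "\<bar>(deriv ^^ l) b x\<bar>"] tendsto_intros) (auto simp: isCont_def D_def)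
  then obtain \<epsilon> where \<epsilon>: "\<epsilon> > 0" "\<And>s. s \<noteq> x \<Longrightarrow> \<bar>s - x\<bar> < \<epsilon> \<Longrightarrow> \<bar>(deriv ^^ l) b s\<bar> > D"
    by (auto simp: eventually_at dist_real_def)
  have "D / fact n * \<bar>s - x\<bar> ^ n \<le> \<bar>deriv b s\<bar>" if s: "\<bar>s - x\<bar> < \<epsilon>" for s
  proof (cases "s = x")
    case True
    then have "\<bar>s - x\<bar> ^ n = 0" using n(2) True by simp
    then show ?thesis by (metis abs_ge_zero mult_zero_right)
  next
    case False
    have "\<exists>t. (if s < x then s < t \<and> t < x else x < t \<and> t < s) \<and>
      deriv b s = (\<Sum>m<n. (deriv ^^ Suc m) b x / fact m * (s - x) ^ m) + (deriv ^^ Suc n) b t / fact n * (s - x) ^ n"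
    proof (rule Taylor[where a = "min s x" and b = "max s x" and diff = "\<lambda>m. (deriv ^^ Suc m) b"])
      show "\<forall>m t. m < n \<and> min s x \<le> t \<and> t \<le> max s x \<longrightarrow>
          ((deriv ^^ Suc m) b has_real_derivative (deriv ^^ Suc (Suc m)) b t) (at t)"
        using der by blast
    qed (use n False in auto)
    then obtain t where t: "if s < x then s < t \<and> t < x else x < t \<and> t < s"
      and eq: "deriv b s = (\<Sum>m<n. (deriv ^^ Suc m) b x / fact m * (s - x) ^ m) + (deriv ^^ l) b t / fact n * (s - x) ^ n"
      by (auto simp: n)
    have "(\<Sum>m<n. (deriv ^^ Suc m) b x / fact m * (s - x) ^ m) = 0"
      using n by (intro sum.neutral ballI) (simp add: least del: funpow.simps)
    then have "\<bar>deriv b s\<bar> = \<bar>(deriv ^^ l) b t\<bar> / fact n * \<bar>s - x\<bar> ^ n"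
      by (simp add: eq abs_mult power_abs)
    moreover have "\<bar>(deriv ^^ l) b t\<bar> > D" using t s by (intro \<epsilon>) (auto split: if_splits)
    then have "D / fact n * \<bar>s - x\<bar> ^ n \<le> \<bar>(deriv ^^ l) b t\<bar> / fact n * \<bar>s - x\<bar> ^ n"
      by (intro mult_right_mono divide_right_mono) auto
    ultimately show ?thesis by simp
  qed
  with D \<epsilon>(1) show thesis by (intro that[of \<epsilon> "D / fact n" n]) auto
qed

text \<open>On the side of zero that contains \<open>r\<close>, \<open>|x|\<close> is the linear
  function \<open>\<sigma> * x\<close>, so the profile can be differentiated there on an open
  set.\<close>

lemma deriv_flat:
  fixes b :: "real \<Rightarrow> real"
  assumes flat: "\<And>r. r \<in> {- h..h} - {0} \<Longrightarrow> b (y + r) - b y = c * exp (- (1 / \<bar>r\<bar> powr p))"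
    and r: "0 < \<bar>r\<bar>" "\<bar>r\<bar> < h"
  shows "deriv b (y + r) = sgn r * (c * p * \<bar>r\<bar> powr (- p - 1) * exp (- (1 / \<bar>r\<bar> powr p)))"
proof -
  define \<sigma> where "\<sigma> = sgn r"
  have \<sigma>: "\<sigma> * r > 0" "\<bar>r\<bar> = \<sigma> * r" "\<sigma> \<noteq> 0" using r by (auto simp: \<sigma>_def sgn_if)
  have d: "((\<lambda>x. b y + c * exp (- ((\<sigma> * x) powr (- p)))) has_real_derivative
      c * (exp (- ((\<sigma> * r) powr (- p))) * (p * (\<sigma> * r) powr (- p - 1) * \<sigma>))) (at r)"
    using \<sigma> by (auto intro!: derivative_eq_intros simp: field_simps)
  have eq: "b y + c * exp (- ((\<sigma> * x) powr (- p))) = b (y + x)" if "x \<in> {x. 0 < \<sigma> * x} \<inter> {- h<..<h}" for x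
  proof -
    have "\<bar>x\<bar> = \<sigma> * x" using that by (auto simp: \<sigma>_def sgn_if split: if_splits)
    moreover have "x \<in> {- h..h} - {0}" using that by auto
    from flat[OF this] have "b (y + x) = b y + c * exp (- (1 / \<bar>x\<bar> powr p))" by linarith
    ultimately show ?thesis by (simp add: powr_minus_divide)
  qed
  have op: "open ({x. 0 < \<sigma> * x} \<inter> {- h<..<h})"
    by (intro open_Int open_Collect_less continuous_intros open_greaterThanLessThan)
  have "((\<lambda>x. b (y + x)) has_real_derivative
      c * (exp (- ((\<sigma> * r) powr (- p))) * (p * (\<sigma> * r) powr (- p - 1) * \<sigma>))) (at r)"
    by (rule has_field_derivative_transform_within_open[OF d op _ eq]) (use \<sigma> r in auto)
  then have "(b has_real_derivative c * (exp (- ((\<sigma> * r) powr (- p))) * (p * (\<sigma> * r) powr (- p - 1) * \<sigma>))) (at (r + y))"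
    by (subst DERIV_shift) (simp add: add.commute)
  then show ?thesis
    using \<sigma> by (auto simp: DERIV_imp_deriv add.commute powr_minus_divide \<sigma>_def[symmetric])
qed


text \<open>Local bounds and compactness. Since \<open>r\<close> is at most the distance to every
  critical point, near a critical point \<open>x\<close> it suffices to bound
  \<open>|deriv b s|\<close> below in terms of \<open>|s - x|\<close>. The exponent
  \<open>P \<ge> p i\<close> gives a right side that is smallest for all profiles at once.\<close>

lemma derivative_lower_bound:
  fixes b :: "real \<Rightarrow> real" and y h p c :: "nat \<Rightarrow> real"
  assumes periodic: "\<And>s. b (s + 1) = b s"
    and smooth: "\<And>k s. (deriv ^^ k) b differentiable (at s)"
    and critical: "finite {s \<in> {0..<1}. deriv b s = 0}"
    and degenerate: "{s \<in> {0..<1}. \<forall>k\<ge>1. (deriv ^^ k) b s = 0} = y ` {1..m}"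
    and pos: "\<And>i. i \<in> {1..m} \<Longrightarrow> h i > 0 \<and> p i > 0"
    and flat: "\<And>i r. i \<in> {1..m} \<Longrightarrow> r \<in> {- h i..h i} - {0} \<Longrightarrow>
      b (y i + r) - b (y i) = c i * exp (- (1 / \<bar>r\<bar> powr p i))"
    and P: "P > 0" "\<And>i. i \<in> {1..m} \<Longrightarrow> p i \<le> P"
  obtains C where "0 < C" "C \<le> 1" "\<And>r s. 0 < r \<Longrightarrow> r \<le> 1 \<Longrightarrow> s \<in> {0..1} \<Longrightarrow>
    (\<And>z. z \<in> {0..1} \<Longrightarrow> deriv b z = 0 \<Longrightarrow> r \<le> \<bar>s - z\<bar>) \<Longrightarrow> C * exp (- (1 / r powr P)) \<le> \<bar>deriv b s\<bar>"
proof -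
  define bound where "bound C s \<longleftrightarrow> (\<forall>r. 0 < r \<longrightarrow> r \<le> 1 \<longrightarrow>
    (\<forall>z\<in>{0..1}. deriv b z = 0 \<longrightarrow> r \<le> \<bar>s - z\<bar>) \<longrightarrow> C * exp (- (1 / r powr P)) \<le> \<bar>deriv b s\<bar>)" for C s
  have bound_mono: "bound C' s" if "bound C s" "C' \<le> C" for C C' s
    using that unfolding bound_def by (meson exp_ge_zero mult_right_mono order_trans)
  have der: "((deriv ^^ j) b has_real_derivative (deriv ^^ Suc j) b s) (at s)" for j s
    using smooth[of j s] by (simp add: DERIV_deriv_iff_real_differentiable)
  have local: "\<exists>\<epsilon> C. 0 < \<epsilon> \<and> 0 < C \<and> (\<forall>s. \<bar>s - x\<bar> < \<epsilon> \<longrightarrow> bound C s)" if x: "x \<in> {0..1}" for x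
  proof (cases "deriv b x = 0")
    case False
    have "isCont (deriv b) x" using der[of 1] DERIV_isCont by fastforce
    then have "\<forall>\<^sub>F s in at x. \<bar>deriv b s\<bar> > \<bar>deriv b x\<bar> / 2"
      using False by (intro order_tendstoD(1)[of _ "\<bar>deriv b x\<bar>"] tendsto_intros) (auto simp: isCont_def)
    then obtain \<epsilon> where \<epsilon>: "\<epsilon> > 0" "\<And>s. s \<noteq> x \<Longrightarrow> \<bar>s - x\<bar> < \<epsilon> \<Longrightarrow> \<bar>deriv b s\<bar> > \<bar>deriv b x\<bar> / 2"
      by (auto simp: eventually_at dist_real_def)
    have "bound (\<bar>deriv b x\<bar> / 2) s" if s: "\<bar>s - x\<bar> < \<epsilon>" for s
      unfolding bound_def
    proof (intro allI impI)
      fix r :: real assume "0 < r"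
      then have "\<bar>deriv b x\<bar> / 2 * exp (- (1 / r powr P)) \<le> \<bar>deriv b x\<bar> / 2 * 1"
        by (intro mult_left_mono) auto
      also have "\<dots> \<le> \<bar>deriv b s\<bar>" using \<epsilon>(2)[OF _ s] by (cases "s = x") auto
      finally show "\<bar>deriv b x\<bar> / 2 * exp (- (1 / r powr P)) \<le> \<bar>deriv b s\<bar>" .
    qed
    with \<epsilon>(1) False show ?thesis by (intro exI[of _ \<epsilon>] exI[of _ "\<bar>deriv b x\<bar> / 2"]) auto
  next
    case crit: True
    show ?thesis
    proof (cases "\<exists>k\<ge>1. (deriv ^^ k) b x \<noteq> 0")
      case True
      then obtain k where k: "k \<ge> 1" "(deriv ^^ k) b x \<noteq> 0" by blast
      obtain \<epsilon> C n where C: "\<epsilon> > 0" "C > 0" "\<And>s. \<bar>s - x\<bar> < \<epsilon> \<Longrightarrow> C * \<bar>s - x\<bar> ^ n \<le> \<bar>deriv b s\<bar>"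
        by (rule finite_order_lower_bound[OF smooth k crit]) blast
      obtain C' where C': "C' > 0" "\<And>r. 0 < r \<Longrightarrow> r \<le> 1 \<Longrightarrow> C' * exp (- (1 / r powr P)) \<le> r ^ n"
        by (rule power_ge_exp_neg_powr[OF P(1), of n]) blast
      have "bound (C * C') s" if s: "\<bar>s - x\<bar> < \<epsilon>" for s
        unfolding bound_def
      proof (intro allI impI)
        fix r :: real assume r: "0 < r" "r \<le> 1" "\<forall>z\<in>{0..1}. deriv b z = 0 \<longrightarrow> r \<le> \<bar>s - z\<bar>"
        then have "r \<le> \<bar>s - x\<bar>" using x crit by blast
        then have "r ^ n \<le> \<bar>s - x\<bar> ^ n" using r by (intro power_mono) auto
        with C'(2)[OF r(1,2)] have "C * (C' * exp (- (1 / r powr P))) \<le> C * \<bar>s - x\<bar> ^ n"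
          using C(2) by (intro mult_left_mono) auto
        also have "\<dots> \<le> \<bar>deriv b s\<bar>" by (rule C(3)[OF s])
        finally show "C * C' * exp (- (1 / r powr P)) \<le> \<bar>deriv b s\<bar>" by (simp add: mult.assoc)
      qed
      then show ?thesis using C(1,2) C'(1) by (intro exI[of _ \<epsilon>] exI[of _ "C * C'"]) auto
    next
      case False
      \<comment> \<open>The degenerate points are listed in \<open>{0..<1}\<close>, so the endpoint
        1 is represented by 0; periodicity carries all derivatives over.\<close>
      define x' where "x' = (if x = 1 then 0 else x)"
      have shift: "(deriv ^^ k) b (x' + s) = (deriv ^^ k) b (x + s)" for k s
        using periodic_deriv_funpow[where b = b, OF periodic, of k s] by (simp add: x'_def add.commute)
      have "x' \<in> {s \<in> {0..<1}. \<forall>k\<ge>1. (deriv ^^ k) b s = 0}"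
        using False x shift[of _ 0] by (auto simp: x'_def)
      then obtain i where i: "i \<in> {1..m}" "x' = y i" unfolding degenerate by blast
      have hp: "h i > 0" "p i > 0" using pos[OF i(1)] by auto
      have D: "deriv b (x + r) = sgn r * (c i * p i * \<bar>r\<bar> powr (- p i - 1) * exp (- (1 / \<bar>r\<bar> powr p i)))"
        if "0 < \<bar>r\<bar>" "\<bar>r\<bar> < h i" for r
        using deriv_flat[where h = "h i" and p = "p i" and c = "c i" and b = b and y = x', OF _ that] flat[OF i(1)] shift[of 1 r] by (simp add: i(2))
      \<comment> \<open>With \<open>c i = 0\<close> the function would be constant next to
        \<open>y i\<close>, which would give infinitely many critical points.\<close>
      have "c i \<noteq> 0"
      proof
        assume "c i = 0"
        have "x' < 1" "0 \<le> x'" using x by (auto simp: x'_def)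
        \<comment> \<open>An interval to the right of \<open>x'\<close>, cut off at 1, stays inside
          \<open>{0..<1}\<close>, where the critical points are counted.\<close>
        define \<delta> where "\<delta> = min (h i) (1 - x')"
        have "\<delta> > 0" using \<open>x' < 1\<close> hp by (simp add: \<delta>_def)
        have "{x'<..<x' + \<delta>} \<subseteq> {s \<in> {0..<1}. deriv b s = 0}"
        proof
          fix s assume s: "s \<in> {x'<..<x' + \<delta>}"
          then have "0 < s - x'" "s - x' < h i" by (auto simp: \<delta>_def)
          then have "deriv b (x + (s - x')) = 0" using D[of "s - x'"] \<open>c i = 0\<close> by simp
          then show "s \<in> {s \<in> {0..<1}. deriv b s = 0}"
            using s \<open>0 \<le> x'\<close> shift[of 1 "s - x'"] by (auto simp: \<delta>_def)
        qed
        then have "finite {x'<..<x' + \<delta>}" using critical finite_subset by blast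
        then show False using \<open>\<delta> > 0\<close> infinite_Ioo[of x' "x' + \<delta>"] by simp
      qed
      have "bound (\<bar>c i\<bar> * p i) s" if s: "\<bar>s - x\<bar> < min (h i) 1" for s
        unfolding bound_def
      proof (intro allI impI)
        fix r :: real assume r: "0 < r" "r \<le> 1" "\<forall>z\<in>{0..1}. deriv b z = 0 \<longrightarrow> r \<le> \<bar>s - z\<bar>"
        then have rs: "r \<le> \<bar>s - x\<bar>" using x crit by blast
        then have s0: "0 < \<bar>s - x\<bar>" "\<bar>s - x\<bar> < h i" using r s by auto
        \<comment> \<open>Within distance one the prefactor of the derivative is at least one, so
          the exponential alone is a lower bound up to constants.\<close>
        have "1 \<le> \<bar>s - x\<bar> powr (- p i - 1)"
          using s s0 hp powr_mono'[of "- p i - 1" 0 "\<bar>s - x\<bar>"] by simp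
        moreover have "exp (- (1 / r powr P)) \<le> exp (- (1 / \<bar>s - x\<bar> powr p i))"
          using r rs hp P(2)[OF i(1)] by (intro exp_neg_powr_mono) auto
        ultimately have "1 * exp (- (1 / r powr P)) \<le> \<bar>s - x\<bar> powr (- p i - 1) * exp (- (1 / \<bar>s - x\<bar> powr p i))"
          by (intro mult_mono) auto
        then have "\<bar>c i\<bar> * p i * exp (- (1 / r powr P)) \<le> \<bar>c i\<bar> * p i * (\<bar>s - x\<bar> powr (- p i - 1) * exp (- (1 / \<bar>s - x\<bar> powr p i)))"
          using hp by (intro mult_left_mono) auto
        also have "\<dots> = \<bar>deriv b s\<bar>"
          using D[OF s0] s0 hp by (simp add: abs_mult abs_sgn_eq)
        finally show "\<bar>c i\<bar> * p i * exp (- (1 / r powr P)) \<le> \<bar>deriv b s\<bar>" .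
      qed
      then show ?thesis using hp \<open>c i \<noteq> 0\<close> by (intro exI[of _ "min (h i) 1"] exI[of _ "\<bar>c i\<bar> * p i"]) auto
    qed
  qed
  then obtain \<epsilon> C where loc: "\<And>x. x \<in> {0..1} \<Longrightarrow> 0 < \<epsilon> x \<and> 0 < C x \<and> (\<forall>s. \<bar>s - x\<bar> < \<epsilon> x \<longrightarrow> bound (C x) s)"
    by metis
  obtain F where F: "F \<subseteq> {0..1}" "finite F" "{0..1} \<subseteq> (\<Union>x\<in>F. ball x (\<epsilon> x))"
  proof (rule compactE_image[of "{0..1::real}" "{0..1}" "\<lambda>x. ball x (\<epsilon> x)"])
    show "{0..1} \<subseteq> (\<Union>x\<in>{0..1}. ball x (\<epsilon> x))" using loc by force
  qed auto
  \<comment> \<open>The extra element 1 enforces \<open>C0 \<le> 1\<close>, from which the phase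
    estimate later gets its hypothesis \<open>m \<le> 1\<close>.\<close>
  define C0 where "C0 = Min (insert 1 (C ` F))"
  have "C0 > 0" "C0 \<le> 1" "\<And>x. x \<in> F \<Longrightarrow> C0 \<le> C x" using F loc by (auto simp: C0_def)
  moreover have "bound C0 s" if s: "s \<in> {0..1}" for s
  proof -
    obtain x where x: "x \<in> F" "s \<in> ball x (\<epsilon> x)" using F s by blast
    then have "bound (C x) s" using loc[of x] F by (auto simp: dist_real_def abs_minus_commute)
    then show ?thesis using bound_mono x \<open>\<And>x. x \<in> F \<Longrightarrow> C0 \<le> C x\<close> by blast
  qed
  ultimately show thesis using that[of C0] unfolding bound_def by blast
qed

section \<open>Choice of the time scale\<close>

text \<open>Put \<open>x = \<nu>^(-e)\<close> in \<open>(ln x)^a \<le> a^a * x\<close>. With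
  \<open>a = 2 / P\<close> and \<open>e = 1 / 16\<close> the right side is the constant
  \<open>A\<close> that absorbs \<open>\<Lambda>^2\<close> wherever a factor
  \<open>\<nu>^(1/16)\<close> can be spared.\<close>

lemma ln_powr_le_powr:
  fixes a e \<nu> :: real
  assumes "0 < a" "0 < e" "0 < \<nu>" "\<nu> < 1"
  shows "\<bar>ln \<nu>\<bar> powr a * \<nu> powr e \<le> (a / e) powr a"
proof -
  define x where "x = \<nu> powr (- e)"
  have x: "x > 1" using assms powr_less_mono'[of \<nu> "- e" 0] by (simp add: x_def)
  have "ln x = e * \<bar>ln \<nu>\<bar>" using assms by (simp add: x_def ln_powr)
  then have "(e * \<bar>ln \<nu>\<bar>) powr a \<le> a powr a * x" using ln_powr_bound2[OF x assms(1)] by simp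
  then have "(e * \<bar>ln \<nu>\<bar>) powr a * \<nu> powr e \<le> a powr a * x * \<nu> powr e"
    by (rule mult_right_mono) simp
  moreover have "(e * \<bar>ln \<nu>\<bar>) powr a = e powr a * \<bar>ln \<nu>\<bar> powr a"
    by (rule powr_mult)
  ultimately have "e powr a * (\<bar>ln \<nu>\<bar> powr a * \<nu> powr e) \<le> a powr a * (x * \<nu> powr e)"
    by (simp only: mult.assoc)
  also have "x * \<nu> powr e = 1" using assms by (simp add: x_def flip: powr_add)
  finally show ?thesis using assms by (simp add: powr_divide field_simps)
qed

text \<open>
  The mixing time \<open>\<tau> = \<nu>\<^sup>-\<^sup>1\<^sup>/\<^sup>4\<close> is short enough for diffusion to be negligible and long enough for
  phase mixing where \<open>\<bar>b'\<bar>\<close> is at least of order \<open>\<nu>\<^sup>1\<^sup>/\<^sup>1\<^sup>6\<close>.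
\<close>

lemma (in stuck_mode) not_stuck:
  fixes Z :: "real set" and b'' :: "real \<Rightarrow> real" and L K C0 P A \<Lambda> H :: real
  assumes b'': "\<And>y. (b' has_real_derivative b'' y) (at y)" "continuous_on UNIV b''"
    and L: "\<And>y. y \<in> {0..1} \<Longrightarrow> \<bar>b' y\<bar> \<le> L"
    and K: "\<And>y. y \<in> {0..1} \<Longrightarrow> \<bar>b'' y\<bar> \<le> K"
    and Z: "finite Z" and C0: "0 < C0" "C0 \<le> 1" and \<nu>: "\<nu> < 1"
    and off: "\<And>r y. 0 < r \<Longrightarrow> r \<le> 1 \<Longrightarrow> y \<in> {0..1} \<Longrightarrow> (\<And>z. z \<in> Z \<Longrightarrow> r \<le> \<bar>y - z\<bar>) \<Longrightarrow>
      C0 * exp (- (1 / r powr P)) \<le> \<bar>b' y\<bar>"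
    and \<kappa>: "1 \<le> \<bar>\<kappa>\<bar>" and P: "0 < P"
    and \<Lambda>: "\<Lambda> = \<bar>ln \<nu>\<bar> powr (1 / P)" "1 \<le> \<Lambda>" and T: "T = 1 / (\<nu> * \<Lambda>\<^sup>2)"
    and A: "\<Lambda>\<^sup>2 * \<nu> powr (1 / 16) \<le> A"
    and H: "H = 16 powr (1 / P)" "H \<le> \<Lambda>" "64 * card Z * H \<le> \<Lambda>"
    and c_small: "(320 * card Z * H)\<^sup>2 * c \<le> 1"
    and \<nu>_small: "16 * ((21 + 8 * L\<^sup>2) * A) * \<nu> powr (1 / 16) \<le> 1"
      "16 * ((real (card Z) + 1) * (30 + 12 * K) * A / C0\<^sup>2) * \<nu> powr (1 / 16) \<le> 1"
      "4 * A * \<nu> powr (1 / 16) \<le> 1"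
  shows False
proof -
  \<comment> \<open>In terms of \<eta> the scales are monomials: \<open>\<nu> = \<eta>^16\<close>,
    \<open>\<tau> = \<eta>^(-4)\<close>, \<open>m = C0 * \<eta>\<close>,
    \<open>1 / T = \<eta>^16 * \<Lambda>^2\<close>. From \<open>\<eta>^2\<close> on, one factor
    absorbs \<open>\<Lambda>^2\<close> and another is left over to be small.\<close>
  define \<eta> where "\<eta> = \<nu> powr (1 / 16)"
  have \<eta>: "0 < \<eta>" "\<eta> < 1" using pos \<nu> powr_less_mono2[of "1/16" \<nu> 1] by (auto simp: \<eta>_def)
  have \<nu>\<eta>: "\<nu> = \<eta> ^ 16" using pos by (simp add: \<eta>_def powr_power)
  have \<Lambda>0: "0 < \<Lambda>" using \<Lambda>(2) by linarith
  have A\<eta>: "\<Lambda>\<^sup>2 * \<eta> \<le> A" using A by (simp add: \<eta>_def)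
  have A0: "0 < A" using A\<eta> \<Lambda>0 \<eta> by (meson less_le_trans mult_pos_pos zero_less_power)
  have H0: "0 < H" by (simp add: H)
  define n where "n = real (card Z)"
  have n: "0 \<le> n" by (simp add: n_def)
  define \<tau> where "\<tau> = 1 / \<eta> ^ 4"
  \<comment> \<open>As \<open>H powr P = 16\<close>, this radius has
    \<open>r powr P = 16 / \<bar>ln \<nu>\<bar>\<close>, and \<open>exp (- (1 / r powr P))\<close>
    is exactly \<eta>.\<close>
  define r where "r = H / \<Lambda>"
  define m where "m = C0 * \<eta>"
  define q where "q = sqrt c"
  \<comment> \<open>Balances the terms \<open>2 * \<omega>\<close> and
    \<open>8 * c * \<Lambda>\<^sup>2 / \<omega>\<close> of \<open>W\<close> up to constants: they
    become \<open>2 * q * \<Lambda>\<close> and \<open>8 * q * \<Lambda>\<close>.\<close>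
  define \<omega> where "\<omega> = q * \<Lambda>"
  have q: "0 < q" "q\<^sup>2 = c" "q \<le> 1" using c by (auto simp: q_def intro: real_le_lsqrt)
  have \<nu>T: "\<nu> * T = 1 / \<Lambda>\<^sup>2" using pos by (simp add: T)
  have \<eta>A: "\<eta> ^ k * \<Lambda>\<^sup>2 \<le> A * \<eta>" if "2 \<le> k" for k
  proof -
    have "\<eta> ^ k * \<Lambda>\<^sup>2 \<le> \<eta> ^ 2 * \<Lambda>\<^sup>2" using that \<eta> by (intro mult_right_mono power_decreasing) auto
    also have "\<dots> \<le> A * \<eta>" using mult_right_mono[OF A\<eta>, of \<eta>] \<eta> by (simp add: power2_eq_square mult_ac)
    finally show ?thesis .
  qed
  have \<tau>: "0 < \<tau>" "\<tau> < T / 2"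
  proof -
    show "0 < \<tau>" using \<eta> by (simp add: \<tau>_def)
    have "4 * (\<eta> ^ 12 * \<Lambda>\<^sup>2) \<le> 4 * (A * \<eta>)" using \<eta>A[of 12] by simp
    also have "\<dots> \<le> 1" using \<nu>_small(3) by (simp add: \<eta>_def)
    finally have "2 * (\<eta> ^ 12 * \<Lambda>\<^sup>2) < 1" by simp
    moreover have "T * \<eta> ^ 4 = 1 / (\<eta> ^ 12 * \<Lambda>\<^sup>2)" using \<eta> by (simp add: T \<nu>\<eta> divide_simps flip: power_add)
    moreover have "2 < 1 / x" if "2 * x < 1" "0 < x" for x :: real using that by (simp add: field_simps)
    ultimately have "2 < T * \<eta> ^ 4" using \<eta> \<Lambda>0 by simp
    then show "\<tau> < T / 2" using \<eta> by (simp add: \<tau>_def field_simps)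
  qed
  have r: "0 < r" "r \<le> 1" using H0 H \<Lambda>0 by (auto simp: r_def)
  have m: "0 < m" "m \<le> 1" using C0 \<eta> mult_mono[of C0 1 \<eta> 1] by (auto simp: m_def)
  have m_eq: "C0 * exp (- (1 / r powr P)) = m"
  proof -
    have "r powr P = 16 / \<bar>ln \<nu>\<bar>"
      using P pos \<nu> by (simp add: r_def H \<Lambda> powr_divide powr_powr)
    then have "- (1 / r powr P) = ln \<nu> / 16" using pos \<nu> by (simp add: ln_le_zero_iff)
    then show ?thesis using pos by (simp add: m_def \<eta>_def powr_def)
  qed
  have \<omega>: "0 < \<omega>" using q \<Lambda>0 by (simp add: \<omega>_def)
  define W where "W = 2 * (1 + \<omega>) + 8 * c / (\<nu> * T) / \<omega>"
  have P_eq: "8 * c / (\<nu> * T) = 8 * c * \<Lambda>\<^sup>2" by (simp add: \<nu>T)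
  have W_eq: "W = 2 + 10 * q * \<Lambda>"
    unfolding W_def P_eq \<omega>_def using q \<Lambda>0 by (simp add: q(2)[symmetric] power2_eq_square)
  have K0: "0 \<le> K" using order_trans[OF abs_ge_zero K[of 0]] by simp
  have stuck_ineq: "3 / 8 \<le> \<tau> * (c / T * (21 + 8 * \<tau>\<^sup>2 * L\<^sup>2)) + n * (2 * r * W)
      + (n + 1) * ((2 * W + (8 * c / (\<nu> * T) / 2 + 2) + W * K) / (\<tau> * m\<^sup>2))"
    unfolding W_def n_def
    by (rule stuck_inequality[OF b'' \<tau> L K Z r(1) m _ \<kappa> \<omega>])
       (use off[OF r] m_eq in auto)
  \<comment> \<open>The two parts are of order \<open>\<tau> / T = \<eta>^12 * \<Lambda>^2\<close>
    and \<open>\<tau>^3 / T = \<eta>^4 * \<Lambda>^2\<close>.\<close>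
  have t1: "\<tau> * (c / T * (21 + 8 * \<tau>\<^sup>2 * L\<^sup>2)) \<le> 1 / 16"
  proof -
    have "\<tau> * (c / T * (21 + 8 * \<tau>\<^sup>2 * L\<^sup>2)) = c * ((\<eta> ^ 4 * \<Lambda>\<^sup>2) * (21 * \<eta> ^ 8 + 8 * L\<^sup>2))"
      using \<eta> \<Lambda>0 unfolding \<tau>_def T \<nu>\<eta> by (simp add: field_simps flip: power_add power_mult)
    also have "\<dots> \<le> 1 * ((A * \<eta>) * (21 * 1 + 8 * L\<^sup>2))"
    proof (rule mult_mono[OF _ mult_mono])
      show "\<eta> ^ 4 * \<Lambda>\<^sup>2 \<le> A * \<eta>" by (rule \<eta>A) simp
      show "21 * \<eta> ^ 8 + 8 * L\<^sup>2 \<le> 21 * 1 + 8 * L\<^sup>2"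
        using \<eta> by (intro add_right_mono mult_left_mono power_le_one) auto
    qed (use c \<eta> A0 in auto)
    also have "\<dots> \<le> 1 / 16" using \<nu>_small(1) by (simp add: \<eta>_def algebra_simps)
    finally show ?thesis .
  qed
  \<comment> \<open>The error without a power of \<nu>: it equals
    \<open>4 * n * H / \<Lambda> + 20 * n * H * q\<close>. Large \<Lambda> makes the first term
    small; the second does not depend on \<nu> and is what limits \<open>c\<close>. The numbers 64
    and 320 in the hypotheses give each term \<open>1 / 16\<close>.\<close>
  have t2: "n * (2 * r * W) \<le> 1 / 8"
  proof -
    have "n * (2 * r * W) = 4 * (n * H) / \<Lambda> + 20 * n * H * q"
      using \<Lambda>0 by (simp add: W_eq r_def field_simps)
    moreover have "4 * (n * H) / \<Lambda> \<le> 1 / 16" using H(3) \<Lambda>0 by (simp add: n_def field_simps)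
    moreover have "(320 * n * H * q)\<^sup>2 \<le> 1\<^sup>2" using c_small by (simp add: n_def power_mult_distrib q(2))
    then have "320 * n * H * q \<le> 1" by (rule power2_le_imp_le) simp
    ultimately show ?thesis by simp
  qed
  \<comment> \<open>The numerator is of order \<open>\<Lambda>^2\<close>, and
    \<open>1 / (\<tau> * m\<^sup>2)\<close> is \<open>\<eta>\<^sup>2 / C0\<^sup>2\<close>. In the
    constant, 30 is 24 from \<open>2 * W\<close>, 4 from the gradient and 2.\<close>
  have t3: "(n + 1) * ((2 * W + (8 * c / (\<nu> * T) / 2 + 2) + W * K) / (\<tau> * m\<^sup>2)) \<le> 1 / 16"
  proof -
    have \<Lambda>1: "1 \<le> \<Lambda>\<^sup>2" "\<Lambda> \<le> \<Lambda>\<^sup>2" using \<Lambda>(2) self_le_power[of \<Lambda> 2] one_le_power[of \<Lambda> 2] by auto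
    have "10 * q * \<Lambda> \<le> 10 * 1 * \<Lambda>\<^sup>2" using q \<Lambda>1 \<Lambda>0 by (intro mult_mono) auto
    then have W: "W \<le> 12 * \<Lambda>\<^sup>2" using \<Lambda>1 by (simp add: W_eq)
    have "W * K \<le> 12 * \<Lambda>\<^sup>2 * K" using W K0 by (rule mult_right_mono)
    moreover have "8 * c / (\<nu> * T) / 2 \<le> 4 * \<Lambda>\<^sup>2" unfolding P_eq using c \<Lambda>0 by simp
    ultimately have N: "2 * W + (8 * c / (\<nu> * T) / 2 + 2) + W * K \<le> (30 + 12 * K) * \<Lambda>\<^sup>2"
      using W \<Lambda>1 by (simp add: algebra_simps)
    have \<tau>m: "1 / (\<tau> * m\<^sup>2) = \<eta>\<^sup>2 / C0\<^sup>2" using \<eta> C0 by (simp add: \<tau>_def m_def field_simps flip: power_add)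
    have "(n + 1) * ((2 * W + (8 * c / (\<nu> * T) / 2 + 2) + W * K) / (\<tau> * m\<^sup>2))
        = (n + 1) * ((2 * W + (8 * c / (\<nu> * T) / 2 + 2) + W * K) * (\<eta>\<^sup>2 / C0\<^sup>2))"
      by (simp only: \<tau>m[symmetric]) simp
    also have "\<dots> \<le> (n + 1) * ((30 + 12 * K) * \<Lambda>\<^sup>2 * (\<eta>\<^sup>2 / C0\<^sup>2))"
      using N n by (intro mult_left_mono mult_right_mono) auto
    also have "\<dots> = (n + 1) * (30 + 12 * K) / C0\<^sup>2 * (\<eta>\<^sup>2 * \<Lambda>\<^sup>2)" by simp
    also have "\<dots> \<le> (n + 1) * (30 + 12 * K) / C0\<^sup>2 * (A * \<eta>)"
      using \<eta>A[of 2] n K0 by (intro mult_left_mono) auto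
    also have "\<dots> \<le> 1 / 16" using \<nu>_small(2) by (simp add: \<eta>_def n_def algebra_simps)
    finally show ?thesis .
  qed
  \<comment> \<open>The three errors add up to at most \<open>1 / 4\<close>, below
    \<open>3 / 8\<close>.\<close>
  show False using stuck_ineq t1 t2 t3 by linarith
qed


text \<open>The interface between the mixing argument and weak solutions. One constant serves all
  wavenumbers and all residuals below the tolerance. Unit initial energy is a normalisation by
  linearity, but the tolerance refers to the residual of the normalised mode.\<close>

definition contracts :: "(real \<Rightarrow> real) \<Rightarrow> (real \<Rightarrow> real) \<Rightarrow> real \<Rightarrow> real \<Rightarrow> real \<Rightarrow> bool" where
  "contracts b b' \<nu> T c \<longleftrightarrow> (\<forall>\<kappa> \<rho> G Gt Gy Gyy. 1 \<le> \<bar>\<kappa>\<bar> \<longrightarrow> approximate_mode b b' \<kappa> \<nu> T \<rho> G Gt Gy Gyy \<longrightarrow>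
     integral {0..1} (\<lambda>y. (cmod (G 0 y))\<^sup>2) = 1 \<longrightarrow> \<rho> * T \<le> c \<longrightarrow>
     integral {0..1} (\<lambda>y. (cmod (G T y))\<^sup>2) \<le> 1 - c)"

text \<open>Mixing is needed for small \<nu>. For \<open>\<nu> \<ge> \<nu>0\<close> damping
  suffices: with \<Lambda> frozen at \<open>\<Lambda>0\<close>, a stuck mode would satisfy
  \<open>\<kappa>\<^sup>2 \<le> 4 * c * \<Lambda>0\<^sup>2 \<le> 1 / 2\<close>, contrary to
  \<open>\<bar>\<kappa>\<bar> \<ge> 1\<close>. Freezing at \<open>\<nu>0\<close> keeps \<Lambda> at
  least as large as the logarithm requires, since \<open>\<bar>ln \<nu>\<bar>\<close> decreases on
  the unit interval.\<close>

lemma contraction_constants: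
  fixes b b' b'' :: "real \<Rightarrow> real" and Z :: "real set" and C0 P :: real
  assumes b': "\<And>y. (b has_real_derivative b' y) (at y)"
    and b'': "\<And>y. (b' has_real_derivative b'' y) (at y)" "continuous_on UNIV b''"
    and Z: "finite Z" and C0: "0 < C0" "C0 \<le> 1" and P: "0 < P"
    and off: "\<And>r y. 0 < r \<Longrightarrow> r \<le> 1 \<Longrightarrow> y \<in> {0..1} \<Longrightarrow> (\<And>z. z \<in> Z \<Longrightarrow> r \<le> \<bar>y - z\<bar>) \<Longrightarrow>
      C0 * exp (- (1 / r powr P)) \<le> \<bar>b' y\<bar>"
  obtains c \<Lambda> where "0 < c" "c \<le> 1 / 8"
    "\<And>\<nu>. 0 < \<nu> \<Longrightarrow> \<nu> < 1 \<Longrightarrow> 0 < \<Lambda> \<nu> \<and> \<bar>ln \<nu>\<bar> powr (2 / P) \<le> (\<Lambda> \<nu>)\<^sup>2"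
    "\<And>\<nu>. 0 < \<nu> \<Longrightarrow> \<nu> < 1 \<Longrightarrow> contracts b b' \<nu> (1 / (\<nu> * (\<Lambda> \<nu>)\<^sup>2)) c"
proof -
  have bounded: "\<exists>L. \<forall>y\<in>{0..1}. \<bar>g y\<bar> \<le> L" if "continuous_on UNIV g" for g :: "real \<Rightarrow> real"
  proof -
    have "bounded (g ` {0..1})"
      by (intro compact_imp_bounded compact_continuous_image continuous_on_subset[OF that]) auto
    then show ?thesis by (auto simp: bounded_iff)
  qed
  have "continuous_on UNIV b'" using b''(1) by (meson DERIV_continuous continuous_at_imp_continuous_on)
  then obtain L where L: "\<And>y. y \<in> {0..1} \<Longrightarrow> \<bar>b' y\<bar> \<le> L" using bounded by meson
  obtain K where K: "\<And>y. y \<in> {0..1} \<Longrightarrow> \<bar>b'' y\<bar> \<le> K" using bounded b''(2) by meson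
  have K0: "0 \<le> K" using order_trans[OF abs_ge_zero K[of 0]] by simp
  define A where "A = (2 / P / (1 / 16)) powr (2 / P)"
  define H where "H = 16 powr (1 / P)"
  \<comment> \<open>As a sum, \<open>E\<close> exceeds each constant that
    \<open>\<nu>^(1/16)\<close> has to beat, just as \<open>M\<close> exceeds each lower bound on
    \<Lambda>. The two entries of \<open>\<nu>0\<close> then enforce
    \<open>\<Lambda> \<ge> M\<close> and \<open>E * \<nu>^(1/16) \<le> 1\<close>.\<close>
  define E where "E = 1 + 16 * ((21 + 8 * L\<^sup>2) * A) + 16 * ((real (card Z) + 1) * (30 + 12 * K) * A / C0\<^sup>2) + 4 * A"
  define M where "M = 1 + H + 64 * card Z * H"
  define \<nu>0 where "\<nu>0 = min (exp (- (M powr P))) ((1 / E) powr 16)"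
  define \<Lambda>0 where "\<Lambda>0 = \<bar>ln \<nu>0\<bar> powr (1 / P)"
  define \<Lambda> where "\<Lambda> \<nu> = (if \<nu> < \<nu>0 then \<bar>ln \<nu>\<bar> powr (1 / P) else \<Lambda>0)" for \<nu>
  \<comment> \<open>The three entries serve the bootstrap for the energy, the mass near the critical
    points, and large \<nu>. The added 1 keeps the denominator positive when \<open>Z\<close> is
    empty.\<close>
  define c where "c = min (1 / 8) (min (1 / (320 * card Z * H + 1)\<^sup>2) (1 / (8 * \<Lambda>0\<^sup>2)))"
  have H0: "0 < H" by (simp add: H_def)
  have A0: "0 < A" using P by (simp add: A_def)
  have E: "1 \<le> E" "16 * ((21 + 8 * L\<^sup>2) * A) \<le> E"
    "16 * ((real (card Z) + 1) * (30 + 12 * K) * A / C0\<^sup>2) \<le> E" "4 * A \<le> E"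
    using A0 K0 unfolding E_def by (auto simp: add_nonneg_nonneg)
  have M: "1 \<le> M" "H \<le> M" "64 * card Z * H \<le> M" using H0 by (auto simp: M_def)
  have \<nu>0: "0 < \<nu>0" "\<nu>0 < 1"
    using E(1) M(1) by (auto simp: \<nu>0_def min_less_iff_disj)
  have \<Lambda>0: "0 < \<Lambda>0" using \<nu>0 by (simp add: \<Lambda>0_def)
  have nz: "0 < 320 * real (card Z) * H + 1" using H0 by (simp add: add_nonneg_pos)
  have c_bounds: "0 < c" "c \<le> 1 / 8" "c \<le> 1 / (320 * card Z * H + 1)\<^sup>2" "c \<le> 1 / (8 * \<Lambda>0\<^sup>2)"
    using \<Lambda>0 nz by (auto simp: c_def)
  have sq: "(\<bar>ln \<nu>\<bar> powr (1 / P))\<^sup>2 = \<bar>ln \<nu>\<bar> powr (2 / P)" for \<nu>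
    by (simp add: power2_eq_square flip: powr_add)
  have \<Lambda>: "0 < \<Lambda> \<nu> \<and> \<bar>ln \<nu>\<bar> powr (2 / P) \<le> (\<Lambda> \<nu>)\<^sup>2" if \<nu>: "0 < \<nu>" "\<nu> < 1" for \<nu>
  proof (cases "\<nu> < \<nu>0")
    case True
    then have "(\<Lambda> \<nu>)\<^sup>2 = \<bar>ln \<nu>\<bar> powr (2 / P)" unfolding \<Lambda>_def by (simp only: if_True sq)
    moreover have "0 < \<Lambda> \<nu>" using True \<nu> by (simp add: \<Lambda>_def)
    ultimately show ?thesis by simp
  next
    case False
    then have "\<bar>ln \<nu>\<bar> \<le> \<bar>ln \<nu>0\<bar>" using \<nu> \<nu>0 by simp
    then have "\<bar>ln \<nu>\<bar> powr (2 / P) \<le> \<bar>ln \<nu>0\<bar> powr (2 / P)" using P by (intro powr_mono2) auto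
    then show ?thesis using False \<Lambda>0 by (simp add: \<Lambda>_def \<Lambda>0_def sq)
  qed
  show thesis
  proof (rule that[OF c_bounds(1,2) \<Lambda>])
    fix \<nu> :: real assume \<nu>: "0 < \<nu>" "\<nu> < 1"
    show "contracts b b' \<nu> (1 / (\<nu> * (\<Lambda> \<nu>)\<^sup>2)) c"
      unfolding contracts_def
    proof (intro allI impI)
      fix \<kappa> \<rho> :: real and G Gt Gy Gyy :: "real \<Rightarrow> real \<Rightarrow> complex"
      assume \<kappa>: "1 \<le> \<bar>\<kappa>\<bar>"
        and mode: "approximate_mode b b' \<kappa> \<nu> (1 / (\<nu> * (\<Lambda> \<nu>)\<^sup>2)) \<rho> G Gt Gy Gyy"
        and start: "integral {0..1} (\<lambda>y. (cmod (G 0 y))\<^sup>2) = 1"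
        and \<rho>: "\<rho> * (1 / (\<nu> * (\<Lambda> \<nu>)\<^sup>2)) \<le> c"
      define T where "T = 1 / (\<nu> * (\<Lambda> \<nu>)\<^sup>2)"
      interpret approximate_mode b b' \<kappa> \<nu> T \<rho> G Gt Gy Gyy using mode by (simp add: T_def)
      have "energy T \<le> 1 - c"
      proof (rule ccontr)
        assume "\<not> energy T \<le> 1 - c"
        then interpret stuck_mode b b' \<kappa> \<nu> T \<rho> G Gt Gy Gyy c
          by unfold_locales (use c_bounds start \<rho> in \<open>auto simp: energy_def T_def\<close>)
        show False
        proof (cases "\<nu> < \<nu>0")
          case True
          have l: "\<Lambda> \<nu> = \<bar>ln \<nu>\<bar> powr (1 / P)" using True by (simp add: \<Lambda>_def)
          have "\<nu> < exp (- (M powr P))" using True by (simp add: \<nu>0_def)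
          then have "ln \<nu> < - (M powr P)" using \<nu> by (metis exp_gt_zero ln_exp ln_less_cancel_iff)
          then have "M powr P \<le> \<bar>ln \<nu>\<bar>" by simp
          then have "(M powr P) powr (1 / P) \<le> \<bar>ln \<nu>\<bar> powr (1 / P)" using P by (intro powr_mono2) auto
          then have Ml: "M \<le> \<Lambda> \<nu>" using P M by (simp add: powr_powr l)
          define \<eta> where "\<eta> = \<nu> powr (1 / 16)"
          have "\<eta> \<le> ((1 / E) powr 16) powr (1 / 16)"
            unfolding \<eta>_def using True \<nu> by (intro powr_mono2) (auto simp: \<nu>0_def)
          also have "\<dots> = 1 / E" unfolding powr_powr using E(1) by simp
          finally have "\<eta> \<le> 1 / E" .
          then have E\<eta>: "E * \<eta> \<le> 1" using E(1) by (simp add: field_simps)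
          have \<eta>: "x * \<eta> \<le> 1" if "x \<le> E" for x
            using mult_right_mono[OF that, of \<eta>] E\<eta> by (simp add: \<eta>_def)
          have "(320 * card Z * H)\<^sup>2 * c \<le> (320 * card Z * H + 1)\<^sup>2 * (1 / (320 * card Z * H + 1)\<^sup>2)"
          proof (rule mult_mono)
            show "(320 * card Z * H)\<^sup>2 \<le> (320 * card Z * H + 1)\<^sup>2" using H0 by (intro power_mono) auto
            show "c \<le> 1 / (320 * card Z * H + 1)\<^sup>2" by (rule c_bounds(3))
          qed (use c_bounds(1) in auto)
          also have "\<dots> = 1" using nz by simp
          finally have cs: "(320 * card Z * H)\<^sup>2 * c \<le> 1" .
          have A: "(\<Lambda> \<nu>)\<^sup>2 * \<nu> powr (1 / 16) \<le> A"
            unfolding l sq A_def using P \<nu> by (intro ln_powr_le_powr) auto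
          show False
            by (rule not_stuck[OF b'' L K Z C0 \<nu>(2) off \<kappa> P l _ T_def A H_def _ _ cs
                 \<eta>[OF E(2), unfolded \<eta>_def] \<eta>[OF E(3), unfolded \<eta>_def] \<eta>[OF E(4), unfolded \<eta>_def]])
               (use M Ml in auto)
        next
          case False
          then have "\<nu> * \<kappa>\<^sup>2 * T = \<kappa>\<^sup>2 / \<Lambda>0\<^sup>2" using \<nu> by (simp add: T_def \<Lambda>_def)
          then have "\<kappa>\<^sup>2 / \<Lambda>0\<^sup>2 \<le> 4 * c" using wavenumber_le by simp
          then have "\<kappa>\<^sup>2 \<le> 4 * c * \<Lambda>0\<^sup>2" using \<Lambda>0 by (simp add: pos_divide_le_eq)
          also have "\<dots> \<le> 1 / 2" using c_bounds(4) \<Lambda>0 by (simp add: field_simps)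
          finally show False using power_mono[OF \<kappa>, of 2] by simp
        qed
      qed
      then show "integral {0..1} (\<lambda>y. (cmod (G (1 / (\<nu> * (\<Lambda> \<nu>)\<^sup>2)) y))\<^sup>2) \<le> 1 - c"
        by (simp add: energy_def T_def)
    qed
  qed auto
qed

section \<open>The Fejer kernel\<close>

text \<open>The squared modulus of a geometric sum: positivity is evident and the decay away from
  integers follows from the summation formula.\<close>

definition fejer :: "nat \<Rightarrow> real \<Rightarrow> real" where
  "fejer N s = (cmod (\<Sum>j<N. cis (2 * pi * s) ^ j))\<^sup>2 / real N"

definition fejer_weight :: "nat \<Rightarrow> int \<Rightarrow> real" where
  "fejer_weight N l = 1 - \<bar>real_of_int l\<bar> / real N"

lemma fejer_nonneg: "0 \<le> fejer N s"
  by (simp add: fejer_def)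

lemma sum_symmetric_int_Suc:
  fixes f :: "int \<Rightarrow> 'a :: comm_monoid_add"
  shows "(\<Sum>l = - int (Suc n)..int (Suc n). f l) = f (int (Suc n)) + f (- int (Suc n)) + (\<Sum>l = - int n..int n. f l)"
proof -
  have "{- int (Suc n)..int (Suc n)} = insert (int (Suc n)) (insert (- int (Suc n)) {- int n..int n})" by auto
  then show ?thesis by (simp add: add.assoc)
qed

lemma dirichlet_kernel_split:
  fixes f :: "int \<Rightarrow> 'a :: comm_monoid_add"
  shows "(\<Sum>l = - int n..int n. f l) = f 0 + (\<Sum>j<n. f (int j - int n) + f (int n - int j))"
proof (induction n)
  case (Suc n)
  have "(\<Sum>j<Suc n. f (int j - int (Suc n)) + f (int (Suc n) - int j))
      = f (- int (Suc n)) + f (int (Suc n)) + (\<Sum>j<n. f (int j - int n) + f (int n - int j))"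
    by (subst sum.lessThan_Suc_shift) (simp add: algebra_simps)
  then show ?case
    unfolding sum_symmetric_int_Suc Suc by (simp add: add_ac)
qed simp

text \<open>Passing from \<open>n\<close> to \<open>n + 1\<close> adds the Dirichlet kernel: the
  square of the new power is its central term, and the cross terms with the old sum are the others.
  Each coefficient \<open>n - |l|\<close> rises by one accordingly.\<close>

lemma norm_square_geometric_sum:
  "complex_of_real ((cmod (\<Sum>j<n. cis \<theta> ^ j))\<^sup>2) = (\<Sum>l = - int n..int n. of_real (real n - \<bar>real_of_int l\<bar>) * cis (of_int l * \<theta>))"
proof (induction n)
  case (Suc n)
  define S where "S = (\<Sum>j<n. cis \<theta> ^ j)"
  define \<zeta> where "\<zeta> l = cis (of_int l * \<theta>)" for l :: int
  have "complex_of_real ((cmod (S + cis \<theta> ^ n))\<^sup>2) = (S + cis \<theta> ^ n) * cnj (S + cis \<theta> ^ n)"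
    by (rule complex_norm_square)
  also have "\<dots> = S * cnj S + (cnj (cis \<theta> ^ n) * S + cis \<theta> ^ n * cnj S) + cis \<theta> ^ n * cnj (cis \<theta> ^ n)"
    by (simp add: algebra_simps)
  also have "cis \<theta> ^ n * cnj (cis \<theta> ^ n) = \<zeta> 0"
    by (subst complex_norm_square[symmetric]) (simp add: \<zeta>_def norm_power)
  also have "cnj (cis \<theta> ^ n) * S + cis \<theta> ^ n * cnj S = (\<Sum>j<n. \<zeta> (int j - int n) + \<zeta> (int n - int j))"
    unfolding S_def cnj_sum sum_distrib_left sum.distrib[symmetric]
  proof (intro sum.cong refl arg_cong2[of _ _ _ _ "(+)"])
    fix j :: nat
    show "cnj (cis \<theta> ^ n) * cis \<theta> ^ j = \<zeta> (int j - int n)"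
      unfolding \<zeta>_def Complex.DeMoivre cis_cnj cis_mult by (simp add: algebra_simps)
    show "cis \<theta> ^ n * cnj (cis \<theta> ^ j) = \<zeta> (int n - int j)"
      unfolding \<zeta>_def Complex.DeMoivre cis_cnj cis_mult by (simp add: algebra_simps)
  qed
  also have "S * cnj S = complex_of_real ((cmod S)\<^sup>2)" by (rule complex_norm_square[symmetric])
  finally have "complex_of_real ((cmod (S + cis \<theta> ^ n))\<^sup>2) = of_real ((cmod S)\<^sup>2) + (\<Sum>l = - int n..int n. \<zeta> l)"
    unfolding dirichlet_kernel_split by (simp add: add_ac)
  also have "\<dots> = (\<Sum>l = - int n..int n. of_real (real (Suc n) - \<bar>real_of_int l\<bar>) * \<zeta> l)"
    unfolding S_def Suc \<zeta>_def[symmetric] sum.distrib[symmetric]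
    by (intro sum.cong refl) (simp add: algebra_simps)
  finally show ?case
    unfolding sum_symmetric_int_Suc by (simp add: S_def \<zeta>_def add.commute)
qed simp

text \<open>The weights vanish at \<open>l = N\<close> and \<open>l = - N\<close>; including these
  terms matches the square truncation of Fourier series on the torus.\<close>

lemma fejer_expansion:
  assumes "N > 0"
  shows "complex_of_real (fejer N s) = (\<Sum>l = - int N..int N. of_real (fejer_weight N l) * cis (2 * pi * of_int l * s))"
proof -
  have "complex_of_real (fejer N s) = of_real ((cmod (\<Sum>j<N. cis (2 * pi * s) ^ j))\<^sup>2) / of_nat N"
    by (simp add: fejer_def)
  also have "\<dots> = (\<Sum>l = - int N..int N. of_real (real N - \<bar>real_of_int l\<bar>) * cis (of_int l * (2 * pi * s)) / of_nat N)"
    by (simp only: norm_square_geometric_sum sum_divide_distrib)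
  also have "\<dots> = (\<Sum>l = - int N..int N. of_real (fejer_weight N l) * cis (2 * pi * of_int l * s))"
  proof (intro sum.cong refl)
    fix l :: int
    have "of_real (real N - \<bar>real_of_int l\<bar>) / of_nat N = complex_of_real (fejer_weight N l)"
      using assms by (simp add: fejer_weight_def diff_divide_distrib)
    then show "of_real (real N - \<bar>real_of_int l\<bar>) * cis (of_int l * (2 * pi * s)) / of_nat N
        = of_real (fejer_weight N l) * cis (2 * pi * of_int l * s)"
      by (metis (no_types, lifting) mult.commute mult.left_commute times_divide_eq_left)
  qed
  finally show ?thesis .
qed

lemma norm_one_minus_cis_sq: "(cmod (1 - cis (2 * a)))\<^sup>2 = 4 * (sin a)\<^sup>2"
proof -
  have "(cmod (1 - cis (2 * a)))\<^sup>2 = (1 - cos (2 * a))\<^sup>2 + (sin (2 * a))\<^sup>2" by (simp add: cmod_power2)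
  also have "\<dots> = 2 - 2 * cos (2 * a)" using sin_cos_squared_add[of "2 * a"] by (simp add: power2_eq_square algebra_simps)
  also have "\<dots> = 4 * (sin a)\<^sup>2" by (simp add: cos_double_sin)
  finally show ?thesis .
qed

text \<open>With \<open>z = cis (2 * pi * s)\<close>, the geometric sum times \<open>1 - z\<close>
  is \<open>1 - z ^ N\<close>, of modulus at most 2, while \<open>|1 - z|^2\<close> is four times
  the squared sine.\<close>

lemma fejer_sin_le: "fejer N s * (sin (pi * s))\<^sup>2 \<le> 1 / real N"
proof -
  define z where "z = cis (2 * pi * s)"
  have "(1 - z) * (\<Sum>j<N. z ^ j) = 1 - z ^ N" by (simp add: one_diff_power_eq)
  then have "(cmod (1 - z))\<^sup>2 * (cmod (\<Sum>j<N. z ^ j))\<^sup>2 = (cmod (1 - z ^ N))\<^sup>2"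
    by (metis norm_mult power_mult_distrib)
  moreover have "cmod (1 - z ^ N) \<le> 2" using norm_triangle_ineq4[of 1 "z ^ N"] by (simp add: z_def norm_power)
  then have "(cmod (1 - z ^ N))\<^sup>2 \<le> 2\<^sup>2" by (intro power_mono) auto
  ultimately have "4 * (sin (pi * s))\<^sup>2 * (cmod (\<Sum>j<N. z ^ j))\<^sup>2 \<le> 4"
    using norm_one_minus_cis_sq[of "pi * s"] by (simp add: z_def mult.assoc)
  then have "(sin (pi * s))\<^sup>2 * (cmod (\<Sum>j<N. z ^ j))\<^sup>2 / real N \<le> 1 / real N"
    by (intro divide_right_mono) auto
  then show ?thesis by (simp add: fejer_def z_def mult.commute)
qed

text \<open>Factor the left side as \<open>sqrt K * x\<close> times \<open>sqrt K * |sin|\<close>,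
  where the second factor is at most \<open>1 / sqrt N\<close>. The result integrates to the unit
  mass of the kernel and the square integral of \<open>x\<close>, so it applies to solutions without
  a supremum bound.\<close>

lemma fejer_sin_mult_le:
  assumes "N > 0" "0 \<le> x"
  shows "fejer N s * \<bar>sin (pi * s)\<bar> * x \<le> (fejer N s + x\<^sup>2) / (2 * sqrt (real N))"
proof -
  define q where "q = sqrt (fejer N s)"
  have q: "0 \<le> q" "q\<^sup>2 = fejer N s" using fejer_nonneg by (auto simp: q_def)
  have "(q * \<bar>sin (pi * s)\<bar>)\<^sup>2 \<le> (1 / sqrt (real N))\<^sup>2"
    using fejer_sin_le[of N s] q by (simp add: power_mult_distrib power_divide)
  then have "q * \<bar>sin (pi * s)\<bar> \<le> 1 / sqrt (real N)" by (rule power2_le_imp_le) simp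
  then have "q * x * (q * \<bar>sin (pi * s)\<bar>) \<le> q * x * (1 / sqrt (real N))"
    using q assms by (intro mult_left_mono) auto
  moreover have "q * x \<le> (q\<^sup>2 + x\<^sup>2) / 2" using zero_le_power2[of "q - x"] by (simp add: power2_diff)
  then have "q * x * (1 / sqrt (real N)) \<le> (q\<^sup>2 + x\<^sup>2) / 2 * (1 / sqrt (real N))" by (intro mult_right_mono) auto
  ultimately have "q\<^sup>2 * \<bar>sin (pi * s)\<bar> * x \<le> (q\<^sup>2 + x\<^sup>2) / (2 * sqrt (real N))"
    by (simp add: power2_eq_square mult_ac)
  then show ?thesis by (simp add: q)
qed

text \<open>For \<open>0 \<le> x \<le> 2\<close> the cubic Taylor bound gives
  \<open>sin x \<ge> x - x^3 / 6 \<ge> x / 3\<close>; then \<open>pi \<ge> 2\<close>.\<close>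

lemma sin_pi_ge:
  assumes "0 \<le> m" "m \<le> 1 / 2"
  shows "m / 2 \<le> sin (pi * m)"
proof -
  define x where "x = pi * m"
  have x: "0 \<le> x" "x \<le> 2" using assms pi_less_4 mult_mono[of pi 4 m "1/2"] by (auto simp: x_def)
  have "\<bar>sin x - (\<Sum>m<3. sin_coeff m * x ^ m)\<bar> \<le> inverse (fact 3) * \<bar>x\<bar> ^ 3"
    by (rule Maclaurin_sin_bound)
  then have "\<bar>sin x - x\<bar> \<le> x ^ 3 / 6" using x by (simp add: sin_coeff_def numeral_3_eq_3 lessThan_Suc fact_reduce)
  then have "x - x ^ 3 / 6 \<le> sin x" by linarith
  moreover have "x * x\<^sup>2 \<le> x * 2\<^sup>2" using x by (intro mult_left_mono power_mono) auto
  then have "x / 3 \<le> x - x ^ 3 / 6" by (simp add: power3_eq_cube power2_eq_square)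
  moreover have "m / 2 \<le> x / 3" using assms pi_ge_two mult_right_mono[of 2 pi m] by (simp add: x_def)
  ultimately show ?thesis by (simp add: x_def)
qed

text \<open>\<open>|sin (pi (x - y))|\<close> is comparable to the distance on the circle. If the
  points are more than one half apart, the shorter way leads through the endpoint, where
  \<open>h 1 = h 0\<close>.\<close>

lemma lipschitz_on_circle:
  fixes h :: "real \<Rightarrow> real"
  assumes lip: "\<And>x y. x \<in> {0..1} \<Longrightarrow> y \<in> {0..1} \<Longrightarrow> \<bar>h x - h y\<bar> \<le> M * \<bar>x - y\<bar>"
    and per: "h 1 = h 0" and xy: "x \<in> {0..1}" "y \<in> {0..1}"
  shows "\<bar>h x - h y\<bar> \<le> 2 * M * \<bar>sin (pi * (x - y))\<bar>"
proof -
  have M: "0 \<le> M" using lip[of 1 0] by simp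
  have *: "\<bar>h x - h y\<bar> \<le> 2 * M * \<bar>sin (pi * (x - y))\<bar>" if xy: "x \<in> {0..1}" "y \<in> {0..1}" "y \<le> x" for x y
  proof (cases "x - y \<le> 1 / 2")
    case True
    have "\<bar>h x - h y\<bar> \<le> M * (x - y)" using lip[OF xy(1,2)] xy by simp
    also have "\<dots> \<le> M * (2 * \<bar>sin (pi * (x - y))\<bar>)"
      using sin_pi_ge[of "x - y"] True xy M by (intro mult_left_mono) auto
    finally show ?thesis by simp
  next
    case False
    have "\<bar>h x - h y\<bar> \<le> \<bar>h x - h 1\<bar> + \<bar>h 0 - h y\<bar>" using per by simp
    also have "\<dots> \<le> M * (1 - x) + M * y" using lip[of x 1] lip[of 0 y] xy by (intro add_mono) auto
    also have "\<dots> = M * (1 - (x - y))" by (simp add: algebra_simps)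
    also have "\<dots> \<le> M * (2 * \<bar>sin (pi * (1 - (x - y)))\<bar>)"
      using sin_pi_ge[of "1 - (x - y)"] False xy M by (intro mult_left_mono) auto
    also have "sin (pi * (1 - (x - y))) = sin (pi * (x - y))"
      using sin_pi_minus[of "pi * (x - y)"] by (simp add: algebra_simps)
    finally show ?thesis by simp
  qed
  show ?thesis
  proof (cases "y \<le> x")
    case False
    have "pi * (x - y) = - (pi * (y - x))" by (simp add: algebra_simps)
    then have "sin (pi * (x - y)) = - sin (pi * (y - x))" by (simp only: sin_minus)
    then show ?thesis using *[of y x] xy False by (simp add: abs_minus_commute)
  qed (use * xy in auto)
qed

section \<open>Fourier series on the torus\<close>

lemma space_torus2 [simp]: "space torus2 = {0..<1} \<times> {0..<1}"
  by (simp add: torus2_def space_restrict_space)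

lemma space_torus1 [simp]: "space torus1 = {0..<1}"
  by (simp add: torus1_def space_restrict_space)

lemma square_borel: "{0..<1::real} \<times> {0..<1::real} \<in> sets borel"
  by (intro borel_Times) auto

lemma measurable_torus2: "f \<in> borel_measurable borel \<Longrightarrow> f \<in> borel_measurable torus2"
  unfolding torus2_def by (intro measurable_restrict_space1) simp

lemma integral_torus2:
  fixes g :: "real \<times> real \<Rightarrow> 'a :: {banach, second_countable_topology}"
  shows "(LINT z|torus2. g z) = (LINT z|lborel. indicator ({0..<1} \<times> {0..<1}) z *\<^sub>R g z)"
  unfolding torus2_def using square_borel by (subst integral_restrict_space) auto

lemma integral_torus1:
  fixes g :: "real \<Rightarrow> 'a :: {banach, second_countable_topology}"
  shows "(LINT z|torus1. g z) = (LINT z|lborel. indicator {0..<1} z *\<^sub>R g z)"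
  unfolding torus1_def by (subst integral_restrict_space) auto

lemma integrable_torus2:
  fixes g :: "real \<times> real \<Rightarrow> 'a :: {banach, second_countable_topology}"
  shows "integrable torus2 g \<longleftrightarrow> integrable lborel (\<lambda>z. indicator ({0..<1} \<times> {0..<1}) z *\<^sub>R g z)"
  unfolding torus2_def using square_borel by (subst integrable_restrict_space) auto

lemma fubini_torus2:
  fixes g :: "real \<times> real \<Rightarrow> 'a :: {banach, second_countable_topology}"
  assumes "integrable torus2 g"
  shows "(LINT z|torus2. g z) = (LINT y|torus1. LINT x|torus1. g (x, y))"
proof -
  have "integrable (lborel \<Otimes>\<^sub>M lborel) (\<lambda>z. indicator ({0..<1} \<times> {0..<1}) z *\<^sub>R g z)"
    using assms by (simp add: integrable_torus2 lborel_prod)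
  then have "integrable (lborel \<Otimes>\<^sub>M lborel) (\<lambda>(x, y). indicator ({0..<1} \<times> {0..<1}) (x, y) *\<^sub>R g (x, y))"
    by (simp add: case_prod_beta')
  from lborel_pair.integral_snd[OF this]
  have "(LINT z|torus2. g z) = (LINT y|lborel. LINT x|lborel. indicator ({0..<1} \<times> {0..<1}) (x, y) *\<^sub>R g (x, y))"
    by (simp add: integral_torus2 lborel_prod case_prod_beta')
  also have "\<dots> = (LINT y|torus1. LINT x|torus1. g (x, y))"
    unfolding integral_torus1 by (intro Bochner_Integration.integral_cong refl) (auto simp: indicator_times split: split_indicator)
  finally show ?thesis .
qed

lemma emeasure_torus2: "emeasure torus2 (space torus2) = 1"
proof -
  have "emeasure torus2 (space torus2) = emeasure lborel ({0..<1::real} \<times> {0..<1::real})"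
    unfolding torus2_def using square_borel by (subst emeasure_restrict_space) (auto simp: space_restrict_space)
  also have "\<dots> = emeasure lborel {0..<1::real} * emeasure lborel {0..<1::real}"
    unfolding lborel_prod[symmetric] by (rule lborel.emeasure_pair_measure_Times) auto
  finally show ?thesis by simp
qed

interpretation torus2: finite_measure torus2
  by standard (use emeasure_torus2 in simp)

lemma measure_torus2 [simp]: "measure torus2 ({0..<1} \<times> {0..<1}) = 1"
  using emeasure_torus2 by (simp add: measure_def)

lemma integrable_torus2_bounded:
  fixes g :: "real \<times> real \<Rightarrow> 'a :: {banach, second_countable_topology}"
  assumes "g \<in> borel_measurable torus2" "\<And>z. z \<in> space torus2 \<Longrightarrow> norm (g z) \<le> B"
  shows "integrable torus2 g"
  by (rule torus2.integrable_const_bound[of _ B]) (use assms in auto)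

lemma integral_torus1_continuous:
  fixes g :: "real \<Rightarrow> 'a :: euclidean_space"
  assumes "continuous_on UNIV g"
  shows "(LINT x|torus1. g x) = integral {0..1} g"
proof -
  have [measurable]: "g \<in> borel_measurable borel" using assms by (rule borel_measurable_continuous_onI)
  have "(LINT x|torus1. g x) = (LINT x:{0..1}|lborel. g x)"
    unfolding integral_torus1 set_lebesgue_integral_def
  proof (rule integral_cong_AE)
    have "AE x in lborel. x \<noteq> (1 :: real)" by (rule AE_lborel_singleton)
    then show "AE x in lborel. indicator {0..<1} x *\<^sub>R g x = indicator {0..1} x *\<^sub>R g x"
      by eventually_elim (auto split: split_indicator)
  qed measurable
  also have "\<dots> = integral {0..1} g"
  proof (rule set_borel_integral_eq_integral)
    have "continuous_on {0..1} g" using assms continuous_on_subset by blast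
    then show "set_integrable lborel {0..1} g" by (rule borel_integrable_atLeastAtMost')
  qed
  finally show ?thesis .
qed

lemma integral_cis_period: "integral {0..1} (\<lambda>s. cis (2 * pi * of_int k * s)) = (if k = 0 then 1 else 0)"
proof (cases "k = 0")
  case False
  define a where "a = 2 * pi * real_of_int k"
  have a: "a \<noteq> 0" using False by (simp add: a_def)
  have "((\<lambda>s. cis (a * s)) has_integral cis (a * 1) / (\<i> * of_real a) - cis (a * 0) / (\<i> * of_real a)) {0..1}"
  proof (rule fundamental_theorem_of_calculus)
    fix s :: real
    have "((\<lambda>s. Complex (sin (a * s) / a) (- cos (a * s) / a)) has_vector_derivative Complex (cos (a * s)) (sin (a * s))) (at s within {0..1})"
      unfolding has_vector_derivative_complex_iff using a by (auto intro!: derivative_eq_intros)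
    moreover have "Complex (sin (a * s) / a) (- cos (a * s) / a) = cis (a * s) / (\<i> * of_real a)" for s
      using a by (simp add: complex_eq_iff Re_divide Im_divide power2_eq_square)
    ultimately show "((\<lambda>s. cis (a * s) / (\<i> * of_real a)) has_vector_derivative cis (a * s)) (at s within {0..1})"
      by (simp add: cis.code)
  qed simp
  moreover have "cis (a * 1) = 1" unfolding a_def using cis_multiple_2pi[of "of_int k"] by (simp add: mult.commute)
  ultimately show ?thesis using False by (simp add: a_def[symmetric] integral_unique)
qed simp

section \<open>Exponentials, Fourier coefficients and square-integrable functions\<close>

definition fourier_mode :: "int \<Rightarrow> int \<Rightarrow> real \<times> real \<Rightarrow> complex" where
  "fourier_mode k l z = cis (2 * pi * (of_int k * fst z + of_int l * snd z))"

definition fourier_coeff :: "(real \<times> real \<Rightarrow> complex) \<Rightarrow> int \<Rightarrow> int \<Rightarrow> complex" where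
  "fourier_coeff f k l = (LINT z|torus2. f z * fourier_mode (- k) (- l) z)"

lemma norm_fourier_mode [simp]: "cmod (fourier_mode k l z) = 1"
  by (simp add: fourier_mode_def)

lemma fourier_mode_mult: "fourier_mode k l z * fourier_mode k' l' z = fourier_mode (k + k') (l + l') z"
  by (simp add: fourier_mode_def cis_mult algebra_simps)

lemma cnj_fourier_mode: "cnj (fourier_mode k l z) = fourier_mode (- k) (- l) z"
  by (simp add: fourier_mode_def cis_cnj algebra_simps)

lemma measurable_fourier_mode [measurable]: "fourier_mode k l \<in> borel_measurable torus2"
  unfolding fourier_mode_def[abs_def]
  by (intro measurable_torus2 borel_measurable_continuous_onI continuous_intros)

lemma integral_fourier_mode: "(LINT z|torus2. fourier_mode k l z) = (if k = 0 \<and> l = 0 then 1 else 0)"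
proof -
  have c: "continuous_on UNIV (\<lambda>s. cis (2 * pi * of_int k * s))" for k by (intro continuous_intros)
  have "(LINT z|torus2. fourier_mode k l z) = (LINT y|torus1. LINT x|torus1. fourier_mode k l (x, y))"
    by (intro fubini_torus2 integrable_torus2_bounded[of _ 1]) auto
  also have "\<dots> = (LINT y|torus1. LINT x|torus1. cis (2 * pi * of_int k * x) * cis (2 * pi * of_int l * y))"
    by (simp add: fourier_mode_def cis_mult algebra_simps)
  also have "\<dots> = (LINT x|torus1. cis (2 * pi * of_int k * x)) * (LINT y|torus1. cis (2 * pi * of_int l * y))"
    by simp
  finally show ?thesis unfolding integral_torus1_continuous[OF c] integral_cis_period by simp
qed

definition mass :: "(real \<times> real \<Rightarrow> complex) \<Rightarrow> real" where
  "mass f = (LINT z|torus2. (cmod (f z))\<^sup>2)"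

lemma mass_nonneg: "0 \<le> mass f"
  by (simp add: mass_def)

lemma L2_norm_eq: "L2_norm f = sqrt (mass f)"
  by (simp add: L2_norm_def mass_def)

lemma L2_torusD:
  assumes "f \<in> L2_torus"
  shows "f \<in> borel_measurable torus2" "integrable torus2 (\<lambda>z. (cmod (f z))\<^sup>2)" "integrable torus2 f"
proof -
  show 1: "f \<in> borel_measurable torus2" and 2: "integrable torus2 (\<lambda>z. (cmod (f z))\<^sup>2)"
    using assms by (auto simp: L2_torus_def)
  show "integrable torus2 f"
  proof (rule Bochner_Integration.integrable_bound[of _ "\<lambda>z. 1 + (cmod (f z))\<^sup>2"])
    have "cmod w \<le> 1 + (cmod w)\<^sup>2" for w
      using zero_le_power2[of "cmod w - 1"] norm_ge_zero[of w] unfolding power2_diff one_power2 by linarith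
    then show "AE z in torus2. norm (f z) \<le> norm (1 + (cmod (f z))\<^sup>2)" by simp
  qed (use 1 2 in auto)
qed

lemma L2_torus_bounded:
  assumes "f \<in> borel_measurable torus2" "\<And>z. z \<in> space torus2 \<Longrightarrow> cmod (f z) \<le> B"
  shows "f \<in> L2_torus"
proof -
  have "0 \<le> B" using order_trans[OF norm_ge_zero assms(2)[of "(0, 0)"]] by simp
  then have "integrable torus2 (\<lambda>z. (cmod (f z))\<^sup>2)"
    using assms by (intro integrable_torus2_bounded[of _ "B\<^sup>2"]) (auto intro!: power_mono)
  then show ?thesis using assms by (simp add: L2_torus_def)
qed

lemma norm_add_square_le: "(cmod (z + w))\<^sup>2 \<le> 2 * (cmod z)\<^sup>2 + 2 * (cmod w)\<^sup>2"
  using norm_diff_square_le[of z "- w"] by simp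

lemma L2_torus_add:
  assumes "f \<in> L2_torus" "g \<in> L2_torus"
  shows "(\<lambda>z. f z + g z) \<in> L2_torus" "mass (\<lambda>z. f z + g z) \<le> 2 * mass f + 2 * mass g"
proof -
  note fg [measurable] = L2_torusD(1)[OF assms(1)] L2_torusD(1)[OF assms(2)]
  have i: "integrable torus2 (\<lambda>z. 2 * (cmod (f z))\<^sup>2 + 2 * (cmod (g z))\<^sup>2)"
    using assms[THEN L2_torusD(2)] by auto
  have i': "integrable torus2 (\<lambda>z. (cmod (f z + g z))\<^sup>2)"
    by (rule Bochner_Integration.integrable_bound[OF i]) (use norm_add_square_le in auto)
  then show "(\<lambda>z. f z + g z) \<in> L2_torus" by (simp add: L2_torus_def)
  have "mass (\<lambda>z. f z + g z) \<le> (LINT z|torus2. 2 * (cmod (f z))\<^sup>2 + 2 * (cmod (g z))\<^sup>2)"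
    unfolding mass_def using norm_add_square_le by (intro integral_mono i i') auto
  also have "\<dots> = 2 * mass f + 2 * mass g"
    using assms[THEN L2_torusD(2)] by (simp add: mass_def)
  finally show "mass (\<lambda>z. f z + g z) \<le> 2 * mass f + 2 * mass g" .
qed

lemma L2_torus_scale:
  assumes "f \<in> L2_torus"
  shows "(\<lambda>z. a * f z) \<in> L2_torus" "mass (\<lambda>z. a * f z) = (cmod a)\<^sup>2 * mass f"
  using assms by (auto simp: L2_torus_def mass_def norm_mult power_mult_distrib)

lemma L2_torus_diff:
  assumes "f \<in> L2_torus" "g \<in> L2_torus"
  shows "(\<lambda>z. f z - g z) \<in> L2_torus" "mass (\<lambda>z. f z - g z) \<le> 2 * mass f + 2 * mass g"
  using L2_torus_add[OF assms(1) L2_torus_scale(1)[OF assms(2), of "-1"]] L2_torus_scale(2)[OF assms(2), of "-1"]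
  by simp_all

lemma L2_torus_sum:
  assumes "\<And>i. i \<in> I \<Longrightarrow> f i \<in> L2_torus"
  shows "(\<lambda>z. \<Sum>i\<in>I. f i z) \<in> L2_torus"
  using assms
proof (induction I rule: infinite_finite_induct)
  case (insert i I)
  then show ?case using L2_torus_add(1)[of "f i" "\<lambda>z. \<Sum>i\<in>I. f i z"] by simp
qed (auto intro!: L2_torus_bounded[of _ 0])

lemma integrable_mult_bounded:
  assumes f: "integrable torus2 f" and g: "g \<in> borel_measurable torus2" "\<And>z. z \<in> space torus2 \<Longrightarrow> cmod (g z) \<le> B"
  shows "integrable torus2 (\<lambda>z. f z * g z :: complex)"
proof (rule Bochner_Integration.integrable_bound)
  show "integrable torus2 (\<lambda>z. B * norm (f z))" using f by simp
  show "AE z in torus2. norm (f z * g z) \<le> norm (B * norm (f z))"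
  proof (intro AE_I2)
    fix z assume z: "z \<in> space torus2"
    have "cmod (f z) * cmod (g z) \<le> cmod (f z) * B" using g(2)[OF z] by (rule mult_left_mono) simp
    then show "norm (f z * g z) \<le> norm (B * norm (f z))" by (simp add: norm_mult mult.commute abs_mult) (smt (verit) abs_ge_self mult_mono norm_ge_zero g(2)[OF z])
  qed
qed (use f g in auto)

lemma fourier_coeff_add:
  assumes "f \<in> L2_torus" "g \<in> L2_torus"
  shows "fourier_coeff (\<lambda>z. f z + g z) k l = fourier_coeff f k l + fourier_coeff g k l"
  unfolding fourier_coeff_def distrib_right using assms[THEN L2_torusD(3)]
  by (intro Bochner_Integration.integral_add integrable_mult_bounded[of _ _ 1]) auto

lemma fourier_coeff_scale: "fourier_coeff (\<lambda>z. a * f z) k l = a * fourier_coeff f k l"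
  by (simp add: fourier_coeff_def mult.assoc)

section \<open>Best approximation and the class of functions with Parseval's identity\<close>

definition trig_poly :: "nat \<Rightarrow> (int \<Rightarrow> int \<Rightarrow> complex) \<Rightarrow> real \<times> real \<Rightarrow> complex" where
  "trig_poly N p z = (\<Sum>(k, l)\<in>{- int N..int N} \<times> {- int N..int N}. p k l * fourier_mode k l z)"

lemma trig_poly_L2: "trig_poly N p \<in> L2_torus"
  unfolding trig_poly_def[abs_def] case_prod_beta
  by (intro L2_torus_sum L2_torus_scale L2_torus_bounded[of _ 1]) auto

text \<open>Orthonormality of the exponentials completes the square in the coefficients
  \<open>p\<close>. Taking \<open>p = fourier_coeff f\<close> yields Bessel's inequality, and
  comparison with other \<open>p\<close> shows that this choice is the best approximation.\<close>

lemma mass_diff_trig_poly: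
  assumes f: "f \<in> L2_torus"
  defines "S \<equiv> \<lambda>N. {- int N..int N} \<times> {- int N..int N}"
  shows "mass (\<lambda>z. f z - trig_poly N p z) = mass f - (\<Sum>(k, l)\<in>S N. (cmod (fourier_coeff f k l))\<^sup>2)
    + (\<Sum>(k, l)\<in>S N. (cmod (fourier_coeff f k l - p k l))\<^sup>2)"
proof -
  define q where "q \<kappa> = p (fst \<kappa>) (snd \<kappa>)" for \<kappa>
  define e where "e \<kappa> = fourier_mode (fst \<kappa>) (snd \<kappa>)" for \<kappa>
  define a where "a \<kappa> = fourier_coeff f (fst \<kappa>) (snd \<kappa>)" for \<kappa>
  have fin: "finite (S N)" by (simp add: S_def)
  have P: "trig_poly N p z = (\<Sum>\<kappa>\<in>S N. q \<kappa> * e \<kappa> z)" for z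
    by (simp add: trig_poly_def S_def q_def e_def case_prod_beta)
  have em: "e \<kappa> \<in> borel_measurable torus2" "\<And>z. cmod (e \<kappa> z) \<le> 1" for \<kappa> by (auto simp: e_def)
  have ce: "(\<lambda>z. cnj (e \<kappa> z)) \<in> borel_measurable torus2" "\<And>z. cmod (cnj (e \<kappa> z)) \<le> 1" for \<kappa>
    by (auto simp: e_def cnj_fourier_mode)
  have a: "(LINT z|torus2. f z * cnj (e \<kappa> z)) = a \<kappa>" for \<kappa>
    by (simp add: a_def e_def fourier_coeff_def cnj_fourier_mode)
  have fi: "integrable torus2 (\<lambda>z. f z * cnj (e \<kappa> z))" for \<kappa>
    by (rule integrable_mult_bounded[OF L2_torusD(3)[OF f] ce])
  have ei: "integrable torus2 (\<lambda>z. e \<kappa> z * cnj (e \<kappa>' z))" for \<kappa> \<kappa>'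
    by (intro integrable_mult_bounded[OF integrable_torus2_bounded[of _ 1] ce] em)
  have orth: "(LINT z|torus2. e \<kappa> z * cnj (e \<kappa>' z)) = (if \<kappa> = \<kappa>' then 1 else 0)" for \<kappa> \<kappa>'
    by (simp add: e_def cnj_fourier_mode fourier_mode_mult integral_fourier_mode prod_eq_iff)
  have "(LINT z|torus2. f z * cnj (trig_poly N p z)) = (LINT z|torus2. (\<Sum>\<kappa>\<in>S N. cnj (q \<kappa>) * (f z * cnj (e \<kappa> z))))"
    unfolding P cnj_sum sum_distrib_left by (simp add: mult_ac)
  also have "\<dots> = (\<Sum>\<kappa>\<in>S N. cnj (q \<kappa>) * a \<kappa>)"
    using fi by (simp add: a)
  finally have I1: "(LINT z|torus2. f z * cnj (trig_poly N p z)) = (\<Sum>\<kappa>\<in>S N. cnj (q \<kappa>) * a \<kappa>)" .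
  have i1: "integrable torus2 (\<lambda>z. f z * cnj (trig_poly N p z))"
  proof -
    have "integrable torus2 (\<lambda>z. (\<Sum>\<kappa>\<in>S N. cnj (q \<kappa>) * (f z * cnj (e \<kappa> z))))"
      using fi by (intro Bochner_Integration.integrable_sum) auto
    then show ?thesis unfolding P cnj_sum sum_distrib_left by (simp add: mult_ac)
  qed
  have "(LINT z|torus2. trig_poly N p z * cnj (trig_poly N p z))
      = (LINT z|torus2. (\<Sum>\<kappa>\<in>S N. \<Sum>\<kappa>'\<in>S N. q \<kappa> * cnj (q \<kappa>') * (e \<kappa> z * cnj (e \<kappa>' z))))"
    unfolding P cnj_sum sum_product by (simp add: mult_ac)
  also have "\<dots> = (\<Sum>\<kappa>\<in>S N. \<Sum>\<kappa>'\<in>S N. q \<kappa> * cnj (q \<kappa>') * (if \<kappa> = \<kappa>' then 1 else 0))"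
    using ei by (simp add: orth)
  also have "\<dots> = (\<Sum>\<kappa>\<in>S N. q \<kappa> * cnj (q \<kappa>))"
    using fin by (intro sum.cong refl) (simp add: if_distrib[of "\<lambda>x. _ * x"] sum.delta' cong: if_cong)
  finally have I2: "(LINT z|torus2. trig_poly N p z * cnj (trig_poly N p z)) = (\<Sum>\<kappa>\<in>S N. q \<kappa> * cnj (q \<kappa>))" .
  have mP: "mass (trig_poly N p) = (\<Sum>\<kappa>\<in>S N. (cmod (q \<kappa>))\<^sup>2)"
  proof -
    have "complex_of_real (mass (trig_poly N p)) = (LINT z|torus2. trig_poly N p z * cnj (trig_poly N p z))"
      by (simp only: mass_def integral_complex_of_real[symmetric] complex_norm_square)
    also have "\<dots> = of_real (\<Sum>\<kappa>\<in>S N. (cmod (q \<kappa>))\<^sup>2)"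
      unfolding I2 of_real_sum complex_norm_square ..
    finally show ?thesis by (simp only: of_real_eq_iff)
  qed
  have pt: "(cmod (z - w))\<^sup>2 = (cmod z)\<^sup>2 - 2 * Re (z * cnj w) + (cmod w)\<^sup>2" for z w
    unfolding cmod_power2 by (simp add: power2_eq_square algebra_simps)
  have ri: "integrable torus2 (\<lambda>z. 2 * Re (f z * cnj (trig_poly N p z)))"
    using i1 by (intro integrable_mult_right integrable_Re)
  have "mass (\<lambda>z. f z - trig_poly N p z) = mass f - 2 * Re (LINT z|torus2. f z * cnj (trig_poly N p z)) + mass (trig_poly N p)"
    unfolding mass_def pt
    by (simp only: Bochner_Integration.integral_add[OF Bochner_Integration.integrable_diff[OF L2_torusD(2)[OF f] ri] L2_torusD(2)[OF trig_poly_L2]]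
        Bochner_Integration.integral_diff[OF L2_torusD(2)[OF f] ri] integral_mult_right_zero integral_Re[OF i1])
  also have "\<dots> = mass f - (\<Sum>\<kappa>\<in>S N. (cmod (a \<kappa>))\<^sup>2) + (\<Sum>\<kappa>\<in>S N. (cmod (a \<kappa> - q \<kappa>))\<^sup>2)"
    unfolding I1 mP pt sum.distrib sum_subtractf sum_distrib_left[symmetric] Re_sum[symmetric] by (simp add: mult.commute)
  finally show ?thesis by (simp add: a_def q_def case_prod_beta)
qed

text \<open>The gap in Bessel's inequality, equivalently the squared distance in \<open>L^2\<close>
  from \<open>f\<close> to the trigonometric polynomials of degree at most \<open>N\<close> in each
  variable.\<close>

definition fourier_defect :: "(real \<times> real \<Rightarrow> complex) \<Rightarrow> nat \<Rightarrow> real" where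
  "fourier_defect f N = mass f - (\<Sum>(k, l)\<in>{- int N..int N} \<times> {- int N..int N}. (cmod (fourier_coeff f k l))\<^sup>2)"

lemma fourier_defect_eq:
  "f \<in> L2_torus \<Longrightarrow> fourier_defect f N = mass (\<lambda>z. f z - trig_poly N (fourier_coeff f) z)"
  by (simp add: mass_diff_trig_poly fourier_defect_def)

lemma fourier_defect_nonneg: "f \<in> L2_torus \<Longrightarrow> 0 \<le> fourier_defect f N"
  by (simp add: fourier_defect_eq mass_nonneg)

lemma fourier_defect_le_mass: "f \<in> L2_torus \<Longrightarrow> fourier_defect f N \<le> mass f"
  by (auto simp: fourier_defect_def case_prod_beta intro!: sum_nonneg)

lemma fourier_defect_le: "f \<in> L2_torus \<Longrightarrow> fourier_defect f N \<le> mass (\<lambda>z. f z - trig_poly N p z)"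
  by (auto simp: mass_diff_trig_poly fourier_defect_def case_prod_beta intro!: sum_nonneg)

lemma fourier_defect_add:
  assumes f: "f \<in> L2_torus" and g: "g \<in> L2_torus"
  shows "fourier_defect (\<lambda>z. f z + g z) N \<le> 2 * fourier_defect f N + 2 * fourier_defect g N"
proof -
  have "trig_poly N (fourier_coeff (\<lambda>z. f z + g z)) z = trig_poly N (fourier_coeff f) z + trig_poly N (fourier_coeff g) z" for z
    by (simp add: trig_poly_def fourier_coeff_add[OF f g] case_prod_beta sum.distrib distrib_right)
  then have "fourier_defect (\<lambda>z. f z + g z) N
      = mass (\<lambda>z. (f z - trig_poly N (fourier_coeff f) z) + (g z - trig_poly N (fourier_coeff g) z))"
    by (simp add: fourier_defect_eq[OF L2_torus_add(1)[OF f g]] algebra_simps)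
  also have "\<dots> \<le> 2 * fourier_defect f N + 2 * fourier_defect g N"
    unfolding fourier_defect_eq[OF f] fourier_defect_eq[OF g]
    by (rule L2_torus_add(2)[OF L2_torus_diff(1)[OF f trig_poly_L2] L2_torus_diff(1)[OF g trig_poly_L2]])
  finally show ?thesis .
qed

definition parseval :: "(real \<times> real \<Rightarrow> complex) \<Rightarrow> bool" where
  "parseval f \<longleftrightarrow> f \<in> L2_torus \<and> fourier_defect f \<longlonglongrightarrow> 0"

lemma parseval_add:
  assumes "parseval f" "parseval g"
  shows "parseval (\<lambda>z. f z + g z)"
proof -
  have L: "f \<in> L2_torus" "g \<in> L2_torus" using assms by (auto simp: parseval_def)
  have "(\<lambda>N. 2 * fourier_defect f N + 2 * fourier_defect g N) \<longlonglongrightarrow> 2 * 0 + 2 * 0"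
    using assms unfolding parseval_def by (intro tendsto_intros) auto
  then have lim: "(\<lambda>N. 2 * fourier_defect f N + 2 * fourier_defect g N) \<longlonglongrightarrow> 0" by simp
  have "fourier_defect (\<lambda>z. f z + g z) \<longlonglongrightarrow> 0"
    by (rule tendsto_sandwich[OF always_eventually always_eventually tendsto_const lim])
       (simp_all add: fourier_defect_add[OF L] fourier_defect_nonneg[OF L2_torus_add(1)[OF L]])
  then show ?thesis using L2_torus_add(1)[OF L] by (simp add: parseval_def)
qed

lemma parseval_scale:
  assumes "parseval f"
  shows "parseval (\<lambda>z. a * f z)"
proof -
  have L: "f \<in> L2_torus" using assms by (auto simp: parseval_def)
  have "fourier_defect (\<lambda>z. a * f z) = (\<lambda>N. (cmod a)\<^sup>2 * fourier_defect f N)"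
    by (simp add: fourier_defect_def[abs_def] fourier_coeff_scale L2_torus_scale[OF L] norm_mult power_mult_distrib
        case_prod_beta sum_distrib_left right_diff_distrib)
  moreover have "(\<lambda>N. (cmod a)\<^sup>2 * fourier_defect f N) \<longlonglongrightarrow> (cmod a)\<^sup>2 * 0"
    using assms unfolding parseval_def by (intro tendsto_intros) auto
  ultimately show ?thesis using L2_torus_scale(1)[OF L] by (simp add: parseval_def)
qed

lemma parseval_cong:
  assumes "parseval f" "\<And>z. z \<in> space torus2 \<Longrightarrow> f z = g z"
  shows "parseval g"
proof -
  have m: "mass f = mass g"
    unfolding mass_def by (rule Bochner_Integration.integral_cong) (simp_all only: assms(2))
  have c: "fourier_coeff f = fourier_coeff g"
    unfolding fourier_coeff_def[abs_def]
    by (intro ext Bochner_Integration.integral_cong) (simp_all only: assms(2))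
  have "g \<in> L2_torus"
  proof -
    have "f \<in> L2_torus" using assms(1) by (simp add: parseval_def)
    moreover have "f \<in> borel_measurable torus2 \<longleftrightarrow> g \<in> borel_measurable torus2"
      by (rule measurable_cong) (rule assms(2))
    moreover have "integrable torus2 (\<lambda>z. (cmod (f z))\<^sup>2) \<longleftrightarrow> integrable torus2 (\<lambda>z. (cmod (g z))\<^sup>2)"
      by (rule Bochner_Integration.integrable_cong) (simp_all only: assms(2))
    ultimately show ?thesis by (simp add: L2_torus_def)
  qed
  moreover have "fourier_defect f = fourier_defect g"
    unfolding fourier_defect_def[abs_def] m c ..
  ultimately show ?thesis using assms(1) by (simp add: parseval_def)
qed

lemma parseval_zero: "parseval (\<lambda>z. 0)"
proof -
  have "(\<lambda>z. 0) \<in> L2_torus" by (rule L2_torus_bounded[of _ 0]) auto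
  moreover have "mass (\<lambda>z. 0) = 0" by (simp add: mass_def)
  ultimately show ?thesis
    by (simp add: parseval_def fourier_defect_def[abs_def] fourier_coeff_def case_prod_beta)
qed

lemma parseval_sum:
  assumes "\<And>i. i \<in> I \<Longrightarrow> parseval (f i)"
  shows "parseval (\<lambda>z. \<Sum>i\<in>I. f i z)"
  using assms
proof (induction I rule: infinite_finite_induct)
  case (insert i I)
  then show ?case using parseval_add[of "f i" "\<lambda>z. \<Sum>i\<in>I. f i z"] by simp
qed (auto intro: parseval_zero)

text \<open>The defect of \<open>f\<close> is at most twice that of \<open>F j\<close> plus twice
  the squared distance to \<open>F j\<close>, so the class is closed.\<close>

lemma parseval_limit:
  assumes f: "f \<in> L2_torus" and F: "\<And>j. parseval (F j)"
    and lim: "(\<lambda>j. mass (\<lambda>z. f z - F j z)) \<longlonglongrightarrow> 0"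
  shows "parseval f"
proof -
  have "fourier_defect f \<longlonglongrightarrow> 0"
  proof (rule LIMSEQ_I)
    fix \<epsilon> :: real assume \<epsilon>: "0 < \<epsilon>"
    obtain j where j: "mass (\<lambda>z. f z - F j z) < \<epsilon> / 4"
      using order_tendstoD(2)[OF lim, of "\<epsilon> / 4"] \<epsilon> by (auto simp: eventually_sequentially)
    have L: "F j \<in> L2_torus" "(\<lambda>z. f z - F j z) \<in> L2_torus"
      using F[of j] L2_torus_diff(1)[OF f] by (auto simp: parseval_def)
    have "fourier_defect (F j) \<longlonglongrightarrow> 0" using F by (simp add: parseval_def)
    from order_tendstoD(2)[OF this, of "\<epsilon> / 4"] \<epsilon>
    obtain N0 where N0: "\<And>N. N \<ge> N0 \<Longrightarrow> fourier_defect (F j) N < \<epsilon> / 4"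
      by (auto simp: eventually_sequentially)
    have "norm (fourier_defect f N - 0) < \<epsilon>" if "N \<ge> N0" for N
    proof -
      have "fourier_defect (\<lambda>z. (f z - F j z) + F j z) N \<le> 2 * fourier_defect (\<lambda>z. f z - F j z) N + 2 * fourier_defect (F j) N"
        by (rule fourier_defect_add[OF L(2,1)])
      moreover have "fourier_defect (\<lambda>z. f z - F j z) N \<le> mass (\<lambda>z. f z - F j z)"
        by (rule fourier_defect_le_mass[OF L(2)])
      ultimately show ?thesis
        using j N0[OF that] fourier_defect_nonneg[OF f, of N] by simp
    qed
    then show "\<exists>N0. \<forall>N\<ge>N0. norm (fourier_defect f N - 0) < \<epsilon>" by blast
  qed
  then show ?thesis using f by (simp add: parseval_def)
qed

lemma mass_tendsto_0:
  assumes [measurable]: "f \<in> borel_measurable torus2" "\<And>j. F j \<in> borel_measurable torus2"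
    and w: "integrable torus2 w" "\<And>j z. z \<in> space torus2 \<Longrightarrow> (cmod (f z - F j z))\<^sup>2 \<le> w z"
    and lim: "AE z in torus2. (\<lambda>j. F j z) \<longlonglongrightarrow> f z"
  shows "(\<lambda>j. mass (\<lambda>z. f z - F j z)) \<longlonglongrightarrow> 0"
proof -
  have "(\<lambda>j. LINT z|torus2. (cmod (f z - F j z))\<^sup>2) \<longlonglongrightarrow> (LINT z|torus2. 0)"
  proof (rule integral_dominated_convergence[where w = w])
    show "AE z in torus2. (\<lambda>j. (cmod (f z - F j z))\<^sup>2) \<longlonglongrightarrow> 0"
      using lim
    proof eventually_elim
      case (elim z)
      have "(\<lambda>j. (cmod (f z - F j z))\<^sup>2) \<longlonglongrightarrow> (cmod (f z - f z))\<^sup>2" by (intro tendsto_intros elim)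
      then show ?case by simp
    qed
    show "AE z in torus2. norm ((cmod (f z - F j z))\<^sup>2) \<le> w z" for j using w(2) by auto
  qed (use w in auto)
  then show ?thesis by (simp add: mass_def)
qed

section \<open>Fejer means of Lipschitz functions\<close>

lemma fejer_shift_expansion:
  assumes N: "N > 0"
  shows "complex_of_real (fejer N (y - snd z))
    = (\<Sum>l = - int N..int N. of_real (fejer_weight N l) * cis (2 * pi * of_int l * y) * fourier_mode 0 (- l) z)"
  unfolding fejer_expansion[OF N]
  by (intro sum.cong refl) (simp add: fourier_mode_def mult.assoc cis_mult algebra_simps)

text \<open>The kernel is regarded as a function on the square that is constant in \<open>x\<close>;
  its integral is then read off from the expansion, where only \<open>l = 0\<close>
  contributes.\<close>

lemma fejer_torus2:
  assumes N: "N > 0"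
  shows "integrable torus2 (\<lambda>z. fejer N (y - snd z))" "(LINT z|torus2. fejer N (y - snd z)) = 1"
proof -
  note eq = fejer_shift_expansion[OF N, of y]
  have fi: "integrable torus2 (fourier_mode k l)" for k l by (rule integrable_torus2_bounded[of _ 1]) auto
  have i: "integrable torus2 (\<lambda>z. complex_of_real (fejer N (y - snd z)))"
    unfolding eq by (intro Bochner_Integration.integrable_sum integrable_mult_right fi)
  then show ii: "integrable torus2 (\<lambda>z. fejer N (y - snd z))"
    using integrable_Re[OF i] by simp
  have "complex_of_real (LINT z|torus2. fejer N (y - snd z)) = (LINT z|torus2. complex_of_real (fejer N (y - snd z)))"
    by simp
  also have "\<dots> = (\<Sum>l = - int N..int N. of_real (fejer_weight N l) * cis (2 * pi * of_int l * y) * (if l = 0 then 1 else 0))"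
    unfolding eq using fi by (simp add: integral_fourier_mode)
  also have "\<dots> = (\<Sum>l = - int N..int N. if l = 0 then 1 else 0)"
    by (intro sum.cong refl) (simp add: fejer_weight_def)
  also have "\<dots> = 1" by simp
  finally show "(LINT z|torus2. fejer N (y - snd z)) = 1" by (simp only: of_real_eq_1_iff)
qed

text \<open>The sum with \<open>q l\<close>, the Fejer weight times the Fourier coefficient of
  \<open>h\<close>, is the convolution of \<open>h\<close> with the kernel. As the kernel has mass
  one, the error is at most \<open>L\<close> times the integral of \<open>K * |sin|\<close>, which
  \<open>fejer_sin_mult_le\<close> with \<open>x = 1\<close> bounds by
  \<open>1 / sqrt N\<close>.\<close>

lemma fejer_approximation:
  fixes h :: "real \<Rightarrow> real"
  assumes h: "continuous_on UNIV h" and lip: "\<And>x y. x \<in> {0..1} \<Longrightarrow> y \<in> {0..1} \<Longrightarrow> \<bar>h x - h y\<bar> \<le> L * \<bar>sin (pi * (x - y))\<bar>"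
    and N: "N > 0"
  obtains q where "\<And>y. y \<in> {0..1} \<Longrightarrow> cmod (h y - (\<Sum>l = - int N..int N. q l * cis (2 * pi * of_int l * y))) \<le> L / sqrt (real N)"
proof -
  have hm [measurable]: "(\<lambda>z. h (snd z)) \<in> borel_measurable torus2"
    by (intro measurable_torus2 borel_measurable_continuous_onI continuous_on_compose2[OF h] continuous_intros) auto
  have "bounded (h ` {0..1})"
    by (intro compact_imp_bounded compact_continuous_image continuous_on_subset[OF h]) auto
  then obtain B where "\<forall>x\<in>h ` {0..1}. norm x \<le> B" unfolding bounded_iff by blast
  then have B: "\<bar>h s\<bar> \<le> B" if "s \<in> {0..1}" for s using that by auto
  define q where "q l = fejer_weight N l * (LINT z|torus2. h (snd z) * fourier_mode 0 (- l) z)" for l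
  have L0: "0 \<le> L"
  proof -
    have "0 \<le> L * \<bar>sin (pi * (1 / 2 - 0))\<bar>" by (rule order_trans[OF abs_ge_zero lip]) auto
    then show ?thesis by simp
  qed
  show thesis
  proof (rule that[of q])
    fix y :: real assume y: "y \<in> {0..1}"
    note eq = fejer_shift_expansion[OF N, of y]
    have ih: "integrable torus2 (\<lambda>z. complex_of_real (h (snd z)) * fourier_mode 0 l z)" for l
      by (rule integrable_torus2_bounded[of _ B]) (auto simp: norm_mult intro!: B)
    have hF: "integrable torus2 (\<lambda>z. complex_of_real (h (snd z)) * of_real (fejer N (y - snd z)))"
    proof -
      have "integrable torus2 (\<lambda>z. \<Sum>l = - int N..int N. of_real (fejer_weight N l) * cis (2 * pi * of_int l * y) * (complex_of_real (h (snd z)) * fourier_mode 0 (- l) z))"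
        by (intro Bochner_Integration.integrable_sum integrable_mult_right ih)
      then show ?thesis unfolding eq sum_distrib_left by (simp add: mult_ac)
    qed
    have "(LINT z|torus2. complex_of_real (h (snd z)) * of_real (fejer N (y - snd z)))
      = (LINT z|torus2. (\<Sum>l = - int N..int N. of_real (fejer_weight N l) * cis (2 * pi * of_int l * y) * (complex_of_real (h (snd z)) * fourier_mode 0 (- l) z)))"
      unfolding eq sum_distrib_left by (simp add: mult_ac)
    also have "\<dots> = (\<Sum>l = - int N..int N. of_real (fejer_weight N l) * cis (2 * pi * of_int l * y) * (LINT z|torus2. complex_of_real (h (snd z)) * fourier_mode 0 (- l) z))"
      by (simp only: Bochner_Integration.integral_sum[OF integrable_mult_right[OF ih]] integral_mult_right_zero)
    also have "\<dots> = (\<Sum>l = - int N..int N. q l * cis (2 * pi * of_int l * y))"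
      by (simp only: q_def mult_ac)
    finally have Q: "(\<Sum>l = - int N..int N. q l * cis (2 * pi * of_int l * y)) = (LINT z|torus2. complex_of_real (h (snd z)) * of_real (fejer N (y - snd z)))" ..
    have F: "integrable torus2 (\<lambda>z. complex_of_real (h y) * of_real (fejer N (y - snd z)))"
      using fejer_torus2(1)[OF N, of y] by (intro integrable_mult_right integrable_of_real)
    have "complex_of_real (h y) = (LINT z|torus2. complex_of_real (h y) * of_real (fejer N (y - snd z)))"
      by (simp add: fejer_torus2[OF N])
    then have "h y - (\<Sum>l = - int N..int N. q l * cis (2 * pi * of_int l * y))
        = (LINT z|torus2. complex_of_real (h y) * of_real (fejer N (y - snd z)) - complex_of_real (h (snd z)) * of_real (fejer N (y - snd z)))"
      unfolding Q by (subst Bochner_Integration.integral_diff[OF F hF]) simp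
    also have "cmod \<dots> \<le> (LINT z|torus2. L * ((fejer N (y - snd z) + 1\<^sup>2) / (2 * sqrt (real N))))"
    proof (rule Bochner_Integration.integral_norm_bound_integral)
      fix z assume z: "z \<in> space torus2"
      have "cmod (complex_of_real (h y) * of_real (fejer N (y - snd z)) - complex_of_real (h (snd z)) * of_real (fejer N (y - snd z)))
          = \<bar>h y - h (snd z)\<bar> * fejer N (y - snd z)"
        unfolding left_diff_distrib[symmetric] of_real_diff[symmetric] norm_mult norm_of_real by (simp add: fejer_nonneg)
      also have "\<dots> \<le> L * \<bar>sin (pi * (y - snd z))\<bar> * fejer N (y - snd z)"
        using lip[OF y, of "snd z"] z by (intro mult_right_mono fejer_nonneg) auto
      also have "\<dots> = L * (fejer N (y - snd z) * \<bar>sin (pi * (y - snd z))\<bar> * 1)" by simp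
      also have "\<dots> \<le> L * ((fejer N (y - snd z) + 1\<^sup>2) / (2 * sqrt (real N)))"
        using L0 fejer_sin_mult_le[OF N, of 1] by (intro mult_left_mono) auto
      finally show "norm (complex_of_real (h y) * of_real (fejer N (y - snd z)) - complex_of_real (h (snd z)) * of_real (fejer N (y - snd z)))
        \<le> L * ((fejer N (y - snd z) + 1\<^sup>2) / (2 * sqrt (real N)))" .
    next
      show "integrable torus2 (\<lambda>z. complex_of_real (h y) * of_real (fejer N (y - snd z)) - complex_of_real (h (snd z)) * of_real (fejer N (y - snd z)))"
        by (rule Bochner_Integration.integrable_diff[OF F hF])
      show "integrable torus2 (\<lambda>z. L * ((fejer N (y - snd z) + 1\<^sup>2) / (2 * sqrt (real N))))"
        by (intro integrable_mult_right integrable_divide Bochner_Integration.integrable_add fejer_torus2(1)[OF N]) simp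
    qed
    also have "\<dots> = L / sqrt (real N)"
      using fejer_torus2[OF N, of y] N by (simp add: field_simps)
    finally show "cmod (h y - (\<Sum>l = - int N..int N. q l * cis (2 * pi * of_int l * y))) \<le> L / sqrt (real N)" .
  qed
qed

text \<open>Lipschitz functions increasing with \<open>n\<close> to the indicator of the open
  interval. Intersecting with the open unit interval makes them vanish at 0 and 1, hence continuous
  on the circle.\<close>

definition bump :: "nat \<Rightarrow> real \<Rightarrow> real \<Rightarrow> real \<Rightarrow> real" where
  "bump n a b x = min 1 (real n * infdist x (- ({a<..<b} \<inter> {0<..<1})))"

lemma bump_bounds: "0 \<le> bump n a b x" "bump n a b x \<le> 1"
  by (auto simp: bump_def infdist_nonneg)

lemma bump_lipschitz: "\<bar>bump n a b x - bump n a b y\<bar> \<le> real n * \<bar>x - y\<bar>"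
proof -
  let ?A = "- ({a<..<b} \<inter> {0<..<1})"
  have "\<bar>bump n a b x - bump n a b y\<bar> \<le> \<bar>real n * infdist x ?A - real n * infdist y ?A\<bar>"
    unfolding bump_def by linarith
  also have "\<dots> = real n * \<bar>infdist x ?A - infdist y ?A\<bar>"
    by (simp add: abs_mult flip: right_diff_distrib)
  also have "\<dots> \<le> real n * \<bar>x - y\<bar>"
    using infdist_triangle_abs[of x ?A y] by (intro mult_left_mono) (auto simp: dist_real_def)
  finally show ?thesis .
qed

lemma bump_outside: "x \<notin> {a<..<b} \<inter> {0<..<1} \<Longrightarrow> bump n a b x = 0"
  by (simp add: bump_def)

lemma bump_cont: "continuous_on S (bump n a b)"
  unfolding bump_def[abs_def] by (intro continuous_intros)

lemma bump_tendsto: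
  assumes "0 < x" "x < 1"
  shows "(\<lambda>n. bump n a b x) \<longlonglongrightarrow> indicator {a<..<b} x"
proof (cases "x \<in> {a<..<b}")
  case False
  then have "bump n a b x = 0" for n by (intro bump_outside) auto
  then show ?thesis using False by simp
next
  case True
  define d where "d = infdist x (- ({a<..<b} \<inter> {0<..<1}))"
  have "d > 0" unfolding d_def
  proof (rule infdist_pos_not_in_closed)
    have "(0::real) \<in> - ({a<..<b} \<inter> {0<..<1})" by simp
    then show "- ({a<..<b} \<inter> {0<..<1}) \<noteq> {}" by blast
  qed (use True assms in \<open>auto intro!: closed_Compl\<close>)
  have "eventually (\<lambda>n. bump n a b x = 1) sequentially"
  proof (rule eventually_sequentiallyI)
    fix n assume "n \<ge> nat \<lceil>1 / d\<rceil>"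
    then have "1 / d \<le> real n" by linarith
    then have "1 \<le> real n * d" using \<open>d > 0\<close> by (simp add: field_simps)
    then show "bump n a b x = 1" by (simp add: bump_def d_def)
  qed
  then show ?thesis using True by (simp add: tendsto_eventually)
qed

text \<open>The product of the Fejer means of the two factors is a trigonometric polynomial. With
  each mean within \<delta> \<le> 1 of a factor bounded by one, the product is uniformly within
  \<open>3 * \<delta>\<close>.\<close>

lemma parseval_bump_product: "parseval (\<lambda>z. of_real (bump n a b (fst z) * bump n c d (snd z)))"
proof -
  define f where "f = (\<lambda>z. complex_of_real (bump n a b (fst z) * bump n c d (snd z)))"
  define L where "L = 2 * real n"
  have f: "f \<in> L2_torus"
  proof (rule L2_torus_bounded[of _ 1])
    show "f \<in> borel_measurable torus2"
    proof -
      have "continuous_on UNIV (\<lambda>z :: real \<times> real. bump n a b (fst z))" "continuous_on UNIV (\<lambda>z :: real \<times> real. bump n c d (snd z))"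
        by (rule continuous_on_compose2[OF bump_cont[of UNIV]]; simp add: continuous_on_fst continuous_on_snd)+
      then show ?thesis
        unfolding f_def by (intro measurable_torus2 borel_measurable_continuous_onI continuous_intros)
    qed
    show "cmod (f z) \<le> 1" for z
    proof -
      have "bump n a b (fst z) * bump n c d (snd z) \<le> 1 * 1" by (intro mult_mono bump_bounds) auto
      then show ?thesis by (simp add: f_def norm_mult bump_bounds(1))
    qed
  qed
  have approx: "\<exists>q. \<forall>y\<in>{0..1}. cmod (bump n a b y - (\<Sum>l = - int N..int N. q l * cis (2 * pi * of_int l * y))) \<le> L / sqrt (real N)"
    if "N > 0" for N a b
  proof -
    have per: "bump n a b 1 = bump n a b 0" using bump_outside[of 1 a b n] bump_outside[of 0 a b n] by simp
    have "\<bar>bump n a b x - bump n a b y\<bar> \<le> L * \<bar>sin (pi * (x - y))\<bar>" if "x \<in> {0..1}" "y \<in> {0..1}" for x y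
      unfolding L_def by (rule lipschitz_on_circle[OF bump_lipschitz per that])
    from fejer_approximation[OF bump_cont this \<open>N > 0\<close>] show ?thesis by metis
  qed
  have le: "fourier_defect f N \<le> 9 * L\<^sup>2 / real N" if N: "N > 0" "L / sqrt (real N) \<le> 1" for N
  proof -
    define \<delta> where "\<delta> = L / sqrt (real N)"
    have \<delta>: "0 \<le> \<delta>" "\<delta> \<le> 1" using N by (auto simp: \<delta>_def L_def)
    obtain q1 where q1: "\<And>y. y \<in> {0..1} \<Longrightarrow> cmod (bump n a b y - (\<Sum>l = - int N..int N. q1 l * cis (2 * pi * of_int l * y))) \<le> \<delta>"
      using approx[OF N(1)] unfolding \<delta>_def by blast
    obtain q2 where q2: "\<And>y. y \<in> {0..1} \<Longrightarrow> cmod (bump n c d y - (\<Sum>l = - int N..int N. q2 l * cis (2 * pi * of_int l * y))) \<le> \<delta>"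
      using approx[OF N(1)] unfolding \<delta>_def by blast
    have pt: "cmod (f z - trig_poly N (\<lambda>k l. q1 k * q2 l) z) \<le> 3 * \<delta>" if z: "z \<in> space torus2" for z
    proof -
      define P1 where "P1 = (\<Sum>l = - int N..int N. q1 l * cis (2 * pi * of_int l * fst z))"
      define P2 where "P2 = (\<Sum>l = - int N..int N. q2 l * cis (2 * pi * of_int l * snd z))"
      define h1 where "h1 = complex_of_real (bump n a b (fst z))"
      define h2 where "h2 = complex_of_real (bump n c d (snd z))"
      have P: "trig_poly N (\<lambda>k l. q1 k * q2 l) z = P1 * P2"
        unfolding P1_def P2_def sum_product trig_poly_def sum.cartesian_product
        by (intro sum.cong refl) (auto simp: fourier_mode_def cis_mult algebra_simps)
      have d1: "cmod (h1 - P1) \<le> \<delta>" and d2: "cmod (h2 - P2) \<le> \<delta>"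
        using q1[of "fst z"] q2[of "snd z"] z by (auto simp: h1_def h2_def P1_def P2_def)
      have h: "cmod h1 \<le> 1" "cmod h2 \<le> 1" using bump_bounds by (auto simp: h1_def h2_def)
      have P1: "cmod P1 \<le> 2" using norm_triangle_sub[of P1 h1] d1 h \<delta> by (simp add: norm_minus_commute)
      have "f z - P1 * P2 = (h1 - P1) * h2 + P1 * (h2 - P2)"
        by (simp add: f_def h1_def h2_def algebra_simps)
      also have "cmod \<dots> \<le> cmod (h1 - P1) * cmod h2 + cmod P1 * cmod (h2 - P2)"
        by (metis norm_triangle_ineq norm_mult)
      also have "\<dots> \<le> \<delta> * 1 + 2 * \<delta>"
        using d1 d2 h P1 \<delta> by (intro add_mono mult_mono) auto
      finally show ?thesis by (simp add: P)
    qed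
    have "fourier_defect f N \<le> mass (\<lambda>z. f z - trig_poly N (\<lambda>k l. q1 k * q2 l) z)"
      by (rule fourier_defect_le[OF f])
    also have "\<dots> \<le> (LINT z|torus2. (3 * \<delta>)\<^sup>2)"
      unfolding mass_def
    proof (rule integral_mono)
      show "integrable torus2 (\<lambda>z. (cmod (f z - trig_poly N (\<lambda>k l. q1 k * q2 l) z))\<^sup>2)"
        by (rule L2_torusD(2)[OF L2_torus_diff(1)[OF f trig_poly_L2]])
      show "(cmod (f z - trig_poly N (\<lambda>k l. q1 k * q2 l) z))\<^sup>2 \<le> (3 * \<delta>)\<^sup>2" if "z \<in> space torus2" for z
        by (rule power_mono[OF pt[OF that]]) simp
    qed simp
    also have "\<dots> = 9 * L\<^sup>2 / real N" using N by (simp add: \<delta>_def power_mult_distrib power_divide)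
    finally show ?thesis .
  qed
  have "fourier_defect f \<longlonglongrightarrow> 0"
  proof (rule tendsto_sandwich[where f = "\<lambda>_. 0"])
    show "(\<lambda>N. 9 * L\<^sup>2 / real N) \<longlonglongrightarrow> 0" by (rule lim_const_over_n)
    show "\<forall>\<^sub>F N in sequentially. fourier_defect f N \<le> 9 * L\<^sup>2 / real N"
    proof (rule eventually_sequentiallyI)
      fix N assume "N \<ge> Suc (nat \<lceil>L\<^sup>2\<rceil>)"
      then have N: "N > 0" "L\<^sup>2 \<le> real N" by linarith+
      then have "L \<le> sqrt (real N)" by (simp add: real_le_rsqrt)
      then show "fourier_defect f N \<le> 9 * L\<^sup>2 / real N" using N by (intro le) auto
    qed
    show "\<forall>\<^sub>F N in sequentially. 0 \<le> fourier_defect f N"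
      by (intro always_eventually allI fourier_defect_nonneg f)
  qed (rule tendsto_const)
  then show ?thesis using f by (simp add: parseval_def f_def)
qed

text \<open>The bumps vanish where a coordinate is zero, so their convergence to the indicator is
  asserted off these two lines.\<close>

lemma AE_torus2_interior: "AE z in torus2. fst z \<noteq> 0 \<and> snd z \<noteq> 0"
proof -
  have "emeasure (lborel \<Otimes>\<^sub>M lborel) ({0::real} \<times> (UNIV::real set)) = 0"
    by (subst lborel.emeasure_pair_measure_Times) auto
  moreover have "emeasure (lborel \<Otimes>\<^sub>M lborel) ((UNIV::real set) \<times> {0::real}) = 0"
    by (subst lborel.emeasure_pair_measure_Times) auto
  ultimately have "({0::real} \<times> (UNIV::real set)) \<in> null_sets lborel" "((UNIV::real set) \<times> {0::real}) \<in> null_sets lborel"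
    by (auto simp: null_sets_def lborel_prod intro!: borel_Times)
  then have "AE z in lborel. z \<notin> {0::real} \<times> (UNIV::real set)" "AE z in lborel. z \<notin> (UNIV::real set) \<times> {0::real}"
    by (auto intro: AE_not_in)
  then have "AE z in lborel. z \<in> {0..<1} \<times> {0..<1} \<longrightarrow> fst z \<noteq> (0::real) \<and> snd z \<noteq> (0::real)"
    by eventually_elim auto
  then show ?thesis
    unfolding torus2_def using square_borel by (subst AE_restrict_space_iff) auto
qed

section \<open>From boxes to all square-integrable functions\<close>

lemma indicator_L2: "A \<in> sets borel \<Longrightarrow> (\<lambda>z. complex_of_real (indicator A z)) \<in> L2_torus"
  by (intro L2_torus_bounded[of _ 1] measurable_torus2) (auto split: split_indicator)

lemma mem_box_prod: "z \<in> box u v \<longleftrightarrow> fst z \<in> {fst u<..<fst v} \<and> snd z \<in> {snd u<..<snd v}"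
  for z u v :: "real \<times> real"
  by (cases z; cases u; cases v) (auto simp: mem_box Basis_prod_def)

lemma parseval_indicator_box: "parseval (\<lambda>z. complex_of_real (indicator (box u v) z))"
proof (rule parseval_limit[OF indicator_L2 parseval_bump_product])
  define F where "F n z = complex_of_real (bump n (fst u) (fst v) (fst z) * bump n (snd u) (snd v) (snd z))" for n z
  show "(\<lambda>n. mass (\<lambda>z. of_real (indicator (box u v) z) - of_real (bump n (fst u) (fst v) (fst z) * bump n (snd u) (snd v) (snd z)))) \<longlonglongrightarrow> 0"
    unfolding F_def[symmetric]
  proof (rule mass_tendsto_0)
    show "(\<lambda>z. complex_of_real (indicator (box u v) z)) \<in> borel_measurable torus2"
      by (rule L2_torusD(1)[OF indicator_L2]) simp
    show "F j \<in> borel_measurable torus2" for j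
      using parseval_bump_product[of j "fst u" "fst v" "snd u" "snd v"]
      unfolding parseval_def F_def[abs_def] by (auto dest: L2_torusD(1))
    show "integrable torus2 (\<lambda>z. 4)" by simp
    show "(cmod (of_real (indicator (box u v) z) - F j z))\<^sup>2 \<le> 4" for j z
    proof -
      have "bump j (fst u) (fst v) (fst z) * bump j (snd u) (snd v) (snd z) \<le> 1 * 1"
        by (intro mult_mono bump_bounds) auto
      then have "cmod (F j z) \<le> 1" using bump_bounds(1)[of j] by (simp add: F_def norm_mult)
      then have "cmod (of_real (indicator (box u v) z) - F j z) \<le> 2"
        using norm_triangle_ineq4[of "of_real (indicator (box u v) z)" "F j z"] by (auto split: split_indicator_asm)
      then have "(cmod (of_real (indicator (box u v) z) - F j z))\<^sup>2 \<le> 2\<^sup>2" by (intro power_mono) auto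
      then show ?thesis by simp
    qed
    show "AE z in torus2. (\<lambda>j. F j z) \<longlonglongrightarrow> of_real (indicator (box u v) z)"
      using AE_torus2_interior AE_space
    proof eventually_elim
      case (elim z)
      have "(\<lambda>j. F j z) \<longlonglongrightarrow> of_real (indicator {fst u<..<fst v} (fst z) * indicator {snd u<..<snd v} (snd z))"
        unfolding F_def using elim by (intro tendsto_intros bump_tendsto) auto
      moreover have "indicator {fst u<..<fst v} (fst z) * indicator {snd u<..<snd v} (snd z) = (indicator (box u v) z :: real)"
        by (auto simp: mem_box_prod split: split_indicator)
      ultimately show ?case by simp
    qed
  qed
qed auto

lemma parseval_one: "parseval (\<lambda>z. 1)"
proof -
  have "parseval (\<lambda>z. complex_of_real (indicator (box (-1, -1) (1, 1)) z))" by (rule parseval_indicator_box)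
  then show ?thesis by (rule parseval_cong) (auto simp: mem_box_prod)
qed

text \<open>Dynkin's argument: boxes generate the Borel sets and are stable under intersection,
  while Parseval's identity passes to complements by linearity and to disjoint countable unions by
  limits.\<close>

lemma parseval_indicator:
  assumes "A \<in> sets borel"
  shows "parseval (\<lambda>z. complex_of_real (indicator A z))"
proof -
  define G where "G = range (\<lambda>(a, b). box a b :: (real \<times> real) set)"
  have "Int_stable G" by (auto simp: Int_stable_def box_Int_box G_def)
  moreover have "G \<subseteq> Pow UNIV" by simp
  moreover have "A \<in> sigma_sets UNIV G" using assms by (simp add: borel_eq_box G_def)
  ultimately show ?thesis
  proof (induction rule: sigma_sets_induct_disjoint)
    case (basic A)
    then show ?case by (auto simp: G_def intro: parseval_indicator_box)
  next
    case empty
    then show ?case by (simp add: parseval_zero)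
  next
    case (compl A)
    have "parseval (\<lambda>z. 1 + (-1) * complex_of_real (indicator A z))"
      by (intro parseval_add parseval_one parseval_scale compl)
    then show ?case by (rule parseval_cong) (auto split: split_indicator)
  next
    case (union A)
    have meas: "A i \<in> sets borel" for i
      using union(2) by (auto simp: borel_eq_box G_def)
    show ?case
    proof (rule parseval_limit)
      show "(\<lambda>z. complex_of_real (indicator (\<Union>i. A i) z)) \<in> L2_torus"
        using meas by (intro indicator_L2) auto
      show "parseval (\<lambda>z. \<Sum>i<j. complex_of_real (indicator (A i) z))" for j
        by (intro parseval_sum union(3))
      have eq: "(\<Sum>i<j. complex_of_real (indicator (A i) z)) = of_real (indicator (\<Union>i<j. A i) z)" for j z
      proof -
        have "disjoint_family_on A {..<j}" using union(1) by (rule disjoint_family_on_mono[rotated]) simp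
        then show ?thesis by (simp add: indicator_UN_disjoint)
      qed
      show "(\<lambda>j. mass (\<lambda>z. of_real (indicator (\<Union>i. A i) z) - (\<Sum>i<j. of_real (indicator (A i) z)))) \<longlonglongrightarrow> 0"
      proof (rule mass_tendsto_0)
        show "(\<lambda>z. complex_of_real (indicator (\<Union>i. A i) z)) \<in> borel_measurable torus2"
          using meas by (intro L2_torusD(1) indicator_L2) auto
        show "(\<lambda>z. \<Sum>i<j. complex_of_real (indicator (A i) z)) \<in> borel_measurable torus2" for j
          using meas by (intro borel_measurable_sum L2_torusD(1) indicator_L2) auto
        show "integrable torus2 (\<lambda>z. 1)" by simp
        show "(cmod (of_real (indicator (\<Union>i. A i) z) - (\<Sum>i<j. of_real (indicator (A i) z))))\<^sup>2 \<le> 1" for j z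
          unfolding eq by (auto split: split_indicator)
        show "AE z in torus2. (\<lambda>j. \<Sum>i<j. complex_of_real (indicator (A i) z)) \<longlonglongrightarrow> of_real (indicator (\<Union>i. A i) z)"
          unfolding eq by (intro AE_I2 tendsto_of_real LIMSEQ_indicator_UN)
      qed
    qed
  qed
qed

theorem parseval_L2:
  assumes f: "f \<in> L2_torus"
  shows "parseval f"
proof -
  obtain s where s: "\<And>i. simple_function torus2 (s i)"
    "\<And>z. z \<in> space torus2 \<Longrightarrow> (\<lambda>i. s i z) \<longlonglongrightarrow> f z"
    "\<And>i z. z \<in> space torus2 \<Longrightarrow> cmod (s i z) \<le> 2 * cmod (f z)"
    using borel_measurable_implies_sequence_metric[OF L2_torusD(1)[OF f], of 0] unfolding dist_norm diff_0_right by blast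
  have simple: "parseval g" if g: "simple_function torus2 g" for g :: "real \<times> real \<Rightarrow> complex"
  proof -
    have "parseval (\<lambda>z. indicator (g -` {v} \<inter> space torus2) z :: complex)" if "v \<in> g ` space torus2" for v
    proof -
      have "g -` {v} \<inter> space torus2 \<in> sets torus2"
        using simple_functionD(2)[OF g] by blast
      then have "g -` {v} \<inter> space torus2 \<in> sets borel"
        unfolding torus2_def using square_borel by (auto simp: sets_restrict_space space_restrict_space)
      from parseval_indicator[OF this] show ?thesis by (rule parseval_cong) (auto split: split_indicator)
    qed
    then have "parseval (\<lambda>z. \<Sum>v\<in>g ` space torus2. v * indicator (g -` {v} \<inter> space torus2) z)"
      by (intro parseval_sum parseval_scale)
    then show ?thesis
    proof (rule parseval_cong)
      fix z assume z: "z \<in> space torus2"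
      have fin: "finite (g ` space torus2)" using g by (rule simple_functionD(1))
      have "(\<Sum>v\<in>g ` space torus2. v * indicator (g -` {v} \<inter> space torus2) z)
          = (\<Sum>v\<in>g ` space torus2. if v = g z then v else 0)"
        using z by (intro sum.cong refl) (auto split: split_indicator)
      also have "\<dots> = g z" using z fin by (simp add: sum.delta)
      finally show "(\<Sum>v\<in>g ` space torus2. v * indicator (g -` {v} \<inter> space torus2) z) = g z" .
    qed
  qed
  show ?thesis
  proof (rule parseval_limit[OF f simple[OF s(1)]])
    show "(\<lambda>i. mass (\<lambda>z. f z - s i z)) \<longlonglongrightarrow> 0"
    proof (rule mass_tendsto_0)
      \<comment> \<open>The approximants satisfy \<open>|s i| \<le> 2 * |f|\<close>, and
        \<open>9 = (1 + 2)^2\<close>.\<close>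
      show "integrable torus2 (\<lambda>z. 9 * (cmod (f z))\<^sup>2)" using L2_torusD(2)[OF f] by simp
      show "(cmod (f z - s i z))\<^sup>2 \<le> 9 * (cmod (f z))\<^sup>2" if "z \<in> space torus2" for i z
      proof -
        have "cmod (f z - s i z) \<le> 3 * cmod (f z)" using norm_triangle_ineq4[of "f z" "s i z"] s(3)[OF that, of i] by simp
        then have "(cmod (f z - s i z))\<^sup>2 \<le> (3 * cmod (f z))\<^sup>2" by (intro power_mono) auto
        then show ?thesis by (simp add: power_mult_distrib)
      qed
    qed (use L2_torusD(1)[OF f] s in \<open>auto intro: borel_measurable_simple_function\<close>)
  qed
qed

section \<open>Fourier coefficients of a weak solution\<close>

lemma fourier_mode_has_derivative_x:
  "((\<lambda>s. a * fourier_mode k l (s, y)) has_vector_derivative a * (2 * of_real pi * \<i> * of_int k) * fourier_mode k l (x, y)) (at x)"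
  unfolding fourier_mode_def
  by (rule has_vector_derivative_eq_rhs, rule has_vector_derivative_mult_right[OF has_vector_derivative_cis])
     (auto intro!: derivative_eq_intros)

lemma fourier_mode_has_derivative_y:
  "((\<lambda>s. a * fourier_mode k l (x, s)) has_vector_derivative a * (2 * of_real pi * \<i> * of_int l) * fourier_mode k l (x, y)) (at y)"
  unfolding fourier_mode_def
  by (rule has_vector_derivative_eq_rhs, rule has_vector_derivative_mult_right[OF has_vector_derivative_cis])
     (auto intro!: derivative_eq_intros)

lemma partial_fourier_mode:
  "partial_x (\<lambda>z. a * fourier_mode k l z) = (\<lambda>z. a * (2 * of_real pi * \<i> * of_int k) * fourier_mode k l z)"
  "partial_y (\<lambda>z. a * fourier_mode k l z) = (\<lambda>z. a * (2 * of_real pi * \<i> * of_int l) * fourier_mode k l z)"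
  unfolding partial_x_def partial_y_def fun_eq_iff
  using vector_derivative_at[OF fourier_mode_has_derivative_x] vector_derivative_at[OF fourier_mode_has_derivative_y]
  by auto

lemma differentiable_fourier_mode: "(\<lambda>z. a * fourier_mode k l z) differentiable (at z)"
proof -
  have "((\<lambda>z. a * (of_real (cos (2 * pi * (of_int k * fst z + of_int l * snd z)))
      + \<i> * of_real (sin (2 * pi * (of_int k * fst z + of_int l * snd z))))) has_derivative
     (\<lambda>h. a * (of_real (- sin (2 * pi * (of_int k * fst z + of_int l * snd z)) * (2 * pi * (of_int k * fst h + of_int l * snd h)))
       + \<i> * of_real (cos (2 * pi * (of_int k * fst z + of_int l * snd z)) * (2 * pi * (of_int k * fst h + of_int l * snd h)))))) (at z)"
    by (auto intro!: derivative_eq_intros simp: algebra_simps)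
  moreover have "(\<lambda>z. a * fourier_mode k l z) = (\<lambda>z. a * (of_real (cos (2 * pi * (of_int k * fst z + of_int l * snd z)))
      + \<i> * of_real (sin (2 * pi * (of_int k * fst z + of_int l * snd z)))))"
    by (simp add: fourier_mode_def fun_eq_iff complex_eq_iff)
  ultimately show ?thesis by (auto simp: differentiable_def)
qed

text \<open>Coinduction on the set of multiples of one exponential, which both partial derivatives
  map into itself; the factor \<open>a\<close> is there for this invariance.\<close>

lemma smooth_plane_fourier_mode: "smooth_plane (\<lambda>z. a * fourier_mode k l z)"
proof (rule smooth_plane.coinduct[of "\<lambda>\<phi>. \<exists>a. \<phi> = (\<lambda>z. a * fourier_mode k l z)"])
  fix \<phi> assume "\<exists>a. \<phi> = (\<lambda>z. a * fourier_mode k l z)"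
  then obtain a where \<phi>: "\<phi> = (\<lambda>z. a * fourier_mode k l z)" by blast
  have "\<forall>z. \<phi> differentiable at z" unfolding \<phi> by (intro allI differentiable_fourier_mode)
  moreover have "\<exists>a. partial_x \<phi> = (\<lambda>z. a * fourier_mode k l z)" "\<exists>a. partial_y \<phi> = (\<lambda>z. a * fourier_mode k l z)"
    unfolding \<phi> partial_fourier_mode by (rule exI, rule refl)+
  ultimately show "\<exists>\<phi>'. \<phi> = \<phi>' \<and> (\<forall>z. \<phi>' differentiable at z) \<and>
      ((\<exists>a. partial_x \<phi>' = (\<lambda>z. a * fourier_mode k l z)) \<or> smooth_plane (partial_x \<phi>')) \<and>
      ((\<exists>a. partial_y \<phi>' = (\<lambda>z. a * fourier_mode k l z)) \<or> smooth_plane (partial_y \<phi>'))"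
    by (intro exI[of _ \<phi>] conjI refl disjI1)
qed (rule exI, rule refl)

lemma test_function_fourier_mode: "test_function (fourier_mode k l)"
proof -
  have "smooth_plane (\<lambda>z. 1 * fourier_mode k l z)" by (rule smooth_plane_fourier_mode)
  moreover have cis: "cis (w + 2 * pi * of_int n) = cis w" for w n
    using cis_multiple_2pi[of "of_int n"] by (simp flip: cis_mult)
  have "fourier_mode k l (x + 1, y) = fourier_mode k l (x, y)" "fourier_mode k l (x, y + 1) = fourier_mode k l (x, y)" for x y
    using cis[of "2 * pi * (of_int k * x + of_int l * y)" k] cis[of "2 * pi * (of_int k * x + of_int l * y)" l]
    by (simp_all add: fourier_mode_def algebra_simps)
  ultimately show ?thesis by (simp add: test_function_def)
qed

lemma laplacian_fourier_mode:
  "laplacian (fourier_mode k l) z = - of_real (4 * pi\<^sup>2 * ((of_int k)\<^sup>2 + (of_int l)\<^sup>2)) * fourier_mode k l z"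
proof -
  have x: "partial_x (fourier_mode k l) = (\<lambda>z. (2 * of_real pi * \<i> * of_int k) * fourier_mode k l z)"
    using partial_fourier_mode(1)[of 1 k l] by simp
  have y: "partial_y (fourier_mode k l) = (\<lambda>z. (2 * of_real pi * \<i> * of_int l) * fourier_mode k l z)"
    using partial_fourier_mode(2)[of 1 k l] by simp
  show ?thesis
    unfolding laplacian_def x y partial_fourier_mode by (simp add: power2_eq_square algebra_simps)
qed

lemma partial_x_fourier_mode: "partial_x (fourier_mode k l) z = 2 * of_real pi * \<i> * of_int k * fourier_mode k l z"
  using partial_fourier_mode(1)[of 1 k l] by simp

text \<open>Nonnegativity of the variance, as the square has total measure one.\<close>

lemma integral_norm_le_L2_norm:
  assumes h: "h \<in> L2_torus"
  shows "(LINT z|torus2. cmod (h z)) \<le> L2_norm h"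
proof -
  define m where "m = (LINT z|torus2. cmod (h z))"
  have i: "integrable torus2 (\<lambda>z. cmod (h z))" using L2_torusD(3)[OF h] by simp
  have "0 \<le> (LINT z|torus2. (cmod (h z) - m)\<^sup>2)" by simp
  also have "\<dots> = (LINT z|torus2. (cmod (h z))\<^sup>2 - 2 * m * cmod (h z) + m\<^sup>2)"
    by (simp add: power2_diff algebra_simps)
  also have "\<dots> = mass h - 2 * m * m + m\<^sup>2"
    using i L2_torusD(2)[OF h] by (simp add: mass_def m_def)
  finally have "m\<^sup>2 \<le> mass h" by (simp add: power2_eq_square)
  then show ?thesis unfolding m_def[symmetric] L2_norm_eq by (rule real_le_rsqrt)
qed

text \<open>The Lipschitz condition on \<open>b\<close> is stated with the sine because that is the
  factor against which the Fejer kernel gains a power of \<open>N\<close>.\<close>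

locale weak_solution =
  fixes b b' :: "real \<Rightarrow> real" and L \<nu> :: real
    and f0 :: "real \<times> real \<Rightarrow> complex" and f :: "real \<Rightarrow> real \<times> real \<Rightarrow> complex"
  assumes b': "\<And>y. (b has_real_derivative b' y) (at y)" "continuous_on UNIV b'"
    and b_periodic: "b 1 = b 0"
    and b_lip: "\<And>x y. x \<in> {0..1} \<Longrightarrow> y \<in> {0..1} \<Longrightarrow> \<bar>b x - b y\<bar> \<le> L * \<bar>sin (pi * (x - y))\<bar>"
    and \<nu>: "0 < \<nu>"
    and sol: "advection_diffusion_solution b \<nu> f0 f"
    and f0: "f0 \<in> L2_torus"
begin

lemma f_L2: "0 \<le> t \<Longrightarrow> f t \<in> L2_torus"
  using sol by (simp add: advection_diffusion_solution_def)

lemma f_tendsto: "0 \<le> t \<Longrightarrow> ((\<lambda>s. L2_norm (\<lambda>z. f s z - f t z)) \<longlongrightarrow> 0) (at t within {0..})"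
  using sol by (simp add: advection_diffusion_solution_def)

lemma weak_eq: "test_function \<phi> \<Longrightarrow> 0 \<le> t \<Longrightarrow> (LINT z|torus2. f t z * \<phi> z) =
        (LINT z|torus2. f0 z * \<phi> z) +
        (LINT s:{0..t}|lborel. LINT z|torus2.
           f s z * (of_real (b (snd z)) * partial_x \<phi> z + of_real \<nu> * laplacian \<phi> z))"
  using sol by (simp add: advection_diffusion_solution_def)

lemma b_cont: "continuous_on S b"
  using b'(1) by (meson DERIV_continuous continuous_at_imp_continuous_on)

lemma b_measurable: "(\<lambda>z. complex_of_real (b (snd z))) \<in> borel_measurable torus2"
proof (intro measurable_torus2 borel_measurable_continuous_onI)
  have "continuous_on UNIV (\<lambda>z :: real \<times> real. b (snd z))"
    by (rule continuous_on_compose2[OF b_cont[of UNIV]]) (auto intro: continuous_on_snd)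
  then show "continuous_on UNIV (\<lambda>z :: real \<times> real. complex_of_real (b (snd z)))" by (rule continuous_on_of_real)
qed

lemma b_bounded: "\<exists>B. \<forall>s\<in>{0..1}. \<bar>b s\<bar> \<le> B"
proof -
  have "bounded (b ` {0..1})" by (intro compact_imp_bounded compact_continuous_image b_cont) auto
  then obtain B where "\<forall>x\<in>b ` {0..1}. norm x \<le> B" unfolding bounded_iff by blast
  then have "\<bar>b s\<bar> \<le> B" if "s \<in> {0..1}" for s using that by auto
  then show ?thesis by blast
qed

text \<open>Continuity in time with values in \<open>L^2\<close> becomes continuity of every
  coefficient, so the time integral in the weak equation can be differentiated.\<close>

lemma pairing_cont:
  assumes \<psi>: "\<psi> \<in> borel_measurable torus2" "\<And>z. z \<in> space torus2 \<Longrightarrow> cmod (\<psi> z) \<le> M"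
  shows "continuous_on {0..} (\<lambda>s. LINT z|torus2. f s z * \<psi> z)"
  unfolding continuous_on_def
proof
  fix t :: real assume "t \<in> {0..}"
  then have t: "0 \<le> t" by simp
  have "((\<lambda>s. (LINT z|torus2. f s z * \<psi> z) - (LINT z|torus2. f t z * \<psi> z)) \<longlongrightarrow> 0) (at t within {0..})"
  proof (rule Lim_null_comparison)
    have "((\<lambda>s. M * L2_norm (\<lambda>z. f s z - f t z)) \<longlongrightarrow> M * 0) (at t within {0..})"
      by (intro tendsto_intros f_tendsto t)
    then show "((\<lambda>s. M * L2_norm (\<lambda>z. f s z - f t z)) \<longlongrightarrow> 0) (at t within {0..})" by simp
    have "norm ((LINT z|torus2. f s z * \<psi> z) - (LINT z|torus2. f t z * \<psi> z)) \<le> M * L2_norm (\<lambda>z. f s z - f t z)" if s: "0 \<le> s" for s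
    proof -
      have d: "(\<lambda>z. f s z - f t z) \<in> L2_torus" by (intro L2_torus_diff f_L2 s t)
      have i: "integrable torus2 (\<lambda>z. f u z * \<psi> z)" if "0 \<le> u" for u
        by (rule integrable_mult_bounded[OF L2_torusD(3)[OF f_L2[OF that]] \<psi>])
      have "(LINT z|torus2. f s z * \<psi> z) - (LINT z|torus2. f t z * \<psi> z) = (LINT z|torus2. (f s z - f t z) * \<psi> z)"
        using i[OF s] i[OF t] by (simp add: left_diff_distrib)
      also have "norm \<dots> \<le> (LINT z|torus2. M * cmod (f s z - f t z))"
      proof (rule Bochner_Integration.integral_norm_bound_integral)
        show "integrable torus2 (\<lambda>z. (f s z - f t z) * \<psi> z)"
          by (rule integrable_mult_bounded[OF L2_torusD(3)[OF d] \<psi>])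
        show "integrable torus2 (\<lambda>z. M * cmod (f s z - f t z))" using L2_torusD(3)[OF d] by simp
        fix z assume "z \<in> space torus2"
        then have "cmod (f s z - f t z) * cmod (\<psi> z) \<le> cmod (f s z - f t z) * M" by (intro mult_left_mono \<psi>) auto
        then show "norm ((f s z - f t z) * \<psi> z) \<le> M * cmod (f s z - f t z)" by (simp add: norm_mult mult.commute)
      qed
      also have "\<dots> = M * (LINT z|torus2. cmod (f s z - f t z))" by simp
      also have "\<dots> \<le> M * L2_norm (\<lambda>z. f s z - f t z)"
      proof (intro mult_left_mono integral_norm_le_L2_norm d)
        show "0 \<le> M" using order_trans[OF norm_ge_zero \<psi>(2)[of "(0, 0)"]] by simp
      qed
      finally show ?thesis .
    qed
    then show "\<forall>\<^sub>F s in at t within {0..}. norm ((LINT z|torus2. f s z * \<psi> z) - (LINT z|torus2. f t z * \<psi> z)) \<le> M * L2_norm (\<lambda>z. f s z - f t z)"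
      by (auto simp: eventually_at_filter)
  qed
  then show "((\<lambda>s. LINT z|torus2. f s z * \<psi> z) \<longlongrightarrow> (LINT z|torus2. f t z * \<psi> z)) (at t within {0..})"
    by (rule LIM_zero_cancel)
qed

definition a :: "int \<Rightarrow> int \<Rightarrow> real \<Rightarrow> complex" where
  "a k l t = fourier_coeff (f t) k l"

text \<open>Coefficients of \<open>b * f\<close>. Multiplication by \<open>b\<close> couples the
  frequencies in \<open>y\<close>, so finitely many coefficients \<open>a k l\<close> need not
  satisfy a closed system; this is the source of the commutator.\<close>

definition ab :: "int \<Rightarrow> int \<Rightarrow> real \<Rightarrow> complex" where
  "ab k l t = (LINT z|torus2. f t z * (of_real (b (snd z)) * fourier_mode (- k) (- l) z))"

definition a' :: "int \<Rightarrow> int \<Rightarrow> real \<Rightarrow> complex" where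
  "a' k l t = - (2 * of_real pi * \<i> * of_int k) * ab k l t - of_real (\<nu> * (4 * pi\<^sup>2 * ((of_int k)\<^sup>2 + (of_int l)\<^sup>2))) * a k l t"

lemma a_cont: "continuous_on {0..} (a k l)"
  unfolding a_def[abs_def] fourier_coeff_def by (rule pairing_cont[of _ 1]) auto

lemma b_mode: "(\<lambda>z. of_real (b (snd z)) * fourier_mode k l z) \<in> borel_measurable torus2"
  by (intro borel_measurable_times b_measurable measurable_fourier_mode)

lemma ab_cont: "continuous_on {0..} (ab k l)"
proof -
  obtain B where "\<forall>s\<in>{0..1}. \<bar>b s\<bar> \<le> B" using b_bounded by blast
  then show ?thesis
    unfolding ab_def[abs_def] by (intro pairing_cont[of _ B] b_mode) (auto simp: norm_mult)
qed

lemma a'_cont: "continuous_on {0..} (a' k l)"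
  unfolding a'_def[abs_def] by (intro continuous_intros a_cont ab_cont)

lemma integrable_pairings:
  assumes "0 \<le> t"
  shows "integrable torus2 (\<lambda>z. f t z * (of_real (b (snd z)) * fourier_mode k l z))"
    "integrable torus2 (\<lambda>z. f t z * fourier_mode k l z)"
proof -
  obtain B where B: "\<forall>s\<in>{0..1}. \<bar>b s\<bar> \<le> B" using b_bounded by blast
  then show "integrable torus2 (\<lambda>z. f t z * (of_real (b (snd z)) * fourier_mode k l z))"
    by (intro integrable_mult_bounded[of _ _ B] b_mode L2_torusD(3)[OF f_L2[OF assms]]) (auto simp: norm_mult)
  show "integrable torus2 (\<lambda>z. f t z * fourier_mode k l z)"
    by (intro integrable_mult_bounded[of _ _ 1] L2_torusD(3)[OF f_L2[OF assms]]) auto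
qed

lemma a_integral:
  assumes t: "0 \<le> t"
  shows "a k l t = fourier_coeff f0 k l + integral {0..t} (a' k l)"
proof -
  define \<phi> where "\<phi> = fourier_mode (- k) (- l)"
  have "(LINT s:{0..t}|lborel. LINT z|torus2. f s z * (of_real (b (snd z)) * partial_x \<phi> z + of_real \<nu> * laplacian \<phi> z))
      = (LINT s:{0..t}|lborel. a' k l s)"
  proof (rule set_lebesgue_integral_cong)
    show "\<forall>s. s \<in> {0..t} \<longrightarrow> (LINT z|torus2. f s z * (of_real (b (snd z)) * partial_x \<phi> z + of_real \<nu> * laplacian \<phi> z)) = a' k l s"
    proof (intro allI impI)
      fix s assume "s \<in> {0..t}"
      then have s: "0 \<le> s" by simp
      define c1 c2 where "c1 = - (2 * of_real pi * \<i> * of_int k)" and "c2 = complex_of_real (\<nu> * (4 * pi\<^sup>2 * ((of_int k)\<^sup>2 + (of_int l)\<^sup>2)))"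
      have "(LINT z|torus2. f s z * (of_real (b (snd z)) * partial_x \<phi> z + of_real \<nu> * laplacian \<phi> z))
          = (LINT z|torus2. c1 * (f s z * (of_real (b (snd z)) * \<phi> z)) - c2 * (f s z * \<phi> z))"
        unfolding \<phi>_def partial_x_fourier_mode laplacian_fourier_mode c1_def c2_def
        by (intro Bochner_Integration.integral_cong refl) (simp add: algebra_simps)
      also have "\<dots> = c1 * ab k l s - c2 * a k l s"
        unfolding ab_def a_def fourier_coeff_def \<phi>_def
        using integrable_pairings[OF s] by simp
      finally show "(LINT z|torus2. f s z * (of_real (b (snd z)) * partial_x \<phi> z + of_real \<nu> * laplacian \<phi> z)) = a' k l s"
        by (simp add: a'_def c1_def c2_def)
    qed
  qed simp
  also have "\<dots> = integral {0..t} (a' k l)"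
    by (intro set_borel_integral_eq_integral borel_integrable_atLeastAtMost' continuous_on_subset[OF a'_cont]) auto
  finally show ?thesis
    using weak_eq[OF test_function_fourier_mode t, of "- k" "- l"]
    by (simp add: a_def fourier_coeff_def \<phi>_def)
qed

lemma a_0: "a k l 0 = fourier_coeff f0 k l"
  using a_integral[of 0] by simp

text \<open>The shift by \<open>s\<close> restarts the clock, since the contraction is iterated from
  successive starting times.\<close>

lemma a_derivative:
  assumes "0 \<le> s" "t \<in> {0..T}"
  shows "((\<lambda>t. a k l (s + t)) has_vector_derivative a' k l (s + t)) (at t within {0..T})"
proof -
  have d: "((\<lambda>u. fourier_coeff f0 k l + integral {0..u} (a' k l)) has_vector_derivative 0 + a' k l (s + t)) (at (s + t) within {0..s + T})"
    using assms by (intro has_vector_derivative_add has_vector_derivative_const integral_has_vector_derivative continuous_on_subset[OF a'_cont]) auto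
  have "(a k l has_vector_derivative 0 + a' k l (s + t)) (at (s + t) within {0..s + T})"
    by (rule has_vector_derivative_transform[OF _ _ d]) (use assms in \<open>auto simp: a_integral\<close>)
  then have "(a k l has_vector_derivative a' k l (s + t)) (at (s + t) within {0..s + T})" by simp
  then have "(a k l has_vector_derivative a' k l (s + t)) (at (s + t) within (\<lambda>t. s + t) ` {0..T})"
    by (rule has_vector_derivative_within_subset) (use assms in auto)
  moreover have "((\<lambda>t. s + t) has_vector_derivative 1) (at t within {0..T})"
    by (auto intro!: derivative_eq_intros)
  ultimately have "(a k l \<circ> (\<lambda>t. s + t) has_vector_derivative 1 *\<^sub>R a' k l (s + t)) (at t within {0..T})"
    by (intro vector_diff_chain_within)
  then show ?thesis by (simp add: o_def)
qed

text \<open>No energy inequality is available at this stage. Continuity in time bounds the mass near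
  each time, and compactness of the interval does the rest.\<close>

lemma mass_bounded:
  assumes "0 \<le> s"
  obtains M where "0 \<le> M" "\<And>t. t \<in> {s..s + T} \<Longrightarrow> mass (f t) \<le> M"
proof -
  have "\<exists>\<delta>>0. \<forall>u\<ge>0. \<bar>u - t\<bar> < \<delta> \<longrightarrow> mass (f u) \<le> 2 + 2 * mass (f t)" if t: "0 \<le> t" for t
  proof -
    obtain \<delta> where \<delta>: "\<delta> > 0" "\<And>u. 0 \<le> u \<Longrightarrow> u \<noteq> t \<Longrightarrow> \<bar>u - t\<bar> < \<delta> \<Longrightarrow> L2_norm (\<lambda>z. f u z - f t z) < 1"
      using order_tendstoD(2)[OF f_tendsto[OF t], of 1] by (auto simp: eventually_at dist_real_def)
    have "mass (f u) \<le> 2 + 2 * mass (f t)" if u: "0 \<le> u" "\<bar>u - t\<bar> < \<delta>" for u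
    proof (cases "u = t")
      case False
      have "mass (\<lambda>z. f u z - f t z) \<le> 1"
        using \<delta>(2)[OF u(1) False u(2)] by (simp add: L2_norm_eq real_sqrt_less_iff[of _ 1, simplified])
      moreover have "mass (\<lambda>z. (f u z - f t z) + f t z) \<le> 2 * mass (\<lambda>z. f u z - f t z) + 2 * mass (f t)"
        by (intro L2_torus_add(2) L2_torus_diff(1) f_L2 u t)
      ultimately show ?thesis by simp
    qed (use mass_nonneg[of "f t"] in simp)
    then show ?thesis using \<delta>(1) by blast
  qed
  then obtain \<delta> where \<delta>: "\<And>t. 0 \<le> t \<Longrightarrow> \<delta> t > 0 \<and> (\<forall>u\<ge>0. \<bar>u - t\<bar> < \<delta> t \<longrightarrow> mass (f u) \<le> 2 + 2 * mass (f t))"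
    by metis
  obtain F where F: "F \<subseteq> {s..s + T}" "finite F" "{s..s + T} \<subseteq> (\<Union>t\<in>F. ball t (\<delta> t))"
  proof (rule compactE_image[of "{s..s + T}" "{s..s + T}" "\<lambda>t. ball t (\<delta> t)"])
    show "{s..s + T} \<subseteq> (\<Union>t\<in>{s..s + T}. ball t (\<delta> t))" 
    proof
      fix u assume "u \<in> {s..s + T}"
      moreover from this have "0 < \<delta> u" using \<delta>[of u] assms by simp
      ultimately show "u \<in> (\<Union>t\<in>{s..s + T}. ball t (\<delta> t))" by (intro UN_I[of u]) auto
    qed
  qed auto
  define M where "M = (\<Sum>t\<in>F. 2 + 2 * mass (f t))"
  show thesis
  proof (rule that[of M])
    show "0 \<le> M" using mass_nonneg by (simp add: M_def sum_nonneg)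
    fix u assume u: "u \<in> {s..s + T}"
    then obtain t where t: "t \<in> F" "u \<in> ball t (\<delta> t)" using F(3) by blast
    then have "\<bar>u - t\<bar> < \<delta> t" by (simp add: dist_real_def abs_minus_commute)
    moreover have "0 \<le> t" "0 \<le> u" using t(1) F(1) assms u by auto
    ultimately have "mass (f u) \<le> 2 + 2 * mass (f t)" using \<delta>[of t] by blast
    also have "\<dots> \<le> M" unfolding M_def using t F mass_nonneg
      by (intro member_le_sum[of t F "\<lambda>t. 2 + 2 * mass (f t)"]) auto
    finally show "mass (f u) \<le> M" .
  qed
qed

end

section \<open>Trigonometric sums in \<open>y\<close> and the mollified mode\<close>

definition mode_sum :: "nat \<Rightarrow> (int \<Rightarrow> complex) \<Rightarrow> real \<Rightarrow> complex" where
  "mode_sum N c y = (\<Sum>l = - int N..int N. c l * cis (2 * pi * of_int l * y))"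

lemma mode_sum_derivative:
  "(mode_sum N c has_vector_derivative mode_sum N (\<lambda>l. (2 * of_real pi * \<i> * of_int l) * c l) y) (at y within S)"
  unfolding mode_sum_def[abs_def]
proof (rule has_vector_derivative_sum)
  fix l :: int
  show "((\<lambda>y. c l * cis (2 * pi * of_int l * y)) has_vector_derivative
      2 * of_real pi * \<i> * of_int l * c l * cis (2 * pi * of_int l * y)) (at y within S)"
    by (rule has_vector_derivative_eq_rhs, rule has_vector_derivative_mult_right[OF has_vector_derivative_cis])
       (auto intro!: derivative_eq_intros)
qed

lemma mode_sum_cont:
  assumes "\<And>l. continuous_on S (\<lambda>t. c t l)"
  shows "continuous_on (S \<times> B) (\<lambda>(t, y). mode_sum N (c t) y)"
proof -
  have "continuous_on (S \<times> B) (\<lambda>z. c (fst z) l)" for l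
    by (rule continuous_on_compose2[OF assms]) (auto intro: continuous_on_fst)
  then show ?thesis
    unfolding mode_sum_def case_prod_beta by (intro continuous_intros)
qed

lemma mode_sum_period: "mode_sum N c 1 = mode_sum N c 0"
proof -
  have "cis (2 * pi * of_int l) = 1" for l using cis_multiple_2pi[of "of_int l"] by simp
  then show ?thesis by (simp add: mode_sum_def)
qed

lemma mode_sum_scale: "mode_sum N (\<lambda>l. \<gamma> * c l) y = \<gamma> * mode_sum N c y"
  by (simp add: mode_sum_def sum_distrib_left mult.assoc)

lemma integral_mode_sum: "integral {0..1} (\<lambda>y. (cmod (mode_sum N c y))\<^sup>2) = (\<Sum>l = - int N..int N. (cmod (c l))\<^sup>2)"
proof -
  define e where "e l y = cis (2 * pi * of_int l * y)" for l :: int and y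
  have e: "e l y * cnj (e l' y) = e (l - l') y" for l l' y
    by (simp add: e_def cis_cnj cis_mult algebra_simps)
  have ei: "(e l has_integral (if l = 0 then 1 else 0)) {0..1}" for l
    unfolding integral_cis_period[of l, symmetric] e_def[abs_def]
    by (intro integrable_integral integrable_continuous_interval continuous_intros)
  have "complex_of_real ((cmod (mode_sum N c y))\<^sup>2) = (\<Sum>l = - int N..int N. \<Sum>l' = - int N..int N. c l * cnj (c l') * e (l - l') y)" for y
    unfolding complex_norm_square mode_sum_def cnj_sum sum_product e_def[symmetric] e[symmetric]
    by (simp add: mult_ac)
  moreover have "((\<lambda>y. \<Sum>l = - int N..int N. \<Sum>l' = - int N..int N. c l * cnj (c l') * e (l - l') y) has_integral
      (\<Sum>l = - int N..int N. \<Sum>l' = - int N..int N. c l * cnj (c l') * (if l - l' = 0 then 1 else 0))) {0..1}"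
    by (intro has_integral_sum has_integral_mult_right ei) auto
  moreover have "(\<Sum>l = - int N..int N. \<Sum>l' = - int N..int N. c l * cnj (c l') * (if l - l' = 0 then 1 else 0))
      = of_real (\<Sum>l = - int N..int N. (cmod (c l))\<^sup>2)"
    unfolding of_real_sum complex_norm_square
    by (intro sum.cong refl) (simp add: if_distrib[of "\<lambda>x. _ * x"] sum.delta cong: if_cong)
  ultimately have "((\<lambda>y. complex_of_real ((cmod (mode_sum N c y))\<^sup>2)) has_integral of_real (\<Sum>l = - int N..int N. (cmod (c l))\<^sup>2)) {0..1}"
    by (simp only:)
  from has_integral_Re[OF this] show ?thesis by (simp only: Re_complex_of_real integral_unique)
qed

context weak_solution
begin

lemma L_nonneg: "0 \<le> L"
proof -
  have "0 \<le> L * \<bar>sin (pi * (1 / 2 - 0))\<bar>" by (rule order_trans[OF abs_ge_zero b_lip]) auto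
  then show ?thesis by simp
qed

text \<open>The Fejer mean in \<open>y\<close> commutes with time derivative and diffusion, so these
  cancel. What remains is \<open>2 * pi * \<i> * k\<close> times the integral of \<open>f\<close>
  against the exponential in \<open>x\<close>, the kernel and \<open>b y - b (snd z)\<close>;
  \<open>b_lip\<close> supplies the sine that tames the kernel. The solution enters through its mass
  alone.\<close>

lemma residual_bound:
  assumes t: "0 \<le> t" and y: "y \<in> {0..1}" and N: "N > 0"
  defines "w \<equiv> \<lambda>l. complex_of_real (fejer_weight N l)"
  shows "cmod (mode_sum N (\<lambda>l. w l * a' k l t) y + \<i> * of_real (2 * pi * of_int k * b y) * mode_sum N (\<lambda>l. w l * a k l t) y
      - of_real \<nu> * (mode_sum N (\<lambda>l. (2 * of_real pi * \<i> * of_int l) * ((2 * of_real pi * \<i> * of_int l) * (w l * a k l t))) y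
        - of_real ((2 * pi * of_int k)\<^sup>2) * mode_sum N (\<lambda>l. w l * a k l t) y))
    \<le> \<bar>2 * pi * of_int k\<bar> * (L * ((1 + mass (f t)) / (2 * sqrt (real N))))"
    (is "cmod ?R \<le> _")
proof -
  define E where "E l = w l * cis (2 * pi * of_int l * y)" for l
  define \<psi> where "\<psi> z = f t z * (of_real (b y - b (snd z)) * fourier_mode (- k) 0 z)" for z
  have Ri: "integrable torus2 (\<lambda>z. f t z * (of_real (b y - b (snd z)) * fourier_mode (- k) (- l) z))"
    and RI: "(LINT z|torus2. f t z * (of_real (b y - b (snd z)) * fourier_mode (- k) (- l) z)) = b y * a k l t - ab k l t" for l
  proof -
    have eq: "f t z * (of_real (b y - b (snd z)) * fourier_mode (- k) (- l) z)
        = b y * (f t z * fourier_mode (- k) (- l) z) - f t z * (of_real (b (snd z)) * fourier_mode (- k) (- l) z)" for z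
      by (simp add: algebra_simps)
    show "integrable torus2 (\<lambda>z. f t z * (of_real (b y - b (snd z)) * fourier_mode (- k) (- l) z))"
      unfolding eq by (intro Bochner_Integration.integrable_diff integrable_mult_right integrable_pairings t)
    show "(LINT z|torus2. f t z * (of_real (b y - b (snd z)) * fourier_mode (- k) (- l) z)) = b y * a k l t - ab k l t"
      unfolding eq a_def ab_def fourier_coeff_def
      using integrable_pairings[OF t] by simp
  qed
  have conv: "\<psi> z * of_real (fejer N (y - snd z))
      = (\<Sum>l = - int N..int N. E l * (f t z * (of_real (b y - b (snd z)) * fourier_mode (- k) (- l) z)))" for z
  proof -
    have "fourier_mode (- k) (- l) z = fourier_mode (- k) 0 z * fourier_mode 0 (- l) z" for l
      by (simp add: fourier_mode_mult)
    then show ?thesis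
      unfolding fejer_shift_expansion[OF N] sum_distrib_left \<psi>_def E_def w_def
      by (intro sum.cong refl) (simp add: mult_ac)
  qed
  have \<psi>i: "integrable torus2 (\<lambda>z. \<psi> z * of_real (fejer N (y - snd z)))"
    unfolding conv by (intro Bochner_Integration.integrable_sum integrable_mult_right Ri)
  have "(LINT z|torus2. \<psi> z * of_real (fejer N (y - snd z))) = (\<Sum>l = - int N..int N. E l * (b y * a k l t - ab k l t))"
    unfolding conv using Ri by (simp only: Bochner_Integration.integral_sum[OF integrable_mult_right[OF Ri]] integral_mult_right_zero RI)
  moreover have "?R = (\<i> * of_real (2 * pi * of_int k)) * (\<Sum>l = - int N..int N. E l * (b y * a k l t - ab k l t))"
  proof -
    have "?R = (\<Sum>l = - int N..int N. w l * a' k l t * cis (2 * pi * of_int l * y)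
        + \<i> * of_real (2 * pi * of_int k * b y) * (w l * a k l t * cis (2 * pi * of_int l * y))
        - of_real \<nu> * ((2 * of_real pi * \<i> * of_int l) * ((2 * of_real pi * \<i> * of_int l) * (w l * a k l t)) * cis (2 * pi * of_int l * y)
          - of_real ((2 * pi * of_int k)\<^sup>2) * (w l * a k l t * cis (2 * pi * of_int l * y))))"
      unfolding mode_sum_def by (simp only: sum_distrib_left sum.distrib sum_subtractf right_diff_distrib)
    also have "\<dots> = (\<Sum>l = - int N..int N. (\<i> * of_real (2 * pi * of_int k)) * (E l * (b y * a k l t - ab k l t)))"
      by (intro sum.cong refl) (simp add: a'_def E_def power2_eq_square algebra_simps)
    finally show ?thesis by (simp only: sum_distrib_left)
  qed
  ultimately have "cmod ?R = \<bar>2 * pi * of_int k\<bar> * cmod (LINT z|torus2. \<psi> z * of_real (fejer N (y - snd z)))"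
    by (simp only: norm_mult norm_ii norm_of_real mult_1)
  also have "\<dots> \<le> \<bar>2 * pi * of_int k\<bar> * (LINT z|torus2. L * ((fejer N (y - snd z) + (cmod (f t z))\<^sup>2) / (2 * sqrt (real N))))"
  proof (intro mult_left_mono Bochner_Integration.integral_norm_bound_integral \<psi>i)
    show "integrable torus2 (\<lambda>z. L * ((fejer N (y - snd z) + (cmod (f t z))\<^sup>2) / (2 * sqrt (real N))))"
      by (intro integrable_mult_right integrable_divide Bochner_Integration.integrable_add fejer_torus2(1)[OF N] L2_torusD(2) f_L2 t)
    fix z assume z: "z \<in> space torus2"
    have "cmod (\<psi> z * of_real (fejer N (y - snd z))) = \<bar>b y - b (snd z)\<bar> * (fejer N (y - snd z) * cmod (f t z))"
      unfolding \<psi>_def norm_mult norm_of_real norm_fourier_mode by (simp add: fejer_nonneg mult_ac)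
    also have "\<dots> \<le> L * \<bar>sin (pi * (y - snd z))\<bar> * (fejer N (y - snd z) * cmod (f t z))"
      using z y by (intro mult_right_mono b_lip mult_nonneg_nonneg fejer_nonneg) auto
    also have "\<dots> = L * (fejer N (y - snd z) * \<bar>sin (pi * (y - snd z))\<bar> * cmod (f t z))" by simp
    also have "\<dots> \<le> L * ((fejer N (y - snd z) + (cmod (f t z))\<^sup>2) / (2 * sqrt (real N)))"
      using L_nonneg fejer_sin_mult_le[OF N] by (intro mult_left_mono) auto
    finally show "norm (\<psi> z * of_real (fejer N (y - snd z))) \<le> L * ((fejer N (y - snd z) + (cmod (f t z))\<^sup>2) / (2 * sqrt (real N)))" .
  qed simp
  also have "(LINT z|torus2. L * ((fejer N (y - snd z) + (cmod (f t z))\<^sup>2) / (2 * sqrt (real N))))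
      = L * ((1 + mass (f t)) / (2 * sqrt (real N)))"
    using fejer_torus2[OF N, of y] L2_torusD(2)[OF f_L2[OF t]]
    by (simp only: integral_mult_right_zero integral_divide_zero Bochner_Integration.integral_add mass_def)
  finally show ?thesis .
qed

text \<open>The \<open>k\<close>-th Fourier coefficient in \<open>x\<close> of the Fejer mean in
  \<open>y\<close>, with clock started at \<open>s\<close>. The factor \<gamma> is for scaling to
  unit energy.\<close>

definition mollified :: "nat \<Rightarrow> int \<Rightarrow> real \<Rightarrow> real \<Rightarrow> real \<Rightarrow> real \<Rightarrow> complex" where
  "mollified N k \<gamma> s t = mode_sum N (\<lambda>l. of_real \<gamma> * (of_real (fejer_weight N l) * a k l (s + t)))"

lemma mollified_approximate_mode:
  assumes N: "N > 0" and s: "0 \<le> s" and T: "0 < T"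
    and M: "\<And>t. t \<in> {s..s + T} \<Longrightarrow> mass (f t) \<le> M"
  obtains Gt Gy Gyy where "approximate_mode b b' (2 * pi * of_int k) \<nu> T
    (\<bar>\<gamma>\<bar> * (\<bar>2 * pi * of_int k\<bar> * (L * ((1 + M) / (2 * sqrt (real N)))))) (mollified N k \<gamma> s) Gt Gy Gyy"
proof -
  define w where "w l = complex_of_real (fejer_weight N l)" for l
  define D where "D l = 2 * of_real pi * \<i> * of_int l" for l :: int
  define c where "c t l = of_real \<gamma> * (w l * a k l (s + t))" for t l
  define c' where "c' t l = of_real \<gamma> * (w l * a' k l (s + t))" for t l
  have shift: "continuous_on {0..T} (\<lambda>t. h (s + t))" if "continuous_on {0..} h" for h :: "real \<Rightarrow> complex"
    by (rule continuous_on_compose2[OF that]) (use s in \<open>auto intro!: continuous_intros\<close>)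
  have cont: "continuous_on {0..T} (\<lambda>t. c t l)" "continuous_on {0..T} (\<lambda>t. c' t l)" for l
    unfolding c_def c'_def by (intro continuous_intros shift a_cont a'_cont)+
  have Dy: "(mode_sum N c has_vector_derivative mode_sum N (\<lambda>l. D l * c l) y) (at y within S)" for c y S
    unfolding D_def by (rule mode_sum_derivative)
  have G: "mollified N k \<gamma> s = (\<lambda>t. mode_sum N (c t))"
    by (simp add: mollified_def[abs_def] c_def[abs_def] w_def)
  have "approximate_mode b b' (2 * pi * of_int k) \<nu> T
    (\<bar>\<gamma>\<bar> * (\<bar>2 * pi * of_int k\<bar> * (L * ((1 + M) / (2 * sqrt (real N)))))) (mollified N k \<gamma> s)
    (\<lambda>t. mode_sum N (c' t)) (\<lambda>t. mode_sum N (\<lambda>l. D l * c t l)) (\<lambda>t. mode_sum N (\<lambda>l. D l * (D l * c t l)))"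
    unfolding G
  proof
    show "((\<lambda>t. mode_sum N (c t) y) has_vector_derivative mode_sum N (c' t) y) (at t within {0..T})"
      if "t \<in> {0..T}" "y \<in> {0..1}" for t y
      unfolding mode_sum_def c_def c'_def
      by (intro has_vector_derivative_sum has_vector_derivative_mult_left has_vector_derivative_mult_right a_derivative s that)
    fix t y :: real assume t: "t \<in> {0..T}" and y: "y \<in> {0..1}"
    have M0: "mass (f (s + t)) \<le> M" "0 \<le> s + t" using M t s by auto
    have scale: "mode_sum N (c t) y = of_real \<gamma> * mode_sum N (\<lambda>l. w l * a k l (s + t)) y"
      "mode_sum N (c' t) y = of_real \<gamma> * mode_sum N (\<lambda>l. w l * a' k l (s + t)) y"
      "mode_sum N (\<lambda>l. D l * (D l * c t l)) y = of_real \<gamma> * mode_sum N (\<lambda>l. D l * (D l * (w l * a k l (s + t)))) y"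
      unfolding mode_sum_scale[symmetric] c_def c'_def by (simp_all only: mult_ac)
    have "cmod (mode_sum N (c' t) y + \<i> * of_real (2 * pi * of_int k * b y) * mode_sum N (c t) y
        - of_real \<nu> * (mode_sum N (\<lambda>l. D l * (D l * c t l)) y - of_real ((2 * pi * of_int k)\<^sup>2) * mode_sum N (c t) y))
      = cmod (of_real \<gamma> * (mode_sum N (\<lambda>l. w l * a' k l (s + t)) y + \<i> * of_real (2 * pi * of_int k * b y) * mode_sum N (\<lambda>l. w l * a k l (s + t)) y
      - of_real \<nu> * (mode_sum N (\<lambda>l. D l * (D l * (w l * a k l (s + t)))) y
        - of_real ((2 * pi * of_int k)\<^sup>2) * mode_sum N (\<lambda>l. w l * a k l (s + t)) y)))"
      unfolding scale by (rule arg_cong[of _ _ cmod]) (simp add: algebra_simps)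
    also have "\<dots> \<le> \<bar>\<gamma>\<bar> * (\<bar>2 * pi * of_int k\<bar> * (L * ((1 + mass (f (s + t))) / (2 * sqrt (real N)))))"
      unfolding norm_mult[of "of_real \<gamma>"] norm_of_real D_def w_def
      by (intro mult_left_mono residual_bound M0 y N) auto
    also have "\<dots> \<le> \<bar>\<gamma>\<bar> * (\<bar>2 * pi * of_int k\<bar> * (L * ((1 + M) / (2 * sqrt (real N)))))"
      using M0 L_nonneg by (intro mult_left_mono divide_right_mono) auto
    finally show "cmod (mode_sum N (c' t) y + \<i> * of_real (2 * pi * of_int k * b y) * mode_sum N (c t) y
        - of_real \<nu> * (mode_sum N (\<lambda>l. D l * (D l * c t l)) y - of_real ((2 * pi * of_int k)\<^sup>2) * mode_sum N (c t) y))
      \<le> \<bar>\<gamma>\<bar> * (\<bar>2 * pi * of_int k\<bar> * (L * ((1 + M) / (2 * sqrt (real N)))))" .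
  qed (use b' b_periodic \<nu> T in \<open>auto simp: mode_sum_period intro!: Dy mode_sum_cont cont continuous_intros\<close>)
  then show thesis by (rule that)
qed

end

section \<open>Energy of a single mode, its decay, and summation over the modes\<close>

context weak_solution
begin

definition partial_mass :: "nat \<Rightarrow> int \<Rightarrow> real \<Rightarrow> real" where
  "partial_mass N k t = (\<Sum>l = - int N..int N. (cmod (a k l t))\<^sup>2)"

text \<open>The sum of \<open>|a k l t|^2\<close> over all \<open>l\<close>, as the supremum of
  increasing partial sums; Bessel's inequality bounds these for \<open>t \<ge> 0\<close>.\<close>

definition mode_mass :: "int \<Rightarrow> real \<Rightarrow> real" where
  "mode_mass k t = (SUP N. partial_mass N k t)"

definition mollified_mass :: "nat \<Rightarrow> int \<Rightarrow> real \<Rightarrow> real" where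
  "mollified_mass N k t = (\<Sum>l = - int N..int N. (fejer_weight N l)\<^sup>2 * (cmod (a k l t))\<^sup>2)"

lemma partial_mass_mono: "M \<le> N \<Longrightarrow> partial_mass M k t \<le> partial_mass N k t"
  unfolding partial_mass_def by (intro sum_mono2) auto

lemma sum_partial_mass_le:
  assumes g: "g \<in> L2_torus" and "\<And>k l. a k l t = fourier_coeff g k l" and "N \<le> M"
  shows "(\<Sum>k = - int N..int N. partial_mass M k t) \<le> mass g"
proof -
  have "(\<Sum>k = - int N..int N. partial_mass M k t) \<le> (\<Sum>k = - int M..int M. partial_mass M k t)"
    using assms(3) by (intro sum_mono2) (auto simp: partial_mass_def sum_nonneg)
  also have "\<dots> = (\<Sum>(k, l)\<in>{- int M..int M} \<times> {- int M..int M}. (cmod (fourier_coeff g k l))\<^sup>2)"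
    by (simp add: partial_mass_def assms(2) sum.cartesian_product)
  also have "\<dots> \<le> mass g" using fourier_defect_nonneg[OF g, of M] by (simp add: fourier_defect_def)
  finally show ?thesis .
qed

lemma partial_mass_le_mass:
  assumes "0 \<le> t"
  shows "partial_mass N k t \<le> mass (f t)"
proof -
  define M where "M = max N (nat \<bar>k\<bar>)"
  have "partial_mass N k t \<le> partial_mass M k t" by (rule partial_mass_mono) (simp add: M_def)
  also have "\<dots> \<le> (\<Sum>k = - int M..int M. partial_mass M k t)"
    by (rule member_le_sum) (auto simp: M_def partial_mass_def sum_nonneg)
  also have "\<dots> \<le> mass (f t)" by (rule sum_partial_mass_le[OF f_L2[OF assms]]) (auto simp: a_def)
  finally show ?thesis .
qed

lemma partial_mass_bdd: "0 \<le> t \<Longrightarrow> bdd_above (range (\<lambda>N. partial_mass N k t))"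
  using partial_mass_le_mass by (intro bdd_aboveI2)

lemma partial_mass_le_mode_mass: "0 \<le> t \<Longrightarrow> partial_mass N k t \<le> mode_mass k t"
  unfolding mode_mass_def by (intro cSUP_upper partial_mass_bdd) auto

lemma partial_mass_tendsto: "0 \<le> t \<Longrightarrow> (\<lambda>N. partial_mass N k t) \<longlonglongrightarrow> mode_mass k t"
  unfolding mode_mass_def by (intro LIMSEQ_incseq_SUP partial_mass_bdd incseq_SucI partial_mass_mono) auto

lemma mode_mass_nonneg: "0 \<le> t \<Longrightarrow> 0 \<le> mode_mass k t"
  using partial_mass_le_mode_mass[of t 0 k] by (auto intro: order_trans[rotated] simp: partial_mass_def)

lemma fejer_weight_bounds:
  assumes "N > 0" "l \<in> {- int N..int N}"
  shows "0 \<le> fejer_weight N l" "fejer_weight N l \<le> 1"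
proof -
  have "\<bar>real_of_int l\<bar> \<le> real N" using assms(2) by auto
  then show "0 \<le> fejer_weight N l" "fejer_weight N l \<le> 1"
    using assms(1) by (auto simp: fejer_weight_def divide_le_eq)
qed

lemma mollified_mass_le: "0 < N \<Longrightarrow> 0 \<le> t \<Longrightarrow> mollified_mass N k t \<le> mode_mass k t"
proof -
  assume N: "0 < N" and t: "0 \<le> t"
  have "mollified_mass N k t \<le> partial_mass N k t"
    unfolding mollified_mass_def partial_mass_def
    using fejer_weight_bounds[OF N] by (intro sum_mono mult_left_le_one_le power_le_one) auto
  also have "\<dots> \<le> mode_mass k t" by (rule partial_mass_le_mode_mass[OF t])
  finally show ?thesis .
qed

lemma integral_mollified: "integral {0..1} (\<lambda>y. (cmod (mollified N k \<gamma> s t y))\<^sup>2) = \<gamma>\<^sup>2 * mollified_mass N k (s + t)"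
  by (simp add: mollified_def integral_mode_sum mollified_mass_def norm_mult power_mult_distrib sum_distrib_left)

lemma fejer_weight_tendsto: "(\<lambda>N. fejer_weight N l) \<longlonglongrightarrow> 1"
proof -
  have "(\<lambda>N. 1 - \<bar>real_of_int l\<bar> / real N) \<longlonglongrightarrow> 1 - 0" by (intro tendsto_diff tendsto_const lim_const_over_n)
  then show ?thesis by (simp add: fejer_weight_def)
qed

text \<open>Each Fejer weight tends to one, so any fixed block of terms of the mollified mass
  converges to a partial mass. A bound on the former thus passes to every partial mass and to their
  supremum.\<close>

lemma mode_mass_le_limit:
  assumes t: "0 \<le> t" and ev: "\<forall>\<^sub>F N in sequentially. mollified_mass N k t \<le> C N" and C: "C \<longlonglongrightarrow> D"
  shows "mode_mass k t \<le> D"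
proof -
  have "partial_mass M k t \<le> D" for M
  proof (rule tendsto_le[OF trivial_limit_sequentially C])
    have "(\<lambda>N. \<Sum>l = - int M..int M. (fejer_weight N l)\<^sup>2 * (cmod (a k l t))\<^sup>2) \<longlonglongrightarrow> (\<Sum>l = - int M..int M. 1\<^sup>2 * (cmod (a k l t))\<^sup>2)"
      by (intro tendsto_intros fejer_weight_tendsto)
    then show "(\<lambda>N. \<Sum>l = - int M..int M. (fejer_weight N l)\<^sup>2 * (cmod (a k l t))\<^sup>2) \<longlonglongrightarrow> partial_mass M k t"
      by (simp add: partial_mass_def)
    show "\<forall>\<^sub>F N in sequentially. (\<Sum>l = - int M..int M. (fejer_weight N l)\<^sup>2 * (cmod (a k l t))\<^sup>2) \<le> C N"
      using ev eventually_ge_at_top[of M]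
    proof eventually_elim
      case (elim N)
      have "(\<Sum>l = - int M..int M. (fejer_weight N l)\<^sup>2 * (cmod (a k l t))\<^sup>2) \<le> mollified_mass N k t"
        unfolding mollified_mass_def using elim(2) by (intro sum_mono2) auto
      then show ?case using elim(1) by linarith
    qed
  qed
  then show ?thesis unfolding mode_mass_def by (intro cSUP_least) auto
qed

lemma const_over_sqrt_tendsto: "(\<lambda>N. Q / sqrt (real N)) \<longlonglongrightarrow> 0"
  by (intro tendsto_divide_0[OF tendsto_const] filterlim_at_top_imp_at_infinity
      filterlim_compose[OF sqrt_at_top filterlim_real_sequentially])

text \<open>The energy inequality of a mode, derived from continuity in time and the weak equation.
  At fixed \<sigma> the limit in \<open>N\<close> removes the residual; then \<sigma> tends to
  zero.\<close>

lemma mode_mass_mono: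
  assumes s: "0 \<le> s" and t: "0 \<le> t"
  shows "mode_mass k (s + t) \<le> mode_mass k s"
proof (cases "t = 0")
  case False
  then have t: "0 < t" using t by simp
  obtain M where M: "0 \<le> M" "\<And>u. u \<in> {s..s + t} \<Longrightarrow> mass (f u) \<le> M"
    by (rule mass_bounded[OF s, of t]) blast
  define \<rho> where "\<rho> N = \<bar>1\<bar> * (\<bar>2 * pi * of_int k\<bar> * (L * ((1 + M) / (2 * sqrt (real N)))))" for N
  have \<rho>: "\<rho> \<longlonglongrightarrow> 0"
    using const_over_sqrt_tendsto[of "\<bar>2 * pi * of_int k\<bar> * (L * ((1 + M) / 2))"] by (simp add: \<rho>_def[abs_def])
  have le: "mode_mass k (s + t) \<le> mode_mass k s + t * (\<sigma> * M)" if \<sigma>: "0 < \<sigma>" for \<sigma>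
  proof (rule mode_mass_le_limit)
    show "(\<lambda>N. mode_mass k s + t * (\<sigma> * M + (\<rho> N)\<^sup>2 / \<sigma>)) \<longlonglongrightarrow> mode_mass k s + t * (\<sigma> * M)"
    proof -
      have "(\<lambda>N. mode_mass k s + t * (\<sigma> * M + (\<rho> N)\<^sup>2 / \<sigma>)) \<longlonglongrightarrow> mode_mass k s + t * (\<sigma> * M + 0\<^sup>2 / \<sigma>)"
        using \<sigma> by (intro tendsto_intros \<rho>) auto
      then show ?thesis by simp
    qed
    show "\<forall>\<^sub>F N in sequentially. mollified_mass N k (s + t) \<le> mode_mass k s + t * (\<sigma> * M + (\<rho> N)\<^sup>2 / \<sigma>)"
      using eventually_gt_at_top[of 0]
    proof eventually_elim
      case (elim N)
      obtain Gt Gy Gyy where mode: "approximate_mode b b' (2 * pi * of_int k) \<nu> t (\<rho> N) (mollified N k 1 s) Gt Gy Gyy"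
        unfolding \<rho>_def by (rule mollified_approximate_mode[OF elim s t M(2)])
      interpret approximate_mode b b' "2 * pi * of_int k" \<nu> t "\<rho> N" "mollified N k 1 s" Gt Gy Gyy by (rule mode)
      have e: "energy x = mollified_mass N k (s + x)" for x
        by (simp add: energy_def integral_mollified)
      have "energy x \<le> M" if "x \<in> {0..t}" for x
      proof -
        have "mollified_mass N k (s + x) \<le> mode_mass k (s + x)" using that s elim by (intro mollified_mass_le) auto
        also have "\<dots> \<le> M"
          unfolding mode_mass_def using that s
          by (intro cSUP_least order_trans[OF partial_mass_le_mass M(2)]) auto
        finally show ?thesis by (simp add: e)
      qed
      note balance = energy_balance[OF this \<sigma> order_refl less_imp_le[OF t] order_refl]
      have "0 \<le> 2 * \<nu> * integral {0..t} (\<lambda>x. gradient x + (2 * pi * of_int k)\<^sup>2 * energy x)"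
        using dissipation_nonneg[OF order_refl less_imp_le[OF t] order_refl] \<nu> by simp
      with balance have "energy t \<le> energy 0 + t * (\<sigma> * M + (\<rho> N)\<^sup>2 / \<sigma>)"
        unfolding diff_0_right by linarith
      moreover have "energy 0 \<le> mode_mass k s" using mollified_mass_le[OF elim s] by (simp add: e)
      ultimately show ?case by (simp add: e)
    qed
  qed (use s t in auto)
  have "mode_mass k (s + t) \<le> mode_mass k s + \<epsilon>" if "0 < \<epsilon>" for \<epsilon>
  proof -
    \<comment> \<open>This choice of \<sigma> makes the error \<open>t * \<sigma> * M\<close> at
      most \<epsilon>, also when \<open>M = 0\<close>.\<close>
    have "t * (\<epsilon> / (t * M + 1) * M) = \<epsilon> * ((t * M) / (t * M + 1))" by simp
    also have "\<dots> \<le> \<epsilon> * 1" using that t M(1) by (intro mult_left_mono) (auto simp: divide_le_eq_1 add_nonneg_pos)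
    finally show ?thesis using le[of "\<epsilon> / (t * M + 1)"] that t M(1) by (simp add: add_nonneg_pos)
  qed
  then show ?thesis by (rule field_le_epsilon)
qed simp

text \<open>The mollified mode is scaled to unit energy and contracted before \<open>N\<close> tends
  to infinity. Scaling multiplies the residual by \<gamma>, so the energy needs a lower bound \<mu>
  independent of \<open>N\<close>; one nonzero coefficient supplies it.\<close>

lemma mode_mass_contraction:
  assumes k: "k \<noteq> 0" and s: "0 \<le> s" and T: "0 < T" and c: "0 < c" "c \<le> 1"
    and contr: "contracts b b' \<nu> T c"
  shows "mode_mass k (s + T) \<le> (1 - c) * mode_mass k s"
proof (cases "\<exists>l. a k l s \<noteq> 0")
  case False
  then have "mode_mass k s = 0" by (simp add: mode_mass_def partial_mass_def)
  then show ?thesis using mode_mass_mono[OF s, of T k] T by simp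
next
  case True
  then obtain l where l: "a k l s \<noteq> 0" by blast
  \<comment> \<open>For \<open>N \<ge> 2 * \<bar>l\<bar>\<close> the weight of frequency
    \<open>l\<close> is at least one half, whence the factor \<open>1 / 4\<close>.\<close>
  define \<mu> where "\<mu> = (cmod (a k l s))\<^sup>2 / 4"
  have \<mu>: "0 < \<mu>" using l by (simp add: \<mu>_def)
  obtain M where M: "0 \<le> M" "\<And>u. u \<in> {s..s + T} \<Longrightarrow> mass (f u) \<le> M"
    by (rule mass_bounded[OF s, of T]) blast
  define Q where "Q = 1 / sqrt \<mu> * (\<bar>2 * pi * of_int k\<bar> * (L * ((1 + M) / 2))) * T"
  have "\<forall>\<^sub>F N in sequentially. Q / sqrt (real N) < c"
    using order_tendstoD(2)[OF const_over_sqrt_tendsto c(1)] .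
  then have "\<forall>\<^sub>F N in sequentially. mollified_mass N k (s + T) \<le> (1 - c) * mode_mass k s"
    using eventually_gt_at_top[of 0] eventually_ge_at_top[of "nat (2 * \<bar>l\<bar>)"]
  proof eventually_elim
    case (elim N)
    define m where "m = mollified_mass N k s"
    have "\<mu> \<le> (fejer_weight N l)\<^sup>2 * (cmod (a k l s))\<^sup>2"
    proof -
      have "real_of_int (2 * \<bar>l\<bar>) \<le> real N" using elim(3) by linarith
      then have "1 / 2 \<le> fejer_weight N l" using elim(2) by (simp add: fejer_weight_def field_simps)
      then have "(1 / 2)\<^sup>2 \<le> (fejer_weight N l)\<^sup>2" by (intro power_mono) auto
      from mult_right_mono[OF this, of "(cmod (a k l s))\<^sup>2"] show ?thesis by (simp add: \<mu>_def power2_eq_square)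
    qed
    also have "\<dots> \<le> m"
      unfolding m_def mollified_mass_def using elim(3)
      by (intro member_le_sum[of l _ "\<lambda>l. (fejer_weight N l)\<^sup>2 * (cmod (a k l s))\<^sup>2"]) auto
    finally have m: "\<mu> \<le> m" .
    then have m0: "0 < m" using \<mu> by simp
    define \<gamma> where "\<gamma> = 1 / sqrt m"
    have \<gamma>: "\<gamma>\<^sup>2 * m = 1" "\<bar>\<gamma>\<bar> \<le> 1 / sqrt \<mu>"
      using m0 m \<mu> by (auto simp: \<gamma>_def power_divide intro!: divide_left_mono)
    define \<rho> where "\<rho> = \<bar>\<gamma>\<bar> * (\<bar>2 * pi * of_int k\<bar> * (L * ((1 + M) / (2 * sqrt (real N)))))"
    obtain Gt Gy Gyy where mode: "approximate_mode b b' (2 * pi * of_int k) \<nu> T \<rho> (mollified N k \<gamma> s) Gt Gy Gyy"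
      unfolding \<rho>_def by (rule mollified_approximate_mode[OF elim(2) s T M(2)])
    have "\<rho> \<le> 1 / sqrt \<mu> * (\<bar>2 * pi * of_int k\<bar> * (L * ((1 + M) / (2 * sqrt (real N)))))"
      unfolding \<rho>_def using \<gamma>(2) L_nonneg M(1) by (intro mult_right_mono) auto
    then have "\<rho> * T \<le> 1 / sqrt \<mu> * (\<bar>2 * pi * of_int k\<bar> * (L * ((1 + M) / (2 * sqrt (real N))))) * T"
      using T by (intro mult_right_mono) auto
    also have "\<dots> = Q / sqrt (real N)" by (simp add: Q_def)
    finally have \<rho>T: "\<rho> * T \<le> c" using elim(1) by simp
    have "1 \<le> \<bar>2 * pi * of_int k\<bar>"
    proof -
      have "1 * 1 \<le> (2 * pi) * \<bar>real_of_int k\<bar>" using pi_ge_two k by (intro mult_mono) auto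
      then show ?thesis by (simp add: abs_mult)
    qed
    from contr[unfolded contracts_def, rule_format, OF this mode _ \<rho>T] have "\<gamma>\<^sup>2 * mollified_mass N k (s + T) \<le> 1 - c"
      using \<gamma>(1) by (simp add: integral_mollified m_def)
    then have "\<gamma>\<^sup>2 * mollified_mass N k (s + T) * m \<le> (1 - c) * m" using m0 by (intro mult_right_mono) auto
    moreover have "\<gamma>\<^sup>2 * mollified_mass N k (s + T) * m = mollified_mass N k (s + T) * (\<gamma>\<^sup>2 * m)" by (simp only: mult_ac)
    ultimately have "mollified_mass N k (s + T) \<le> (1 - c) * m" by (simp add: \<gamma>(1))
    also have "\<dots> \<le> (1 - c) * mode_mass k s"
      unfolding m_def using c mollified_mass_le[OF elim(2) s] by (intro mult_left_mono) auto
    finally show ?case .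
  qed
  from mode_mass_le_limit[OF _ this tendsto_const] show ?thesis using s T by simp
qed

text \<open>Only whole periods contract. With \<open>n\<close> of them completed,
  \<open>t / T < n + 1\<close>, and \<open>exp c\<close> pays for the unfinished one.\<close>

lemma mode_mass_decay:
  assumes k: "k \<noteq> 0" and t: "0 \<le> t" and T: "0 < T" and c: "0 < c" "c \<le> 1"
    and contr: "contracts b b' \<nu> T c"
  shows "mode_mass k t \<le> exp c * exp (- c * (t / T)) * mode_mass k 0"
proof -
  define n where "n = nat \<lfloor>t / T\<rfloor>"
  have n: "real n \<le> t / T" "t / T < real n + 1" using t T by (auto simp: n_def)
  have iter: "mode_mass k (real j * T) \<le> (1 - c) ^ j * mode_mass k 0" for j
  proof (induction j)
    case (Suc j)
    have "mode_mass k (real j * T + T) \<le> (1 - c) * mode_mass k (real j * T)"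
      using T by (intro mode_mass_contraction[OF k _ T c contr]) auto
    also have "\<dots> \<le> (1 - c) * ((1 - c) ^ j * mode_mass k 0)" using Suc c by (intro mult_left_mono) auto
    finally show ?case by (simp add: algebra_simps)
  qed simp
  have "mode_mass k t \<le> mode_mass k (real n * T)"
    using mode_mass_mono[of "real n * T" "t - real n * T" k] n T by (simp add: field_simps)
  also have "\<dots> \<le> (1 - c) ^ n * mode_mass k 0" by (rule iter)
  also have "\<dots> \<le> exp c * exp (- c * (t / T)) * mode_mass k 0"
  proof (intro mult_right_mono mode_mass_nonneg)
    have "(1 - c) ^ n \<le> exp (- c) ^ n" using c exp_ge_add_one_self[of "- c"] by (intro power_mono) auto
    also have "\<dots> = exp (- c * real n)" by (simp add: exp_of_nat_mult[symmetric] mult.commute)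
    also have "\<dots> \<le> exp (c + - c * (t / T))"
    proof -
      have "c * (t / T) \<le> c * (real n + 1)" using n c by (intro mult_left_mono) auto
      then show ?thesis by (simp add: algebra_simps)
    qed
    finally show "(1 - c) ^ n \<le> exp c * exp (- c * (t / T))" by (simp only: exp_add)
  qed simp
  finally show ?thesis .
qed

text \<open>The mode \<open>k = 0\<close> does not feel the flow. Fubini's theorem makes it vanish
  initially, and the monotonicity of its energy keeps it zero.\<close>

lemma mode_mass_zero:
  assumes mean: "AE y in torus1. (LINT x|torus1. f0 (x, y)) = 0" and t: "0 \<le> t"
  shows "mode_mass 0 t = 0"
proof -
  have "fourier_coeff f0 0 l = 0" for l
  proof -
    have i: "integrable torus2 (\<lambda>z. f0 z * fourier_mode 0 (- l) z)"
      by (intro integrable_mult_bounded[of _ _ 1] L2_torusD(3)[OF f0]) auto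
    have "fourier_coeff f0 0 l = (LINT y|torus1. LINT x|torus1. f0 (x, y) * fourier_mode 0 (- l) (x, y))"
      unfolding fourier_coeff_def using fubini_torus2[OF i] by simp
    also have "\<dots> = (LINT y|torus1. (LINT x|torus1. f0 (x, y)) * fourier_mode 0 (- l) (0, y))"
      by (simp add: fourier_mode_def)
    also have "\<dots> = 0" using mean by (intro integral_eq_zero_AE) auto
    finally show ?thesis .
  qed
  then have "mode_mass 0 0 = 0" by (simp add: mode_mass_def partial_mass_def a_0)
  then show ?thesis using mode_mass_mono[of 0 t 0] mode_mass_nonneg[OF t, of 0] t by simp
qed

text \<open>At time \<open>t\<close> Parseval's identity is required, since the modes must capture
  the whole mass; at time zero Bessel's inequality is enough.\<close>

lemma mass_decay:
  assumes mean: "AE y in torus1. (LINT x|torus1. f0 (x, y)) = 0"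
    and t: "0 \<le> t" and T: "0 < T" and c: "0 < c" "c \<le> 1"
    and contr: "contracts b b' \<nu> T c"
  shows "mass (f t) \<le> exp c * exp (- c * (t / T)) * mass f0"
proof -
  define D where "D = exp c * exp (- c * (t / T))"
  have D: "0 \<le> D" by (simp add: D_def)
  have decay: "mode_mass k t \<le> D * mode_mass k 0" for k
  proof (cases "k = 0")
    case True
    then show ?thesis using mode_mass_zero[OF mean t] mode_mass_nonneg[of 0 0] D by simp
  next
    case False
    then show ?thesis unfolding D_def by (rule mode_mass_decay[OF _ t T c contr])
  qed
  \<comment> \<open>The range of \<open>k\<close> is held at \<open>N\<close> while the range of
    frequencies in \<open>y\<close> grows, which turns partial masses into mode masses.\<close>
  have init: "(\<Sum>k = - int N..int N. mode_mass k 0) \<le> mass f0" for N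
  proof (rule tendsto_upperbound[OF _ _ trivial_limit_sequentially])
    show "(\<lambda>M. \<Sum>k = - int N..int N. partial_mass M k 0) \<longlonglongrightarrow> (\<Sum>k = - int N..int N. mode_mass k 0)"
      by (intro tendsto_sum partial_mass_tendsto) auto
    show "\<forall>\<^sub>F M in sequentially. (\<Sum>k = - int N..int N. partial_mass M k 0) \<le> mass f0"
      using eventually_ge_at_top[of N] by eventually_elim (intro sum_partial_mass_le f0 a_0)
  qed
  have "mass (f t) - fourier_defect (f t) N \<le> D * mass f0" for N
  proof -
    have "mass (f t) - fourier_defect (f t) N = (\<Sum>k = - int N..int N. partial_mass N k t)"
      by (simp add: fourier_defect_def partial_mass_def a_def sum.cartesian_product)
    also have "\<dots> \<le> (\<Sum>k = - int N..int N. D * mode_mass k 0)"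
      by (intro sum_mono order_trans[OF partial_mass_le_mode_mass[OF t] decay])
    also have "\<dots> \<le> D * mass f0"
      unfolding sum_distrib_left[symmetric] using init D by (intro mult_left_mono)
    finally show ?thesis .
  qed
  moreover have "(\<lambda>N. mass (f t) - fourier_defect (f t) N) \<longlonglongrightarrow> mass (f t) - 0"
    using parseval_L2[OF f_L2[OF t]] unfolding parseval_def by (intro tendsto_intros) auto
  ultimately show ?thesis
    unfolding D_def[symmetric] using tendsto_upperbound[OF _ always_eventually trivial_limit_sequentially] by fastforce
qed

end

section \<open>The decay estimate\<close>

lemma rate_ratio_tendsto:
  assumes q: "0 < q"
  shows "((\<lambda>\<nu>::real. \<nu> / (\<nu> * \<bar>ln \<nu>\<bar> powr q)) \<longlongrightarrow> 0) (at_right 0)"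
proof -
  have "filterlim (\<lambda>\<nu>::real. - ln \<nu>) at_top (at_right 0)"
    using ln_at_0 by (simp add: filterlim_uminus_at_top)
  then have "((\<lambda>\<nu>::real. (- ln \<nu>) powr (- q)) \<longlongrightarrow> 0) (at_right 0)"
    using q by (intro tendsto_neg_powr) auto
  moreover have "\<forall>\<^sub>F \<nu>::real in at_right 0. (- ln \<nu>) powr (- q) = \<nu> / (\<nu> * \<bar>ln \<nu>\<bar> powr q)"
    using eventually_at_right_real[of 0 "1::real", OF zero_less_one]
    by eventually_elim (simp add: powr_minus_divide)
  ultimately show ?thesis by (rule Lim_transform_eventually)
qed

theorem corollary2:
  fixes b :: "real \<Rightarrow> real" and m :: nat and y h p c :: "nat \<Rightarrow> real"
  assumes periodic: "\<And>s. b (s + 1) = b s"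
    and smooth: "\<And>k s. (deriv ^^ k) b differentiable (at s)"
    and critical: "finite {s \<in> {0..<1}. deriv b s = 0}"
    and m: "m \<ge> 1"
    and degenerate: "{s \<in> {0..<1}. \<forall>k\<ge>1. (deriv ^^ k) b s = 0} = y ` {1..m}"
    and pos: "\<And>i. i \<in> {1..m} \<Longrightarrow> h i > 0 \<and> p i > 0"
    and flat: "\<And>i r. i \<in> {1..m} \<Longrightarrow> r \<in> {- h i..h i} - {0} \<Longrightarrow>
      b (y i + r) - b (y i) = c i * exp (- (1 / \<bar>r\<bar> powr p i))"
  shows "dissipation_enhancing b (\<lambda>\<nu>. \<nu> * \<bar>ln \<nu>\<bar> powr (2 / Max (p ` {1..m})))"
proof -
  define P where "P = Max (p ` {1..m})"
  have pP: "p i \<le> P" if "i \<in> {1..m}" for i using that by (simp add: P_def)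
  have P: "P > 0" using pP[of 1] pos[of 1] m by auto
  define b' b'' where "b' = deriv b" and "b'' = deriv b'"
  have der: "((deriv ^^ j) b has_real_derivative (deriv ^^ Suc j) b s) (at s)" for j s
    using smooth[of j s] by (simp add: DERIV_deriv_iff_real_differentiable)
  have b': "(b has_real_derivative b' s) (at s)" for s using der[of 0 s] by (simp add: b'_def)
  have b'': "(b' has_real_derivative b'' s) (at s)" for s using der[of 1 s] by (simp add: b'_def b''_def)
  have b'''': "(b'' has_real_derivative deriv b'' s) (at s)" for s
    using der[of 2 s] by (simp add: b'_def b''_def numeral_2_eq_2)
  have cont: "continuous_on UNIV b'" "continuous_on UNIV b''"
    using b'' b'''' by (meson DERIV_continuous continuous_at_imp_continuous_on)+
  have per: "b 1 = b 0" using periodic[of 0] by simp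
  obtain C0 where C0: "0 < C0" "C0 \<le> 1" "\<And>r s. 0 < r \<Longrightarrow> r \<le> 1 \<Longrightarrow> s \<in> {0..1} \<Longrightarrow>
    (\<And>z. z \<in> {0..1} \<Longrightarrow> deriv b z = 0 \<Longrightarrow> r \<le> \<bar>s - z\<bar>) \<Longrightarrow> C0 * exp (- (1 / r powr P)) \<le> \<bar>deriv b s\<bar>"
    by (rule derivative_lower_bound[where b = b and y = y and h = h and p = p and c = c and m = m and P = P])
       (use periodic smooth critical degenerate pos flat P pP in blast)+
  define Z where "Z = {z \<in> {0..1}. b' z = 0}"
  \<comment> \<open>The hypothesis counts critical points in \<open>{0..<1}\<close>; the closed
    interval adds at most the point 1.\<close>
  have Z: "finite Z"
  proof (rule finite_subset)
    show "Z \<subseteq> insert 1 {s \<in> {0..<1}. deriv b s = 0}" by (auto simp: Z_def b'_def)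
  qed (use critical in simp)
  have off: "C0 * exp (- (1 / r powr P)) \<le> \<bar>b' s\<bar>"
    if "0 < r" "r \<le> 1" "s \<in> {0..1}" "\<And>z. z \<in> Z \<Longrightarrow> r \<le> \<bar>s - z\<bar>" for r s
    unfolding b'_def using that by (intro C0(3)) (auto simp: Z_def b'_def)
  obtain d \<Lambda> where d: "0 < d" "d \<le> 1 / 8"
    and \<Lambda>: "\<And>\<nu>. 0 < \<nu> \<Longrightarrow> \<nu> < 1 \<Longrightarrow> 0 < \<Lambda> \<nu> \<and> \<bar>ln \<nu>\<bar> powr (2 / P) \<le> (\<Lambda> \<nu>)\<^sup>2"
    and contr: "\<And>\<nu>. 0 < \<nu> \<Longrightarrow> \<nu> < 1 \<Longrightarrow> contracts b b' \<nu> (1 / (\<nu> * (\<Lambda> \<nu>)\<^sup>2)) d"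
    by (rule contraction_constants[OF b' b'' cont(2) Z C0(1,2) P off]) blast+
  obtain L where L: "\<And>s. s \<in> {0..1} \<Longrightarrow> \<bar>b' s\<bar> \<le> L"
  proof -
    have "bounded (b' ` {0..1})"
      by (intro compact_imp_bounded compact_continuous_image continuous_on_subset[OF cont(1)]) auto
    then obtain L where "\<forall>x\<in>b' ` {0..1}. norm x \<le> L" unfolding bounded_iff by blast
    then have "\<bar>b' s\<bar> \<le> L" if "s \<in> {0..1}" for s using that by auto
    then show thesis using that by blast
  qed
  have lip: "\<bar>b x - b s\<bar> \<le> 2 * L * \<bar>sin (pi * (x - s))\<bar>" if "x \<in> {0..1}" "s \<in> {0..1}" for x s
  proof (rule lipschitz_on_circle[OF _ per that])
    fix x s :: real assume "x \<in> {0..1}" "s \<in> {0..1}"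
    then have "norm (b x - b s) \<le> L * norm (x - s)"
      by (intro field_differentiable_bound[of "{0..1}" b b']) (auto intro: DERIV_subset[OF b'] L)
    then show "\<bar>b x - b s\<bar> \<le> L * \<bar>x - s\<bar>" by simp
  qed
  \<comment> \<open>\<open>(\<Lambda> \<nu>)\<^sup>2\<close> dominates the logarithm, so
    \<open>1 / T\<close> dominates the rate. The mass decays with constant \<open>d\<close>, its
    square root with \<open>d / 2\<close>.\<close>
  have decay: "L2_norm (f t) \<le> exp (d / 2) * exp (- (d / 2) * (\<nu> * \<bar>ln \<nu>\<bar> powr (2 / P)) * t) * L2_norm f0"
    if \<nu>: "\<nu> \<in> {0<..<1}" and f0: "f0 \<in> L2_torus" and mean: "AE y in torus1. (LINT x|torus1. f0 (x, y)) = 0"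
      and sol: "advection_diffusion_solution b \<nu> f0 f" and t: "0 \<le> t" for \<nu> f0 f t
  proof -
    define T where "T = 1 / (\<nu> * (\<Lambda> \<nu>)\<^sup>2)"
    define rate where "rate = \<nu> * \<bar>ln \<nu>\<bar> powr (2 / P)"
    have T: "0 < T" using \<Lambda>[of \<nu>] \<nu> by (simp add: T_def)
    have contracts: "contracts b b' \<nu> T d"
      unfolding T_def using contr \<nu> by simp
    have rate: "rate \<le> 1 / T" using \<Lambda>[of \<nu>] \<nu> by (simp add: T_def rate_def)
    interpret weak_solution b b' "2 * L" \<nu> f0 f
      by unfold_locales (use b' cont per lip \<nu> sol f0 in auto)
    have "mass (f t) \<le> exp d * exp (- d * (t / T)) * mass f0"
      using d by (intro mass_decay mean t T contracts) auto
    also have "\<dots> \<le> exp d * exp (- d * (rate * t)) * mass f0"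
    proof (intro mult_right_mono mult_left_mono)
      have "rate * t \<le> 1 / T * t" using rate t by (rule mult_right_mono)
      then have "d * (rate * t) \<le> d * (1 / T * t)" using d by (intro mult_left_mono) auto
      then show "exp (- d * (t / T)) \<le> exp (- d * (rate * t))" by simp
    qed (auto simp: mass_nonneg)
    also have "exp d * exp (- d * (rate * t)) = (exp (d / 2) * exp (- (d / 2) * rate * t))\<^sup>2"
      by (simp add: power2_eq_square flip: exp_add)
    finally have "sqrt (mass (f t)) \<le> sqrt ((exp (d / 2) * exp (- (d / 2) * rate * t))\<^sup>2 * mass f0)"
      by (rule real_sqrt_le_mono)
    then show ?thesis by (simp add: L2_norm_eq real_sqrt_mult rate_def)
  qed
  show ?thesis
    unfolding dissipation_enhancing_def P_def[symmetric]
  proof (intro conjI ballI)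
    show "0 < \<nu> * \<bar>ln \<nu>\<bar> powr (2 / P)" if "\<nu> \<in> {0<..<1}" for \<nu> using that by simp
    show "((\<lambda>\<nu>. \<nu> / (\<nu> * \<bar>ln \<nu>\<bar> powr (2 / P))) \<longlongrightarrow> 0) (at_right 0)"
      using P by (intro rate_ratio_tendsto) simp
    show "\<exists>C>0. \<exists>c>0. \<forall>\<nu>\<in>{0<..<1}. \<forall>f0\<in>L2_torus. \<forall>f. (AE y in torus1. (LINT x|torus1. f0 (x, y)) = 0) \<longrightarrow>
        advection_diffusion_solution b \<nu> f0 f \<longrightarrow>
        (\<forall>t\<ge>0. L2_norm (f t) \<le> C * exp (- c * (\<nu> * \<bar>ln \<nu>\<bar> powr (2 / P)) * t) * L2_norm f0)"
      using decay d(1) by (intro exI[of _ "exp (d / 2)"] conjI exI[of _ "d / 2"] ballI allI impI) auto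
  qed
qed

end
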